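(* As the positive integer $M$ tends to infinity, $$A(M)=\frac{\pi^2M^2}{3\log^2M}+O\left(\frac{M^2\log\log M}{\log^3M}\right).$$
   Context: $\mathcal P$ is the set of odd primes and $\chi_{\mathcal P}:\mathbb N\to\{0,1\}$ its indicator function. For a positive integer $N$, $R(N)=\sum_{n=1}^{N-1}\chi_{\mathcal P}(n)\chi_{\mathcal P}(N-n)$. For a positive integer $m$, $a(m)=\sum_{d\mid m}R(d)$ (sum over positive divisors); this is the coefficient of $z^m$ in $F_N(z)=\sum_{k=0}^{N-1}\left(\sum_{n=1}^{N-1}\chi_{\mathcal P}(n)z^{kn}\right)^2$ for every $N\ge m$. For a positive integer $M$, $A(M)=\sum_{m=1}^{2M}a(m)$. Here $\pi$ is the usual constant. *)

theory Defs
  imports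
    Complex_Main
    "HOL-Library.Indicator_Function"
    "HOL-Library.Landau_Symbols"
    "HOL-Computational_Algebra.Primes"
begin

definition odd_primes :: "nat set" where
  "odd_primes = {p. prime p \<and> odd p}"

definition goldbach_R :: "nat \<Rightarrow> nat" where
  "goldbach_R N = (\<Sum>n = 1..<N. indicator odd_primes n * indicator odd_primes (N - n))"

(* Only meant for m > 0: every natural number divides 0, so the value at 0 is the junk value
   of a sum over an infinite set. *)
definition goldbach_a :: "nat \<Rightarrow> nat" where
  "goldbach_a m = (\<Sum>d | d dvd m. goldbach_R d)"

definition goldbach_A :: "nat \<Rightarrow> nat" where
  "goldbach_A M = (\<Sum>m = 1..2 * M. goldbach_a m)"

end

theory Submission
  imports
    Defs
    "HOL-Number_Theory.Prime_Powers"
    "HOL-Complex_Analysis.Complex_Analysis"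
    "HOL-Probability.Probability"
    "HOL-Real_Asymp.Real_Asymp"
begin

text \<open>
  Exchanging the sums over \<open>m\<close> and its divisors gives \<open>A(M) = (\<Sum>k\<le>N. S(N div k))\<close> with \<open>N = 2 M\<close>, where
  \<open>S(n)\<close> counts the pairs of odd primes with sum at most \<open>n\<close>. If the number of primes up to \<open>n\<close> is
  \<open>n / log n\<close> up to a relative error \<open>O(log log n / log n)\<close>, then \<open>S(n)\<close> is \<open>n\<^sup>2 / (2 log\<^sup>2 n)\<close> up to an
  error of the same relative size, and summing over \<open>k \<le> log\<^sup>3 N\<close> produces the factor
  \<open>(\<Sum>k. 1 / k\<^sup>2) = \<pi>\<^sup>2 / 6\<close>; the remaining \<open>k\<close> are negligible.

  For the prime number theorem with that error, let \<open>Z(s) = (s - 1) \<zeta>(s)\<close>. Just to the right of the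
  line \<open>Re s = 1\<close>, the inequality \<open>3 + 4 cos x + cos 2x \<ge> 0\<close> and polynomial bounds for \<open>Z\<close> and its
  derivatives show that \<open>(Z'/Z)''(s) / s\<close> is bounded. This is, up to sign, the Fourier transform of the
  normalised error in \<open>(\<Sum>n\<le>x. \<Lambda>(n) log\<^sup>2 n)\<close> as a function of \<open>log x\<close>, so Gaussian averages of that
  error are bounded, and the monotonicity of the sum turns this into a pointwise bound.
\<close>

section \<open>Dirichlet series and the von Mangoldt function\<close>

text \<open>The weight log^2 is what makes mere boundedness of the transform enough. A Gaussian of
  width 1/T has mass of order 1/T, so a bounded transform controls means of the normalised error
  only up to O(T). With a weight log^k the main term at v = log x is v^k, and the relative cost of
  the averages is T / v^k. Monotonicity, used over a window slightly wider than 1/T, has a relative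
  cost slightly larger than 1/T. With T = v, the exponent k = 2 is the least one for which the first
  cost is O(1/v). The window must exceed 1/T by a factor log v in order that the Gaussian tails beat
  a cubic trivial bound for the error; this is where log log first enters.

  Division by s allows (Z'/Z)'' to grow like |t|, so crude polynomial bounds for Z suffice, provided
  that they are uniform as Re s tends to 1. All work with the logarithmic derivative stays in Re s >
  1; the passage to the limit is made on the real side, by dominated convergence in the
  averages.\<close>

definition dirichlet_abs_conv :: "(nat \<Rightarrow> real) \<Rightarrow> bool" where
  "dirichlet_abs_conv a \<longleftrightarrow> (\<forall>\<sigma>>1. summable (\<lambda>n. \<bar>a n\<bar> * real n powr (-\<sigma>)))"

text \<open>Index 0 does no harm: \<open>0 powr z\<close> is 0 for every \<open>z\<close>, so its
  term vanishes whatever \<open>a 0\<close> is. The same holds for the real powers in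
  \<open>dirichlet_abs_conv\<close>.\<close>

definition dirichlet_series :: "(nat \<Rightarrow> real) \<Rightarrow> complex \<Rightarrow> complex" where
  "dirichlet_series a s = (\<Sum>n. of_real (a n) * of_nat n powr (-s))"

lemma norm_nat_powr: "norm (of_nat n powr (s::complex)) = real n powr Re s"
  by (cases "n = 0") (auto simp: norm_powr_real_powr)

lemma dirichlet_summable_norm:
  assumes "dirichlet_abs_conv a" "Re s > 1"
  shows "summable (\<lambda>n. norm (of_real (a n) * of_nat n powr (-s) :: complex))"
  using assms unfolding dirichlet_abs_conv_def by (simp add: norm_mult norm_nat_powr)

lemma dirichlet_sums:
  assumes "dirichlet_abs_conv a" "Re s > 1"
  shows "(\<lambda>n. of_real (a n) * of_nat n powr (-s)) sums dirichlet_series a s"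
  unfolding dirichlet_series_def
  by (rule summable_sums[OF summable_norm_cancel[OF dirichlet_summable_norm[OF assms]]])

text \<open>Half of the gap between \<open>\<sigma>\<close> and 1 pays for the logarithm, by
  \<open>ln n \<le> n powr e / e\<close>.\<close>

lemma dirichlet_abs_conv_ln:
  assumes "dirichlet_abs_conv a"
  shows "dirichlet_abs_conv (\<lambda>n. a n * ln (real n))"
  unfolding dirichlet_abs_conv_def
proof (intro allI impI)
  fix \<sigma> :: real assume \<sigma>: "\<sigma> > 1"
  define e where "e = (\<sigma> - 1) / 2"
  have e: "e > 0" "\<sigma> - e > 1" using \<sigma> by (auto simp: e_def field_simps)
  have "summable (\<lambda>n. \<bar>a n\<bar> * real n powr (-(\<sigma> - e)))"
    using assms e unfolding dirichlet_abs_conv_def by blast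
  hence "summable (\<lambda>n. (1 / e) * (\<bar>a n\<bar> * real n powr (-(\<sigma> - e))))"
    by (rule summable_mult)
  thus "summable (\<lambda>n. \<bar>a n * ln (real n)\<bar> * real n powr (-\<sigma>))"
  proof (rule summable_comparison_test_ev[rotated], intro always_eventually allI)
    fix n :: nat
    show "norm (\<bar>a n * ln (real n)\<bar> * real n powr (-\<sigma>)) \<le> (1 / e) * (\<bar>a n\<bar> * real n powr (-(\<sigma> - e)))"
    proof (cases "n = 0")
      case False
      hence n: "real n \<ge> 1" by simp
      have "ln (real n) \<le> real n powr e / e" using ln_powr_bound[OF n e(1)] .
      hence "\<bar>a n\<bar> * ln (real n) * real n powr (-\<sigma>) \<le> \<bar>a n\<bar> * (real n powr e / e) * real n powr (-\<sigma>)"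
        by (intro mult_right_mono mult_left_mono) auto
      also have "\<dots> = (1 / e) * (\<bar>a n\<bar> * real n powr (-(\<sigma> - e)))"
        by (simp add: powr_add[symmetric] algebra_simps)
      finally show ?thesis using n by (simp add: abs_mult)
    qed auto
  qed
qed

lemma has_field_derivative_nat_powr:
  "((\<lambda>s. of_nat n powr (-s)) has_field_derivative - (of_real (ln (real n)) * of_nat n powr (-s))) (at (s::complex))"
proof (cases "n = 0")
  case False
  have "((\<lambda>s. exp (-s * of_real (ln (real n)))) has_field_derivative
      - (of_real (ln (real n)) * exp (-s * of_real (ln (real n))))) (at s)"
    by (auto intro!: derivative_eq_intros)
  with False show ?thesis by (simp add: powr_def flip: Ln_of_nat)
qed auto

text \<open>The series is differentiated term by term in a half-plane whose edge
  \<open>\<sigma>\<close> lies strictly between 1 and \<open>Re s\<close>, where one summable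
  majorant serves all points.\<close>

lemma dirichlet_series_has_derivative:
  assumes a: "dirichlet_abs_conv a" and s: "Re s > 1"
  shows "(dirichlet_series a has_field_derivative - dirichlet_series (\<lambda>n. a n * ln (real n)) s) (at s)"
proof -
  define \<sigma> where "\<sigma> = (1 + Re s) / 2"
  have \<sigma>: "\<sigma> > 1" "Re s > \<sigma>" using s by (auto simp: \<sigma>_def field_simps)
  define S where "S = {z. Re z > \<sigma>}"
  have S: "open S" unfolding S_def by (rule open_halfspace_Re_gt)
  have m1: "summable (\<lambda>n. \<bar>a n\<bar> * real n powr (-\<sigma>))" using a \<sigma> by (auto simp: dirichlet_abs_conv_def)
  have m2: "((\<lambda>s. of_real (a n) * of_nat n powr (-s)) has_field_derivative
        - (of_real (a n * ln (real n)) * of_nat n powr (-z))) (at z)" for n and z :: complex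
    by (rule derivative_eq_intros has_field_derivative_nat_powr refl | simp)+
  have m3: "\<forall>\<^sub>F n in sequentially. \<forall>x\<in>S. norm (of_real (a n) * of_nat n powr (-x) :: complex) \<le> \<bar>a n\<bar> * real n powr (-\<sigma>)"
  proof (intro always_eventually allI ballI)
    fix n :: nat and x assume x: "x \<in> S"
    show "norm (of_real (a n) * of_nat n powr (-x) :: complex) \<le> \<bar>a n\<bar> * real n powr (-\<sigma>)"
      using x by (cases "n = 0") (auto simp: norm_mult norm_nat_powr S_def intro!: mult_left_mono powr_mono)
  qed
  obtain g g' where g: "\<forall>x \<in> S. ((\<lambda>n. of_real (a n) * of_nat n powr (-x)) sums g x) \<and>
     ((\<lambda>n. - (of_real (a n * ln (real n)) * of_nat n powr (-x))) sums g' x) \<and> (g has_field_derivative g' x) (at x)"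
    by (rule series_and_derivative_comparison[OF S m1 m2 m3])
  have sS: "s \<in> S" using \<sigma> by (simp add: S_def)
  have eq: "dirichlet_series a x = g x" if "x \<in> S" for x
    unfolding dirichlet_series_def using g that by (blast dest: sums_unique[symmetric])
  have "g' s = - dirichlet_series (\<lambda>n. a n * ln (real n)) s"
    using g sS sums_unique2 sums_minus[OF dirichlet_sums[OF dirichlet_abs_conv_ln[OF a] s]] by blast
  moreover have "(g has_field_derivative g' s) (at s)" using g sS by blast
  ultimately have "(g has_field_derivative - dirichlet_series (\<lambda>n. a n * ln (real n)) s) (at s)" by simp
  moreover have "\<forall>\<^sub>F z in nhds s. dirichlet_series a z = g z"
    using eventually_nhds_in_open[OF S sS] by eventually_elim (rule eq)
  ultimately show ?thesis
    using DERIV_cong_ev[OF refl _ refl, of "dirichlet_series a" g s] by blast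
qed

lemma dirichlet_abs_conv_bounded:
  assumes "\<And>n. \<bar>a n\<bar> \<le> C"
  shows "dirichlet_abs_conv a"
  unfolding dirichlet_abs_conv_def
proof (intro allI impI)
  fix \<sigma> :: real assume "\<sigma> > 1"
  hence "summable (\<lambda>n. real n powr (-\<sigma>))" by (simp add: summable_real_powr_iff)
  hence "summable (\<lambda>n. C * real n powr (-\<sigma>))" by (rule summable_mult)
  thus "summable (\<lambda>n. \<bar>a n\<bar> * real n powr (-\<sigma>))"
    by (rule summable_comparison_test_ev[rotated])
       (auto intro!: always_eventually mult_right_mono assms)
qed

lemma dirichlet_abs_conv_mono:
  assumes "dirichlet_abs_conv b" "\<And>n. \<bar>a n\<bar> \<le> \<bar>b n\<bar>"
  shows "dirichlet_abs_conv a"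
  unfolding dirichlet_abs_conv_def
proof (intro allI impI)
  fix \<sigma> :: real assume "\<sigma> > 1"
  hence "summable (\<lambda>n. \<bar>b n\<bar> * real n powr (-\<sigma>))" using assms by (auto simp: dirichlet_abs_conv_def)
  thus "summable (\<lambda>n. \<bar>a n\<bar> * real n powr (-\<sigma>))"
    by (rule summable_comparison_test_ev[rotated])
       (auto intro!: always_eventually mult_right_mono assms)
qed

section \<open>The series of zeta and of the von Mangoldt function\<close>

abbreviation zeta_series :: "complex \<Rightarrow> complex" where
  "zeta_series \<equiv> dirichlet_series (\<lambda>_. 1)"

abbreviation mangoldt_series :: "complex \<Rightarrow> complex" where
  "mangoldt_series \<equiv> dirichlet_series mangoldt"

lemma dirichlet_abs_conv_one: "dirichlet_abs_conv (\<lambda>_. 1)"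
  by (rule dirichlet_abs_conv_bounded[of _ 1]) auto

lemma mangoldt_le_ln: "mangoldt n \<le> ln (real n)"
  by (cases "n = 0") (auto intro: mangoldt_le)

lemma dirichlet_abs_conv_mangoldt: "dirichlet_abs_conv mangoldt"
proof (rule dirichlet_abs_conv_mono[OF dirichlet_abs_conv_ln[OF dirichlet_abs_conv_one]])
  fix n show "\<bar>mangoldt n\<bar> \<le> \<bar>1 * ln (real n)\<bar>"
    using mangoldt_le_ln[of n] mangoldt_nonneg[of n] by simp
qed

lemma nat_powr_mult: "of_nat (m * n) powr (s::complex) = of_nat m powr s * of_nat n powr s"
proof (cases "m = 0 \<or> n = 0")
  case False
  hence p: "0 < m" "0 < n" "0 < m * n" by auto
  have "Ln (of_nat (m * n)) = of_real (ln (real (m * n)))" by (rule Ln_of_nat[OF p(3)])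
  also have "\<dots> = Ln (of_nat m) + Ln (of_nat n)"
    using p by (simp add: ln_mult Ln_of_nat)
  finally have "Ln (of_nat (m * n)) = Ln (of_nat m) + (Ln (of_nat n) :: complex)" .
  with False show ?thesis by (simp add: powr_def algebra_simps exp_add)
qed auto

text \<open>Since the values of \<open>mangoldt\<close> at the divisors of n add up to log n, the
  product of the two series is a double sum over pairs (m, d) regrouped by n = m d. Absolute
  summability of the double family permits the regrouping.\<close>

lemma ln_series_eq:
  assumes s: "Re s > 1"
  shows "dirichlet_series (\<lambda>n. ln (real n)) s = zeta_series s * mangoldt_series s"
proof -
  define f :: "nat \<Rightarrow> complex" where "f = (\<lambda>n. of_nat n powr (-s))"
  define g :: "nat \<Rightarrow> complex" where "g = (\<lambda>n. of_real (mangoldt n) * of_nat n powr (-s))"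
  have nf: "summable (\<lambda>n. norm (f n))" and ng: "summable (\<lambda>n. norm (g n))"
    using dirichlet_summable_norm[OF dirichlet_abs_conv_one s] dirichlet_summable_norm[OF dirichlet_abs_conv_mangoldt s]
    by (auto simp: f_def g_def)
  have f0: "f 0 = 0" "g 0 = 0" by (auto simp: f_def g_def)
  \<comment> \<open>Index 0 is left out because every \<open>d\<close> divides it, so its group of
    pairs would be infinite.\<close>
  let ?P = "{0<..} :: nat set"
  have hf: "(f has_sum zeta_series s) UNIV" and hg: "(g has_sum mangoldt_series s) UNIV"
    using norm_summable_imp_has_sum[OF nf] norm_summable_imp_has_sum[OF ng] dirichlet_sums[OF dirichlet_abs_conv_one s]
      dirichlet_sums[OF dirichlet_abs_conv_mangoldt s] by (auto simp: f_def g_def)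
  have hf: "(f has_sum zeta_series s) ?P" and hg: "(g has_sum mangoldt_series s) ?P"
    using has_sum_cong_neutral[of UNIV ?P f f] has_sum_cong_neutral[of UNIV ?P g g] hf hg f0
    by (auto simp: not_less)
  have af: "(\<lambda>n. norm (f n)) summable_on ?P" and ag: "(\<lambda>n. norm (g n)) summable_on ?P"
    using nf ng by (auto intro: summable_on_subset_banach[OF summable_nonneg_imp_summable_on])
  have "(\<lambda>z. norm (f (fst z) * g (snd z))) summable_on (SIGMA x:?P. ?P)"
    unfolding Infinite_Sum.abs_summable_on_Sigma_iff
    using af ag by (auto simp: norm_mult infsum_cmult_right' infsum_nonneg abs_mult
        intro!: summable_on_cmult_right summable_on_cmult_left)
  hence sm: "(\<lambda>(x, y). f x * g y) summable_on ?P \<times> ?P"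
    unfolding case_prod_unfold by (rule Infinite_Sum.abs_summable_summable)
  have 1: "((\<lambda>(x, y). f x * g y) has_sum zeta_series s * mangoldt_series s) (?P \<times> ?P)"
  proof (rule has_sum_SigmaI[where g = "\<lambda>x. f x * mangoldt_series s"])
    show "((\<lambda>x. f x * mangoldt_series s) has_sum zeta_series s * mangoldt_series s) ?P"
      by (intro has_sum_cmult_left hf)
  qed (use sm in \<open>auto intro!: has_sum_cmult_right hg\<close>)
  have "bij_betw (\<lambda>(n, d). (n div d, d)) (SIGMA n:?P. {d. d dvd n}) (?P \<times> ?P)"
    by (rule bij_betwI[where g = "\<lambda>(m, d). (m * d, d)"]) (auto simp: dvd_pos_nat div_greater_zero_iff dvd_imp_le)
  note bij = has_sum_reindex_bij_betw[OF this, of "\<lambda>(x,y). f x * g y"]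
  have 2: "((\<lambda>(n, d). f (n div d) * g d) has_sum zeta_series s * mangoldt_series s) (SIGMA n:?P. {d. d dvd n})"
    using 1 bij by (simp add: case_prod_unfold)
  have 3: "((\<lambda>n. of_real (ln (real n)) * f n) has_sum zeta_series s * mangoldt_series s) ?P"
  proof (rule has_sum_SigmaD[OF 2])
    fix n assume n: "n \<in> ?P"
    have "(\<Sum>d | d dvd n. f (n div d) * g d) = (\<Sum>d | d dvd n. mangoldt d * f n)"
    proof (rule sum.cong)
      fix d assume "d \<in> {d. d dvd n}"
      then obtain k where k: "n = d * k" by auto
      with n have "d > 0" "k > 0" by auto
      thus "f (n div d) * g d = mangoldt d * f n"
        by (simp add: k f_def g_def nat_powr_mult ac_simps del: of_nat_mult)
    qed auto
    also have "\<dots> = of_real (ln (real n)) * f n"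
      using n mangoldt_sum[of n, where ?'a = complex] by (simp add: sum_distrib_right[symmetric])
    finally show "((\<lambda>d. case (n, d) of (n, d) \<Rightarrow> f (n div d) * g d) has_sum of_real (ln (real n)) * f n) {d. d dvd n}"
      using n by (intro has_sum_finiteI) auto
  qed
  have l: "summable (\<lambda>n. norm (of_real (ln (real n)) * f n))"
     "(\<lambda>n. of_real (ln (real n)) * f n) sums dirichlet_series (\<lambda>n. ln (real n)) s"
    using dirichlet_summable_norm[OF dirichlet_abs_conv_ln[OF dirichlet_abs_conv_one] s] 
      dirichlet_sums[OF dirichlet_abs_conv_ln[OF dirichlet_abs_conv_one] s] by (auto simp: f_def)
  have "((\<lambda>n. of_real (ln (real n)) * f n) has_sum dirichlet_series (\<lambda>n. ln (real n)) s) UNIV"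
    using norm_summable_imp_has_sum[OF l] .
  hence "((\<lambda>n. of_real (ln (real n)) * f n) has_sum dirichlet_series (\<lambda>n. ln (real n)) s) ?P"
    using f0 has_sum_cong_neutral[of UNIV ?P "\<lambda>n. of_real (ln (real n)) * f n" "\<lambda>n. of_real (ln (real n)) * f n"]
    by (auto simp: not_less)
  with 3 show ?thesis using has_sum_unique by blast
qed

lemma zeta_series_deriv:
  assumes "Re s > 1"
  shows "(zeta_series has_field_derivative - (zeta_series s * mangoldt_series s)) (at s)"
  using dirichlet_series_has_derivative[OF dirichlet_abs_conv_one assms] ln_series_eq[OF assms] by simp

section \<open>The zeta function without its pole\<close>

text \<open>This is (s - 1) times the difference between n^(-s) and the integral of u^(-s) over
  [n, n + 1]. The factor s - 1 has cleared the denominator of the integral, so the formula also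
  makes sense at s = 1.\<close>

definition zeta_term :: "nat \<Rightarrow> complex \<Rightarrow> complex" where
  "zeta_term n s = (s - 1) * of_nat n powr (-s) + of_nat (Suc n) powr (1 - s) - of_nat n powr (1 - s)"

text \<open>The function Z(s) = (s - 1) \<zeta>(s), continued to the left of Re s = 1. The leading 1
  is (s - 1) times the integral of u^(-s) over [1, \<infinity>).\<close>

definition zeta_reg :: "complex \<Rightarrow> complex" where
  "zeta_reg s = 1 + (\<Sum>n. zeta_term (Suc n) s)"

lemma norm_pos_real_powr: "r > 0 \<Longrightarrow> norm (of_real r powr (s::complex)) = r powr Re s"
  by (simp add: norm_powr_real_powr)

lemma has_field_derivative_powr_pos:
  fixes z s :: complex
  assumes "Re z > 0"
  shows "((\<lambda>u. u powr s) has_field_derivative s * z powr (s - 1)) (at z within A)"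
proof -
  have "z \<notin> \<real>\<^sub>\<le>\<^sub>0" using assms by (auto simp: complex_nonpos_Reals_iff)
  thus ?thesis by (rule has_field_derivative_at_within[OF has_field_derivative_powr])
qed

lemma norm_powr_diff_le:
  assumes n: "n > 0" and s: "Re s \<ge> 0" and r: "real n \<le> r" "r \<le> real (Suc n)"
  shows "norm (of_real r powr (-s) - of_nat n powr (-s)) \<le> norm s * real n powr (- Re s - 1)"
proof -
  let ?S = "closed_segment (of_real (real n)) (of_real (real (Suc n))) :: complex set"
  have "norm (of_real r powr (-s) - of_real (real n) powr (-s)) \<le> (norm s * real n powr (- Re s - 1)) * norm (of_real r - of_real (real n) :: complex)"
  proof (rule field_differentiable_bound[of ?S])
    fix z assume "z \<in> ?S"
    then obtain q where q: "z = of_real q" "real n \<le> q" "q \<le> real (Suc n)"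
      by (subst (asm) closed_segment_of_real) (auto simp: closed_segment_eq_real_ivl)
    have q0: "q > 0" "Re z > 0" using q n by auto
    show "((\<lambda>z. z powr (-s)) has_field_derivative -s * z powr (-s-1)) (at z within ?S)"
      by (rule has_field_derivative_powr_pos[OF q0(2)])
    show "norm (-s * z powr (-s-1)) \<le> norm s * real n powr (- Re s - 1)"
      using q q0 n s by (simp add: norm_mult norm_pos_real_powr mult_left_mono powr_mono2')
  next
    show "of_real r \<in> ?S" unfolding of_real_closed_segment using r by (auto simp: closed_segment_eq_real_ivl)
  qed auto
  also have "\<dots> \<le> (norm s * real n powr (- Re s - 1)) * 1"
  proof (intro mult_left_mono)
    have "norm (of_real (r - real n) :: complex) \<le> 1" unfolding norm_of_real using r by auto
    thus "norm (of_real r - of_real (real n) :: complex) \<le> 1" by simp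
  qed auto
  finally show ?thesis by simp
qed

text \<open>The term is the increment of \<open>?g\<close> over [n, n + 1], and the derivative of
  \<open>?g\<close> is (1 - s) (u^(-s) - n^(-s)); the linear part of \<open>?g\<close> is there to
  subtract n^(-s).\<close>

lemma norm_zeta_term_le_aux:
  assumes n: "n > 0" and B: "\<And>r. real n \<le> r \<Longrightarrow> r \<le> real (Suc n) \<Longrightarrow> norm (of_real r powr (-s) - of_nat n powr (-s)) \<le> B"
  shows "norm (zeta_term n s) \<le> norm (s - 1) * B"
proof -
  let ?S = "closed_segment (of_real (real n)) (of_real (real (Suc n))) :: complex set"
  let ?g = "\<lambda>u. u powr (1 - s) - (1 - s) * of_nat n powr (-s) * u"
  have "norm (?g (of_real (real (Suc n))) - ?g (of_real (real n))) \<le> (norm (s - 1) * B) * norm (of_real (real (Suc n)) - of_real (real n) :: complex)"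
  proof (rule field_differentiable_bound[of ?S])
    fix z assume "z \<in> ?S"
    then obtain q where q: "z = of_real q" "real n \<le> q" "q \<le> real (Suc n)"
      by (subst (asm) closed_segment_of_real) (auto simp: closed_segment_eq_real_ivl)
    have q0: "q > 0" "Re z > 0" using q n by auto
    have "(?g has_field_derivative (1 - s) * z powr (1 - s - 1) - (1 - s) * of_nat n powr (-s)) (at z within ?S)"
      by (rule derivative_eq_intros has_field_derivative_powr_pos[OF q0(2)] refl | simp)+
    thus "(?g has_field_derivative (1 - s) * (z powr (-s) - of_nat n powr (-s))) (at z within ?S)"
      by (simp add: algebra_simps)
    show "norm ((1 - s) * (z powr (-s) - of_nat n powr (-s))) \<le> norm (s - 1) * B"
      using B[OF q(2,3)] by (simp add: q(1) norm_mult norm_minus_commute mult_left_mono)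
  qed auto
  also have "?g (of_real (real (Suc n))) - ?g (of_real (real n)) = zeta_term n s"
    by (simp add: zeta_term_def algebra_simps)
  finally show ?thesis by simp
qed

text \<open>The bounds with |s| n^(-Re s - 1) and with 2 n^(-Re s) are interpolated geometrically,
  with weights \<open>\<theta>\<close> and \<open>1 - \<theta>\<close>. A small
  \<open>\<theta>\<close> means little growth in |s|, at the price of little extra decay in
  n.\<close>

lemma norm_zeta_term_le:
  assumes n: "n > 0" and s: "Re s \<ge> 0" and \<theta>: "0 \<le> \<theta>" "\<theta> \<le> 1"
  shows "norm (zeta_term n s) \<le> 2 * norm (s - 1) * norm s powr \<theta> * real n powr (- Re s - \<theta>)"
proof -
  have 1: "norm (zeta_term n s) \<le> norm (s - 1) * (norm s * real n powr (- Re s - 1))"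
    using n s by (intro norm_zeta_term_le_aux norm_powr_diff_le)
  have 2: "norm (zeta_term n s) \<le> norm (s - 1) * (2 * real n powr (- Re s))"
  proof (rule norm_zeta_term_le_aux[OF n])
    fix r assume r: "real n \<le> r"
    have r0: "r > 0" using r n by linarith
    have "norm (of_real r powr (-s) - of_nat n powr (-s)) \<le> r powr (- Re s) + real n powr (- Re s)"
      using norm_triangle_ineq4[of "of_real r powr (-s)" "of_nat n powr (-s)"] norm_pos_real_powr[OF r0, of "-s"] norm_nat_powr[of n "-s"] by simp
    also have "r powr (- Re s) \<le> real n powr (- Re s)" using r n s by (intro powr_mono2') auto
    finally show "norm (of_real r powr (-s) - of_nat n powr (-s)) \<le> 2 * real n powr (- Re s)" by simp
  qed
  show ?thesis
  proof (cases "zeta_term n s = 0")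
    case False
    hence pos: "norm (zeta_term n s) > 0" by simp
    have s1: "norm (s - 1) > 0" using 1 pos by (cases "s = 1") auto
    have s0: "norm s > 0" using 1 pos by (cases "s = 0") auto
    have "norm (zeta_term n s) = norm (zeta_term n s) powr \<theta> * norm (zeta_term n s) powr (1 - \<theta>)"
      using pos by (simp flip: powr_add)
    also have "\<dots> \<le> (norm (s - 1) * (norm s * real n powr (- Re s - 1))) powr \<theta> * (norm (s - 1) * (2 * real n powr (- Re s))) powr (1 - \<theta>)"
      using 1 2 \<theta> by (intro mult_mono powr_mono2) auto
    also have "\<dots> = (norm (s - 1) powr \<theta> * norm (s - 1) powr (1 - \<theta>)) * norm s powr \<theta> * 2 powr (1 - \<theta>) *
        (real n powr ((- Re s - 1) * \<theta>) * real n powr ((- Re s) * (1 - \<theta>)))"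
      by (simp add: powr_mult powr_powr)
    also have "norm (s - 1) powr \<theta> * norm (s - 1) powr (1 - \<theta>) = norm (s - 1)"
      using s1 by (simp flip: powr_add)
    also have "real n powr ((- Re s - 1) * \<theta>) * real n powr ((- Re s) * (1 - \<theta>)) = real n powr (- Re s - \<theta>)"
      unfolding powr_add[symmetric] by (rule arg_cong[of _ _ "\<lambda>x. real n powr x"]) (simp add: algebra_simps)
    also have "norm (s - 1) * norm s powr \<theta> * 2 powr (1 - \<theta>) * real n powr (- Re s - \<theta>)
        \<le> norm (s - 1) * norm s powr \<theta> * 2 powr 1 * real n powr (- Re s - \<theta>)"
      using \<theta> by (intro mult_right_mono mult_left_mono powr_mono) auto
    finally show ?thesis by (simp add: mult_ac)
  qed auto
qed

text \<open>The exponent \<open>\<theta> = 1/16\<close> used from here on is small enough: \<open>Z'/Z\<close> and its relatives grow like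
  \<open>\<bar>t\<bar>\<close> to the power \<open>5\<theta>\<close>, and the cubic term of \<open>(Z'/Z)''\<close> then like \<open>15\<theta> < 1\<close>.\<close>

definition zeta_dom :: "complex set" where "zeta_dom = {s. Re s > 31/32}"

lemma open_zeta_dom: "open zeta_dom"
  unfolding zeta_dom_def by (rule open_halfspace_Re_gt)

text \<open>On the half-plane \<open>Re s + 1/16\<close> exceeds 31/32 + 2/32 = 33/32 > 1, so the
  majorant converges even slightly to the left of Re s = 1.\<close>

lemma norm_zeta_term_le':
  assumes "s \<in> zeta_dom"
  shows "norm (zeta_term (Suc n) s) \<le> 2 * norm (s - 1) * norm s powr (1/16) * real (Suc n) powr (-33/32)"
proof -
  have "norm (zeta_term (Suc n) s) \<le> 2 * norm (s - 1) * norm s powr (1/16) * real (Suc n) powr (- Re s - 1/16)"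
    using assms by (intro norm_zeta_term_le) (auto simp: zeta_dom_def)
  also have "\<dots> \<le> 2 * norm (s - 1) * norm s powr (1/16) * real (Suc n) powr (-33/32)"
    using assms by (intro mult_left_mono powr_mono) (auto simp: zeta_dom_def)
  finally show ?thesis .
qed

lemma summable_zeta_majorant: "summable (\<lambda>n. real (Suc n) powr (-33/32))"
  using summable_real_powr_iff[of "-33/32"] by (subst summable_Suc_iff[of "\<lambda>n. real n powr (-33/32)"]) simp

lemma zeta_reg_sums:
  assumes "s \<in> zeta_dom"
  shows "(\<lambda>n. zeta_term (Suc n) s) sums (zeta_reg s - 1)"
proof -
  have "summable (\<lambda>n. zeta_term (Suc n) s)"
    using norm_zeta_term_le'[OF assms]
    by (intro summable_comparison_test'[OF summable_mult[OF summable_zeta_majorant]]) auto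
  thus ?thesis by (simp add: zeta_reg_def summable_sums)
qed

text \<open>The exponent 17/16 is 1 for the factor s - 1 plus \<theta> = 1/16.\<close>

lemma norm_zeta_reg_le: 
  "\<exists>C>0. \<forall>s\<in>zeta_dom. norm (zeta_reg s) \<le> C * (1 + norm s) powr (17/16)"
proof -
  define K where "K = (\<Sum>n. real (Suc n) powr (-33/32))"
  have K: "K \<ge> 0" unfolding K_def by (intro suminf_nonneg summable_zeta_majorant) auto
  show ?thesis
  proof (rule exI[of _ "1 + 2 * K"], intro conjI ballI)
    fix s assume s: "s \<in> zeta_dom"
    have "norm (zeta_reg s - 1) \<le> (\<Sum>n. 2 * norm (s - 1) * norm s powr (1/16) * real (Suc n) powr (-33/32))"
      using norm_zeta_term_le'[OF s]
      by (subst sums_unique[OF zeta_reg_sums[OF s]])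
         (intro norm_suminf_le summable_mult summable_zeta_majorant, auto)
    also have "\<dots> = 2 * norm (s - 1) * norm s powr (1/16) * K"
      unfolding K_def by (rule suminf_mult[OF summable_zeta_majorant])
    also have "\<dots> \<le> 2 * (1 + norm s) * (1 + norm s) powr (1/16) * K"
      using K norm_triangle_ineq4[of s 1] by (intro mult_right_mono mult_mono powr_mono2) auto
    also have "\<dots> = 2 * K * (1 + norm s) powr (17/16)"
      using powr_add[of "1 + norm s" 1 "1/16"] by (simp add: mult_ac)
    finally have "norm (zeta_reg s - 1) \<le> 2 * K * (1 + norm s) powr (17/16)" .
    moreover have "1 \<le> (1 + norm s) powr (17/16)" by (rule ge_one_powr_ge_zero) auto
    ultimately show "norm (zeta_reg s) \<le> (1 + 2 * K) * (1 + norm s) powr (17/16)"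
      using norm_triangle_ineq2[of "zeta_reg s" 1] by (simp add: algebra_simps)
  qed (use K in auto)
qed

lemma zeta_term_holomorphic: "zeta_term (Suc n) holomorphic_on A"
  unfolding zeta_term_def by (intro holomorphic_intros)

lemma zeta_reg_holomorphic: "zeta_reg holomorphic_on zeta_dom"
proof -
  have "\<exists>g g'. \<forall>x\<in>zeta_dom. (\<lambda>n. zeta_term (Suc n) x) sums g x \<and> (\<lambda>n. deriv (zeta_term (Suc n)) x) sums g' x \<and> (g has_field_derivative g' x) (at x)"
  proof (rule series_and_derivative_comparison_local[OF open_zeta_dom])
    fix n x show "(zeta_term (Suc n) has_field_derivative deriv (zeta_term (Suc n)) x) (at x)"
      using zeta_term_holomorphic[of n UNIV] holomorphic_derivI by blast
  next
    fix x assume "x \<in> zeta_dom"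
    define R where "R = norm x + 1"
    show "\<exists>d h. 0 < d \<and> summable h \<and> (\<forall>\<^sub>F n in sequentially. \<forall>y\<in>ball x d \<inter> zeta_dom. norm (zeta_term (Suc n) y) \<le> h n)"
    proof (rule exI[of _ 1], rule exI[of _ "\<lambda>n. 2 * (R + 1) * R powr (1/16) * real (Suc n) powr (-33/32)"], intro conjI always_eventually allI ballI)
      show "summable (\<lambda>n. 2 * (R + 1) * R powr (1/16) * real (Suc n) powr (-33/32))"
        by (intro summable_mult summable_zeta_majorant)
      fix n y assume y: "y \<in> ball x 1 \<inter> zeta_dom"
      have yR: "norm y \<le> R" using y norm_triangle_ineq2[of y x] by (auto simp: R_def dist_norm norm_minus_commute)
      have "norm (zeta_term (Suc n) y) \<le> 2 * norm (y - 1) * norm y powr (1/16) * real (Suc n) powr (-33/32)"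
        using y by (intro norm_zeta_term_le') auto
      also have "\<dots> \<le> 2 * (R + 1) * R powr (1/16) * real (Suc n) powr (-33/32)"
        using yR norm_triangle_ineq4[of y 1] by (intro mult_right_mono mult_mono powr_mono2) (auto simp: R_def)
      finally show "norm (zeta_term (Suc n) y) \<le> \<dots>" .
    qed auto
  qed
  then obtain g g' where g: "\<And>x. x \<in> zeta_dom \<Longrightarrow> (\<lambda>n. zeta_term (Suc n) x) sums g x"
      "\<And>x. x \<in> zeta_dom \<Longrightarrow> (g has_field_derivative g' x) (at x)" by blast
  have "(\<lambda>s. 1 + g s) holomorphic_on zeta_dom"
    using g(2) holomorphic_on_open[OF open_zeta_dom] by (intro holomorphic_intros) blast
  moreover have "zeta_reg s = 1 + g s" if "s \<in> zeta_dom" for s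
    using sums_unique[OF g(1)[OF that]] by (simp add: zeta_reg_def)
  ultimately show ?thesis using holomorphic_cong[of zeta_dom zeta_dom zeta_reg "\<lambda>s. 1 + g s"] by simp
qed

text \<open>For Re s > 1 the powers n^(1-s) tend to 0, so the differences in
  \<open>zeta_term\<close> telescope to -1, which cancels the leading 1 of
  \<open>zeta_reg\<close>.\<close>

lemma zeta_reg_eq:
  assumes s: "Re s > 1"
  shows "zeta_reg s = (s - 1) * zeta_series s"
proof -
  define f :: "nat \<Rightarrow> complex" where "f n = of_nat (Suc n) powr (1 - s)" for n
  have "(\<lambda>n. real (Suc n) powr (1 - Re s)) \<longlonglongrightarrow> 0" using s by real_asymp
  hence "(\<lambda>n. norm (f n)) \<longlonglongrightarrow> 0"
    by (simp only: f_def norm_nat_powr) simp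
  hence "f \<longlonglongrightarrow> 0" by (rule tendsto_norm_zero_cancel)
  hence 1: "(\<lambda>n. f (Suc n) - f n) sums (0 - f 0)" by (rule telescope_sums)
  have "(\<lambda>n. of_nat n powr (-s)) sums zeta_series s" using dirichlet_sums[OF dirichlet_abs_conv_one s] by simp
  hence "(\<lambda>n. of_nat (Suc n) powr (-s)) sums zeta_series s" by (subst sums_Suc_iff) simp
  hence "(\<lambda>n. (s - 1) * of_nat (Suc n) powr (-s)) sums ((s - 1) * zeta_series s)" by (rule sums_mult)
  from sums_add[OF this 1] have "(\<lambda>n. zeta_term (Suc n) s) sums ((s - 1) * zeta_series s - 1)"
    by (simp add: zeta_term_def f_def algebra_simps)
  moreover have "s \<in> zeta_dom" using s by (simp add: zeta_dom_def)
  ultimately show ?thesis using zeta_reg_sums sums_unique2 by fastforce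
qed

text \<open>Near s = 1 it is this value, together with continuity, that keeps Z away from 0; the
  3-4-1 inequality is exploited only away from the real axis.\<close>

lemma zeta_reg_1: "zeta_reg 1 = 1"
proof -
  have "zeta_term (Suc n) 1 = 0" for n
    by (simp add: zeta_term_def flip: of_nat_Suc del: of_nat_Suc)
  thus ?thesis by (simp add: zeta_reg_def)
qed

text \<open>Cauchy's estimate on circles of radius 1/64, which stay in \<open>zeta_dom\<close>
  because 1 - 1/64 > 31/32. Differentiation therefore costs a constant depending on
  \<open>j\<close>, but no power of |Im s|.\<close>

lemma zeta_reg_deriv_bound:
  "\<exists>C>0. \<forall>s. 1 \<le> Re s \<and> Re s \<le> 2 \<longrightarrow> norm ((deriv ^^ j) zeta_reg s) \<le> C * (1 + \<bar>Im s\<bar>) powr (17/16)"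
proof -
  obtain C where C: "C > 0" "\<And>s. s \<in> zeta_dom \<Longrightarrow> norm (zeta_reg s) \<le> C * (1 + norm s) powr (17/16)"
    using norm_zeta_reg_le by blast
  \<comment> \<open>The 4 comes from 1 + |x| \<le> 3 + 1/64 + |Im s| \<le> 4 (1 + |Im s|) for x on
    the circle.\<close>
  define C' where "C' = fact j * (C * 4 powr (17/16)) / (1/64) ^ j"
  show ?thesis
  proof (rule exI[of _ C'], intro conjI allI impI)
    fix s :: complex assume s: "1 \<le> Re s \<and> Re s \<le> 2"
    have sub: "cball s (1/64) \<subseteq> zeta_dom"
    proof
      fix z assume "z \<in> cball s (1/64)"
      hence "\<bar>Re (s - z)\<bar> \<le> 1/64" using abs_Re_le_cmod[of "s - z"] by (simp add: dist_norm)
      thus "z \<in> zeta_dom" using s unfolding zeta_dom_def mem_Collect_eq minus_complex.sel by linarith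
    qed
    have n: "norm s \<le> 2 + \<bar>Im s\<bar>" using cmod_le[of s] s by auto
    have "norm ((deriv ^^ j) zeta_reg s) \<le> fact j * (C * (4 * (1 + \<bar>Im s\<bar>)) powr (17/16)) / (1/64) ^ j"
    proof (rule Cauchy_inequality)
      show "zeta_reg holomorphic_on ball s (1/64)" "continuous_on (cball s (1/64)) zeta_reg"
        using sub ball_subset_cball[of s "1/64"] holomorphic_on_subset[OF zeta_reg_holomorphic] 
          continuous_on_subset[OF holomorphic_on_imp_continuous_on[OF zeta_reg_holomorphic]] by blast+
      fix x assume x: "norm (s - x) = 1/64"
      have "norm (zeta_reg x) \<le> C * (1 + norm x) powr (17/16)"
        using sub x by (intro C(2)) (auto simp: dist_norm)
      also have "norm x \<le> 1/64 + norm s" using x norm_triangle_ineq2[of x s] by (simp add: norm_minus_commute)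
      hence "C * (1 + norm x) powr (17/16) \<le> C * (1 + (1/64 + norm s)) powr (17/16)"
        using C(1) by (intro mult_left_mono powr_mono2) auto
      also have "\<dots> \<le> C * (4 * (1 + \<bar>Im s\<bar>)) powr (17/16)"
        using n C(1) by (intro mult_left_mono powr_mono2) auto
      finally show "norm (zeta_reg x) \<le> C * (4 * (1 + \<bar>Im s\<bar>)) powr (17/16)" .
    qed auto
    also have "\<dots> = C' * (1 + \<bar>Im s\<bar>) powr (17/16)" unfolding C'_def powr_mult[of 4 "1 + \<bar>Im s\<bar>"] by simp
    finally show "norm ((deriv ^^ j) zeta_reg s) \<le> C' * (1 + \<bar>Im s\<bar>) powr (17/16)" .
  qed (use C in \<open>auto simp: C'_def\<close>)
qed

section \<open>A lower bound near the line of real part one\<close>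

text \<open>A logarithm of zeta up to an additive constant, with coefficients in [0, 1]. At n = 0
  and n = 1 numerator and denominator are both 0, and so is the quotient by convention.\<close>

abbreviation log_zeta_series :: "complex \<Rightarrow> complex" where
  "log_zeta_series \<equiv> dirichlet_series (\<lambda>n. mangoldt n / ln (real n))"

lemma mangoldt_over_ln_bounds: "0 \<le> mangoldt n / ln (real n)" "mangoldt n / ln (real n) \<le> (1::real)"
proof -
  have "ln (real n) \<ge> 0" using mangoldt_le_ln[of n] mangoldt_nonneg[of n] by linarith
  thus "0 \<le> mangoldt n / ln (real n)" "mangoldt n / ln (real n) \<le> (1::real)"
    using mangoldt_le_ln[of n] mangoldt_nonneg[of n] by (auto simp: divide_le_eq_1)
qed

lemma dirichlet_abs_conv_log_zeta: "dirichlet_abs_conv (\<lambda>n. mangoldt n / ln (real n))"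
  by (rule dirichlet_abs_conv_bounded[of _ 1]) (simp only: abs_of_nonneg mangoldt_over_ln_bounds)

lemma log_zeta_series_deriv:
  assumes "Re s > 1"
  shows "(log_zeta_series has_field_derivative - mangoldt_series s) (at s)"
proof -
  have "mangoldt n / ln (real n) * ln (real n) = mangoldt n" for n
    using mangoldt_le_ln[of n] mangoldt_nonneg[of n] by (cases "ln (real n) = 0") auto
  thus ?thesis using dirichlet_series_has_derivative[OF dirichlet_abs_conv_log_zeta assms] by simp
qed

lemma zeta_series_2: "zeta_series 2 \<noteq> 0"
proof -
  have 1: "(\<lambda>n. real n powr (-2)) sums (\<Sum>n. real n powr (-2))"
    by (intro summable_sums) (simp add: summable_real_powr_iff)
  have pos: "(\<Sum>n. real n powr (-2)) > 0"
    using 1 by (intro suminf_pos2[of _ 1]) (auto simp: sums_iff)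
  have "of_real (real n powr (-2)) = (of_nat n powr (-2) :: complex)" for n
    using powr_of_real[of "real n" "-2"] by simp
  hence "(\<lambda>n. of_nat n powr (-2)) sums (of_real (\<Sum>n. real n powr (-2)) :: complex)"
    using sums_of_real[OF 1, where ?'a = complex] by simp
  moreover have "(\<lambda>n. of_nat n powr (-2)) sums zeta_series 2"
    using dirichlet_sums[OF dirichlet_abs_conv_one, of 2] by simp
  ultimately have "zeta_series 2 = of_real (\<Sum>n. real n powr (-2))" by (rule sums_unique2[rotated])
  thus ?thesis using pos by simp
qed

text \<open>Zeta and the exponential have the same logarithmic derivative
  \<open>- mangoldt_series\<close>, so their quotient is constant; the value at 2 shows that it is
  not 0. This yields non-vanishing for Re s > 1 and expresses log |zeta| by a series with
  nonnegative coefficients.\<close>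

lemma zeta_series_eq_exp:
  "\<exists>c. c \<noteq> 0 \<and> (\<forall>s. Re s > 1 \<longrightarrow> zeta_series s = c * exp (log_zeta_series s))"
proof -
  define D where "D = {s :: complex. Re s > 1}"
  let ?f = "\<lambda>s. zeta_series s * exp (- log_zeta_series s)"
  have "\<exists>c. \<forall>s\<in>D. ?f s = c"
  proof (rule has_field_derivative_zero_constant)
    show "convex D" unfolding D_def by (rule convex_halfspace_Re_gt)
    fix s assume "s \<in> D"
    hence s: "Re s > 1" by (simp add: D_def)
    show "(?f has_field_derivative 0) (at s within D)"
      by (rule has_field_derivative_at_within)
         (rule derivative_eq_intros zeta_series_deriv[OF s] log_zeta_series_deriv[OF s] refl | simp add: algebra_simps)+
  qed
  then obtain c where c: "\<And>s. Re s > 1 \<Longrightarrow> ?f s = c" by (auto simp: D_def)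
  show ?thesis
  proof (rule exI[of _ c], intro conjI allI impI)
    show "c \<noteq> 0" using c[of 2] zeta_series_2 by auto
    fix s :: complex assume "Re s > 1"
    from c[OF this] show "zeta_series s = c * exp (log_zeta_series s)"
      by (auto simp: exp_minus field_simps)
  qed
qed

lemma Re_nat_powr: "Re (of_nat n powr (- Complex \<sigma> t)) = real n powr (- \<sigma>) * cos (t * ln (real n))"
proof (cases "n = 0")
  case False
  thus ?thesis by (simp add: powr_def Re_exp Ln_of_nat)
qed auto

lemma Re_log_zeta_sums:
  assumes "\<sigma> > 1"
  shows "(\<lambda>n. mangoldt n / ln (real n) * (real n powr (- \<sigma>) * cos (t * ln (real n)))) sums Re (log_zeta_series (Complex \<sigma> t))"
proof -
  have "(\<lambda>n. Re (of_real (mangoldt n / ln (real n)) * of_nat n powr (- Complex \<sigma> t))) sums Re (log_zeta_series (Complex \<sigma> t))"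
    using assms by (intro sums_Re dirichlet_sums dirichlet_abs_conv_log_zeta) auto
  thus ?thesis by (simp only: Re_complex_of_real Re_nat_powr times_complex.sel Im_complex_of_real mult_zero_left diff_zero)
qed

text \<open>The logarithm of the product is 8 log |c| plus a series whose n-th term is a nonnegative
  coefficient times 3 + 4 cos x + cos 2x = 2 (1 + cos x)^2 with x = t log n. The 8 is the total
  exponent 3 + 4 + 1, hence the witness \<open>norm c ^ 8\<close>.\<close>

lemma zeta_341:
  "\<exists>c>0. \<forall>\<sigma> t. \<sigma> > 1 \<longrightarrow>
     c \<le> norm (zeta_series (Complex \<sigma> 0)) ^ 3 * norm (zeta_series (Complex \<sigma> t)) ^ 4 * norm (zeta_series (Complex \<sigma> (2 * t)))"
proof -
  obtain c where c: "c \<noteq> 0" "\<And>s. Re s > 1 \<Longrightarrow> zeta_series s = c * exp (log_zeta_series s)"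
    using zeta_series_eq_exp by blast
  show ?thesis
  proof (rule exI[of _ "norm c ^ 8"], intro conjI allI impI)
    fix \<sigma> t :: real assume \<sigma>: "\<sigma> > 1"
    let ?L = "\<lambda>t. Re (log_zeta_series (Complex \<sigma> t))"
    have S: "(\<lambda>n. 3 * (mangoldt n / ln (real n) * (real n powr (- \<sigma>) * cos (0 * ln (real n)))) +
        4 * (mangoldt n / ln (real n) * (real n powr (- \<sigma>) * cos (t * ln (real n)))) +
        mangoldt n / ln (real n) * (real n powr (- \<sigma>) * cos ((2 * t) * ln (real n)))) sums (3 * ?L 0 + 4 * ?L t + ?L (2 * t))"
      by (intro sums_add sums_mult Re_log_zeta_sums \<sigma>)
    have N: "0 \<le> 3 * (mangoldt n / ln (real n) * (real n powr (- \<sigma>) * cos (0 * ln (real n)))) +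
        4 * (mangoldt n / ln (real n) * (real n powr (- \<sigma>) * cos (t * ln (real n)))) +
        mangoldt n / ln (real n) * (real n powr (- \<sigma>) * cos ((2 * t) * ln (real n)))" (is "0 \<le> ?R n") for n
    proof -
      define x where "x = t * ln (real n)"
      have "?R n = mangoldt n / ln (real n) * real n powr (- \<sigma>) * (3 + 4 * cos x + cos (2 * x))"
        unfolding x_def by (simp add: algebra_simps)
      also have "3 + 4 * cos x + cos (2 * x) = 2 * (1 + cos x)\<^sup>2"
        unfolding cos_double_cos by (simp add: power2_eq_square algebra_simps)
      finally have "?R n = mangoldt n / ln (real n) * real n powr (- \<sigma>) * (2 * (1 + cos x)\<^sup>2)" .
      moreover have "0 \<le> mangoldt n / ln (real n) * real n powr (- \<sigma>) * (2 * (1 + cos x)\<^sup>2)"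
        by (intro mult_nonneg_nonneg mangoldt_over_ln_bounds) auto
      ultimately show ?thesis by (simp only:)
    qed
    have nn: "0 \<le> 3 * ?L 0 + 4 * ?L t + ?L (2 * t)" by (rule sums_le[OF N sums_zero S])
    have n: "norm (zeta_series (Complex \<sigma> u)) = norm c * exp (?L u)" for u
      using \<sigma> by (simp add: c(2) norm_mult)
    have "norm (zeta_series (Complex \<sigma> 0)) ^ 3 * norm (zeta_series (Complex \<sigma> t)) ^ 4 * norm (zeta_series (Complex \<sigma> (2 * t)))
       = norm c ^ 8 * (exp (?L 0) ^ 3 * exp (?L t) ^ 4 * exp (?L (2 * t)))"
      unfolding n by (simp add: power_mult_distrib power_numeral_reduce)
    also have "exp (?L 0) ^ 3 * exp (?L t) ^ 4 * exp (?L (2 * t)) = exp (3 * ?L 0 + 4 * ?L t + ?L (2 * t))"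
      by (simp add: exp_add flip: exp_of_nat_mult)
    also have "norm c ^ 8 * exp (3 * ?L 0 + 4 * ?L t + ?L (2 * t)) \<ge> norm c ^ 8 * 1"
      using nn by (intro mult_left_mono) auto
    finally show "norm c ^ 8 \<le> norm (zeta_series (Complex \<sigma> 0)) ^ 3 * norm (zeta_series (Complex \<sigma> t)) ^ 4 * norm (zeta_series (Complex \<sigma> (2 * t)))" by simp
  qed (use c in auto)
qed

lemma power_powr_eq: "(x::real) > 0 \<Longrightarrow> (x ^ n) powr a = x powr (real n * a)"
  by (simp add: powr_def ln_realpow)

text \<open>The factors |s - 1|, bounded below by \<sigma> - 1, |t| and |2t|, turn zeta into Z in
  the 3-4-1 inequality; upper bounds for Z(\<sigma>) and Z(\<sigma> + 2it) then isolate |Z(\<sigma>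
  + it)|^4. The exponent is 63/64 = (5 - 17/16) / 4. The hypothesis on \<open>t0\<close> makes |t|
  comparable with 1 + |t|.\<close>

lemma zeta_reg_lower_aux:
  assumes t0: "0 < t0"
  shows "\<exists>c>0. \<forall>\<sigma> t. 1 < \<sigma> \<and> \<sigma> \<le> 2 \<and> t0 \<le> \<bar>t\<bar> \<longrightarrow>
           c * (\<sigma> - 1) powr (3/4) * (1 + \<bar>t\<bar>) powr (63/64) \<le> norm (zeta_reg (Complex \<sigma> t))"
proof -
  obtain c0 where c0: "c0 > 0" "\<And>\<sigma> t. \<sigma> > 1 \<Longrightarrow>
     c0 \<le> norm (zeta_series (Complex \<sigma> 0)) ^ 3 * norm (zeta_series (Complex \<sigma> t)) ^ 4 * norm (zeta_series (Complex \<sigma> (2 * t)))"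
    using zeta_341 by blast
  obtain C where C: "C > 0" "\<And>s. 1 \<le> Re s \<Longrightarrow> Re s \<le> 2 \<Longrightarrow> norm (zeta_reg s) \<le> C * (1 + \<bar>Im s\<bar>) powr (17/16)"
    using zeta_reg_deriv_bound[of 0] by auto
  \<comment> \<open>The best constant with k (1 + |t|) \<le> |t| for all |t| \<ge>
    \<open>t0\<close>.\<close>
  define k where "k = t0 / (1 + t0)"
  have k: "k > 0" using t0 by (simp add: k_def)
  \<comment> \<open>\<open>k ^ 5\<close> comes from |t|^4 and |2t|, \<open>C ^ 4\<close> from
    Z(\<sigma>)^3 and Z(\<sigma> + 2it), and 4 bounds \<open>2 powr (17/16)\<close>.\<close>
  define c1 where "c1 = k ^ 5 * c0 / (4 * C ^ 4)"
  have c1: "c1 > 0" using k c0 C by (simp add: c1_def)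
  show ?thesis
  proof (rule exI[of _ "c1 powr (1/4)"], intro conjI allI impI)
    fix \<sigma> t :: real assume *: "1 < \<sigma> \<and> \<sigma> \<le> 2 \<and> t0 \<le> \<bar>t\<bar>"
    define u where "u = 1 + \<bar>t\<bar>"
    have u: "u \<ge> 1" by (simp add: u_def)
    have tk: "k * u \<le> \<bar>t\<bar>" using * t0 by (simp add: k_def u_def field_simps)
    define X where "X = norm (zeta_reg (Complex \<sigma> t))"
    have e: "norm (zeta_reg (Complex \<sigma> v)) = norm (Complex (\<sigma> - 1) v) * norm (zeta_series (Complex \<sigma> v))" for v
    proof -
      have "Complex \<sigma> v - 1 = Complex (\<sigma> - 1) v" by (simp add: complex_eq_iff)
      thus ?thesis using * by (subst zeta_reg_eq) (auto simp: norm_mult)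
    qed
    have v: "norm (Complex (\<sigma> - 1) v) \<ge> \<bar>v\<bar>" for v using abs_Im_le_cmod[of "Complex (\<sigma> - 1) v"] by simp
    have "(\<sigma> - 1) ^ 3 * (k * u) ^ 4 * (k * u) * c0 \<le> norm (Complex (\<sigma> - 1) 0) ^ 3 * norm (Complex (\<sigma> - 1) t) ^ 4 * norm (Complex (\<sigma> - 1) (2 * t)) *
       (norm (zeta_series (Complex \<sigma> 0)) ^ 3 * norm (zeta_series (Complex \<sigma> t)) ^ 4 * norm (zeta_series (Complex \<sigma> (2 * t))))"
    proof (intro mult_mono)
      show "(\<sigma> - 1) ^ 3 \<le> norm (Complex (\<sigma> - 1) 0) ^ 3"
        using abs_Re_le_cmod[of "Complex (\<sigma> - 1) 0"] * by (intro power_mono) auto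
      show "(k * u) ^ 4 \<le> norm (Complex (\<sigma> - 1) t) ^ 4" using tk v[of t] k u by (intro power_mono) auto
      show "k * u \<le> norm (Complex (\<sigma> - 1) (2 * t))" using tk v[of "2 * t"] by auto
    qed (use c0 k u * in auto)
    also have "\<dots> = norm (zeta_reg (Complex \<sigma> 0)) ^ 3 * X ^ 4 * norm (zeta_reg (Complex \<sigma> (2 * t)))"
      unfolding X_def e by (simp add: power_mult_distrib mult_ac)
    also have "\<dots> \<le> C ^ 3 * X ^ 4 * (C * (4 * u powr (17/16)))"
    proof (intro mult_mono power_mono)
      show "norm (zeta_reg (Complex \<sigma> 0)) \<le> C" using C(2)[of "Complex \<sigma> 0"] * by simp
      have "norm (zeta_reg (Complex \<sigma> (2 * t))) \<le> C * (1 + \<bar>2 * t\<bar>) powr (17/16)"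
        using C(2)[of "Complex \<sigma> (2 * t)"] * by simp
      also have "\<dots> \<le> C * (2 * u) powr (17/16)" using C by (intro mult_left_mono powr_mono2) (auto simp: u_def)
      also have "\<dots> = C * (2 powr (17/16) * u powr (17/16))" using u by (simp add: powr_mult)
      also have "\<dots> \<le> C * (2 powr 2 * u powr (17/16))" using C by (intro mult_left_mono mult_right_mono powr_mono) auto
      finally show "norm (zeta_reg (Complex \<sigma> (2 * t))) \<le> C * (4 * u powr (17/16))" by simp
    qed (use C in \<open>auto simp: X_def\<close>)
    finally have "c1 * (\<sigma> - 1) ^ 3 * u ^ 5 \<le> X ^ 4 * u powr (17/16)"
      using C(1) by (simp add: c1_def field_simps power_numeral_reduce)
    hence "c1 * (\<sigma> - 1) ^ 3 * u powr (63/16) * u powr (17/16) \<le> X ^ 4 * u powr (17/16)"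
      using u powr_add[of u "63/16" "17/16"] powr_realpow[of u 5] by (simp add: mult_ac)
    hence "c1 * (\<sigma> - 1) ^ 3 * u powr (63/16) \<le> X ^ 4" using u by simp
    hence "(c1 * (\<sigma> - 1) ^ 3 * u powr (63/16)) powr (1/4) \<le> (X ^ 4) powr (1/4)"
      using c1 * by (intro powr_mono2) auto
    also have "(X ^ 4) powr (1/4) = X"
    proof (cases "X = 0")
      case False
      hence "X > 0" by (simp add: X_def)
      thus ?thesis by (simp add: power_powr_eq)
    qed auto
    also have "(c1 * (\<sigma> - 1) ^ 3 * u powr (63/16)) powr (1/4) = c1 powr (1/4) * (\<sigma> - 1) powr (3/4) * u powr (63/64)"
      using c1 * u by (simp add: powr_mult powr_powr power_powr_eq)
    finally show "c1 powr (1/4) * (\<sigma> - 1) powr (3/4) * (1 + \<bar>t\<bar>) powr (63/64) \<le> norm (zeta_reg (Complex \<sigma> t))"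
      by (simp add: X_def u_def)
  qed (use c1 in auto)
qed

text \<open>The preceding bound degenerates as \<sigma> tends to 1, so it is used only for \<sigma>
  \<ge> 1 + \<open>\<eta>\<close>. The points closer to the line are reached from there by a
  horizontal segment, along which the derivative bound keeps the change of Z below half of the lower
  bound. The result is uniform up to the line.\<close>

lemma zeta_reg_lower:
  "\<exists>\<delta> c. 0 < \<delta> \<and> \<delta> \<le> 1 \<and> 0 < c \<and> (\<forall>s. 1 < Re s \<and> Re s \<le> 1 + \<delta> \<longrightarrow> c * (1 + \<bar>Im s\<bar>) powr (3/4) \<le> norm (zeta_reg s))"
proof -
  have one: "1 \<in> zeta_dom" by (simp add: zeta_dom_def)
  have "isCont zeta_reg 1"
    using holomorphic_on_imp_continuous_on[OF zeta_reg_holomorphic] open_zeta_dom one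
    by (simp add: continuous_on_eq_continuous_at)
  then obtain r where r: "r > 0" "\<And>s. dist s 1 < r \<Longrightarrow> dist (zeta_reg s) 1 < 1/2"
    unfolding continuous_at_eps_delta zeta_reg_1 by (metis half_gt_zero zero_less_one)
  \<comment> \<open>Points with 1 < Re s \<le> 1 + \<open>t0\<close> and |Im s| < \<open>t0\<close>
    have distance less than 2 \<open>t0\<close> \<le> \<open>r\<close> from 1, so |Z| is at least
    1/2 there. The same \<open>t0\<close> serves as \<open>\<delta>\<close>.\<close>
  define t0 where "t0 = min 1 (r / 2)"
  have t0: "0 < t0" "t0 \<le> 1" "2 * t0 \<le> r" using r by (auto simp: t0_def)
  obtain c2 where c2: "c2 > 0" "\<And>\<sigma> t. 1 < \<sigma> \<Longrightarrow> \<sigma> \<le> 2 \<Longrightarrow> t0 \<le> \<bar>t\<bar> \<Longrightarrow>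
           c2 * (\<sigma> - 1) powr (3/4) * (1 + \<bar>t\<bar>) powr (63/64) \<le> norm (zeta_reg (Complex \<sigma> t))"
    using zeta_reg_lower_aux[OF t0(1)] by blast
  obtain C where C: "C > 0" "\<And>s. 1 \<le> Re s \<Longrightarrow> Re s \<le> 2 \<Longrightarrow> norm (deriv zeta_reg s) \<le> C * (1 + \<bar>Im s\<bar>) powr (17/16)"
    using zeta_reg_deriv_bound[of 1] by auto
  \<comment> \<open>Small enough for \<open>\<kappa> powr (1/4) \<le> c2 / (2 * C)\<close>: the loss
    along the segment is then at most half of the lower bound at its end.\<close>
  define \<kappa> where "\<kappa> = min 1 ((c2 / (2 * C)) ^ 4)"
  have \<kappa>: "\<kappa> > 0" "\<kappa> \<le> 1" using c2 C by (auto simp: \<kappa>_def)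
  have \<kappa>C: "C * \<kappa> \<le> c2 * \<kappa> powr (3/4) / 2"
  proof -
    have "\<kappa> powr (1/4) \<le> ((c2 / (2 * C)) ^ 4) powr (1/4)" using \<kappa> by (intro powr_mono2) (auto simp: \<kappa>_def)
    also have "\<dots> = c2 / (2 * C)" using c2 C by (simp add: power_powr_eq)
    finally have "C * (\<kappa> powr (1/4) * \<kappa> powr (3/4)) \<le> C * (c2 / (2 * C) * \<kappa> powr (3/4))"
      using C by (intro mult_left_mono mult_right_mono) auto
    thus ?thesis using \<kappa> C by (simp flip: powr_add)
  qed
  define c where "c = min (1/4) (c2 * \<kappa> powr (3/4) / 2)"
  have c: "c > 0" using c2 \<kappa> by (simp add: c_def)
  have main: "c * (1 + \<bar>Im s\<bar>) powr (3/4) \<le> norm (zeta_reg s)" if s: "1 < Re s" "Re s \<le> 1 + t0" for s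
  proof (cases "\<bar>Im s\<bar> < t0")
    case True
    have "dist s 1 \<le> \<bar>Re (s - 1)\<bar> + \<bar>Im (s - 1)\<bar>" unfolding dist_norm by (rule cmod_le)
    hence "dist s 1 < r" using s True t0 by auto
    hence "norm (1 - zeta_reg s) < 1/2" using r by (simp add: dist_norm norm_minus_commute)
    hence "1/2 \<le> norm (zeta_reg s)" using norm_triangle_ineq2[of 1 "zeta_reg s"] by simp
    moreover have "(1 + \<bar>Im s\<bar>) powr (3/4) \<le> (1 + \<bar>Im s\<bar>) powr 1" by (intro powr_mono) auto
    hence "c * (1 + \<bar>Im s\<bar>) powr (3/4) \<le> (1/4) * 2"
      using True t0 c by (intro mult_mono) (auto simp: c_def)
    ultimately show ?thesis by linarith
  next
    case False
    define u where "u = 1 + \<bar>Im s\<bar>"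
    have u: "u \<ge> 1" by (simp add: u_def)
    \<comment> \<open>The exponent 5/16 balances the lower bound against the loss: 63/64 -
      (3/4)(5/16) = 17/16 - 5/16 = 3/4.\<close>
    define \<eta> where "\<eta> = \<kappa> * u powr (-5/16)"
    have \<eta>: "\<eta> > 0" using \<kappa> u by (simp add: \<eta>_def)
    have "u powr (-5/16) \<le> 1" using powr_mono[of "-5/16" 0 u] u by simp
    hence \<eta>1: "\<eta> \<le> 1" using \<kappa> mult_mono[of \<kappa> 1 "u powr (-5/16)" 1] by (simp add: \<eta>_def)
    have low: "c2 * \<kappa> powr (3/4) * u powr (3/4) \<le> norm (zeta_reg (Complex \<sigma> (Im s)))" if "1 + \<eta> \<le> \<sigma>" "\<sigma> \<le> 2" for \<sigma>
    proof -
      have "c2 * \<kappa> powr (3/4) * u powr (3/4) = c2 * \<eta> powr (3/4) * u powr (63/64)"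
        using u \<kappa> by (simp add: \<eta>_def powr_mult powr_powr flip: powr_add)
      also have "\<dots> \<le> c2 * (\<sigma> - 1) powr (3/4) * u powr (63/64)"
        using that \<eta> c2 by (intro mult_right_mono mult_left_mono powr_mono2) auto
      also have "\<dots> \<le> norm (zeta_reg (Complex \<sigma> (Im s)))"
        unfolding u_def using that \<eta> False by (intro c2) auto
      finally show ?thesis .
    qed
    have cc: "c * u powr (3/4) \<le> (c2 * \<kappa> powr (3/4) / 2) * u powr (3/4)"
      by (intro mult_right_mono) (auto simp: c_def)
    show ?thesis
    proof (cases "1 + \<eta> \<le> Re s")
      case True
      have "(c2 * \<kappa> powr (3/4) / 2) * u powr (3/4) \<le> c2 * \<kappa> powr (3/4) * u powr (3/4)"
        using c2 by (intro mult_right_mono) auto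
      also have "\<dots> \<le> norm (zeta_reg s)" using low[of "Re s"] True s t0 by simp
      finally show ?thesis using cc by (simp add: u_def)
    next
      case ls: False
      define s' where "s' = Complex (1 + \<eta>) (Im s)"
      define S where "S = {z. 1 \<le> Re z} \<inter> {z. Re z \<le> 2} \<inter> {z. Im z \<le> Im s} \<inter> {z. Im z \<ge> Im s}"
      have "norm (zeta_reg s' - zeta_reg s) \<le> (C * u powr (17/16)) * norm (s' - s)"
      proof (rule field_differentiable_bound[of S])
        show "convex S" unfolding S_def by (intro convex_Int convex_halfspace_Re_ge convex_halfspace_Re_le convex_halfspace_Im_le convex_halfspace_Im_ge)
        fix z assume z: "z \<in> S"
        hence "z \<in> zeta_dom" by (auto simp: S_def zeta_dom_def)
        thus "(zeta_reg has_field_derivative deriv zeta_reg z) (at z within S)"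
          using holomorphic_derivI[OF zeta_reg_holomorphic open_zeta_dom] has_field_derivative_at_within by blast
        show "norm (deriv zeta_reg z) \<le> C * u powr (17/16)" using C(2)[of z] z by (auto simp: S_def u_def)
      qed (use s t0 \<eta> \<eta>1 in \<open>auto simp: S_def s'_def\<close>)
      also have "s' - s = of_real (1 + \<eta> - Re s)" by (simp add: s'_def complex_eq_iff)
      hence "norm (s' - s) = \<bar>1 + \<eta> - Re s\<bar>" by (simp only: norm_of_real)
      hence "norm (s' - s) \<le> \<eta>" using s ls by simp
      hence "(C * u powr (17/16)) * norm (s' - s) \<le> (C * u powr (17/16)) * \<eta>"
        using C by (intro mult_left_mono) auto
      also have "\<dots> = (C * \<kappa>) * u powr (3/4)"
        by (simp add: \<eta>_def flip: powr_add) 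
      also have "\<dots> \<le> (c2 * \<kappa> powr (3/4) / 2) * u powr (3/4)" by (intro mult_right_mono \<kappa>C) auto
      finally have "norm (zeta_reg s' - zeta_reg s) \<le> (c2 * \<kappa> powr (3/4) / 2) * u powr (3/4)" .
      moreover have "c2 * \<kappa> powr (3/4) * u powr (3/4) \<le> norm (zeta_reg s')"
        unfolding s'_def using \<eta>1 by (intro low) auto
      ultimately have "(c2 * \<kappa> powr (3/4) / 2) * u powr (3/4) \<le> norm (zeta_reg s)"
        using norm_triangle_ineq2[of "zeta_reg s'" "zeta_reg s"] by simp
      with cc show ?thesis by (simp add: u_def)
    qed
  qed
  show ?thesis using main t0 c by blast
qed

section \<open>The logarithmic derivative\<close>

lemma dirichlet_abs_conv_mangoldt_ln: "dirichlet_abs_conv (\<lambda>n. mangoldt n * ln (real n))"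
  by (rule dirichlet_abs_conv_ln[OF dirichlet_abs_conv_mangoldt])

lemma dirichlet_abs_conv_mangoldt_ln2: "dirichlet_abs_conv (\<lambda>n. mangoldt n * (ln (real n))\<^sup>2)"
  using dirichlet_abs_conv_ln[OF dirichlet_abs_conv_mangoldt_ln] by (simp add: power2_eq_square mult_ac)

abbreviation mangoldt_ln2_series :: "complex \<Rightarrow> complex" where
  "mangoldt_ln2_series \<equiv> dirichlet_series (\<lambda>n. mangoldt n * (ln (real n))\<^sup>2)"

lemma deriv_eq_of_eq_on_open:
  assumes "open S" "s \<in> S" "\<And>z. z \<in> S \<Longrightarrow> f z = g z"
    and "(f has_field_derivative a) (at s)" "(g has_field_derivative b) (at s)"
  shows "a = b"
  using has_field_derivative_transform_within_open[OF assms(4,1,2,3)] assms(5) DERIV_unique by blast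

lemma zeta_reg_nonzero:
  assumes "Re s > 1"
  shows "zeta_reg s \<noteq> 0"
proof -
  obtain c where "c \<noteq> 0" "\<And>s. Re s > 1 \<Longrightarrow> zeta_series s = c * exp (log_zeta_series s)"
    using zeta_series_eq_exp by blast
  thus ?thesis using assms by (auto simp: zeta_reg_eq)
qed

lemma Re_gt_1_imp_zeta_dom: "Re s > 1 \<Longrightarrow> s \<in> zeta_dom"
  by (simp add: zeta_dom_def)

lemma higher_deriv_zeta_reg_has_derivative:
  assumes "s \<in> zeta_dom"
  shows "((deriv ^^ n) zeta_reg has_field_derivative (deriv ^^ Suc n) zeta_reg s) (at s)"
  using holomorphic_derivI[OF holomorphic_higher_deriv[OF zeta_reg_holomorphic open_zeta_dom] open_zeta_dom assms, of n UNIV] by simp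

text \<open>Logarithmic differentiation of (s - 1) \<zeta>(s): it splits the pole off
  -\<zeta>'/\<zeta>.\<close>

lemma mangoldt_series_eq:
  assumes s: "Re s > 1"
  shows "mangoldt_series s = 1 / (s - 1) - deriv zeta_reg s / zeta_reg s"
proof -
  have "deriv zeta_reg s = zeta_series s + (s - 1) * (- (zeta_series s * mangoldt_series s))"
  proof (rule deriv_eq_of_eq_on_open)
    show "open {s :: complex. Re s > 1}" by (rule open_halfspace_Re_gt)
    show "(zeta_reg has_field_derivative deriv zeta_reg s) (at s)"
      using higher_deriv_zeta_reg_has_derivative[OF Re_gt_1_imp_zeta_dom[OF s], of 0] by simp
    show "((\<lambda>s. (s - 1) * zeta_series s) has_field_derivative zeta_series s + (s - 1) * (- (zeta_series s * mangoldt_series s))) (at s)"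
      by (rule derivative_eq_intros zeta_series_deriv[OF s] refl | simp)+
  qed (use s zeta_reg_eq in auto)
  moreover have "zeta_series s \<noteq> 0" "s \<noteq> 1" using zeta_reg_nonzero[OF s] zeta_reg_eq[OF s] by auto
  moreover have "m = 1 / a - (b + a * (- (b * m))) / (a * b)" if "a \<noteq> 0" "b \<noteq> 0" for a b m :: complex
    using that by (simp add: field_simps)
  ultimately show ?thesis by (simp add: zeta_reg_eq[OF s])
qed

text \<open>The preceding identity is differentiated twice. Each differentiation multiplies the
  coefficients by -log n, so the sign is restored; 2 / (s - 1)^3 is the second derivative of 1 / (s
  - 1), and the bracket is that of Z'/Z.\<close>

lemma mangoldt_ln2_series_eq:
  assumes s: "Re s > 1"
  defines "Z \<equiv> \<lambda>n. (deriv ^^ n) zeta_reg s / zeta_reg s"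
  shows "mangoldt_ln2_series s = 2 / (s - 1) ^ 3 - (Z 3 - 3 * Z 1 * Z 2 + 2 * Z 1 ^ 3)"
proof -
  define q where "q n z = (deriv ^^ n) zeta_reg z / zeta_reg z" for n z
  let ?W = "\<lambda>z::complex. inverse (z - 1)"
  let ?H = "{s :: complex. Re s > 1}"
  have H: "open ?H" by (rule open_halfspace_Re_gt)
  have W: "(?W has_field_derivative - (?W z)\<^sup>2) (at z)" if "Re z > 1" for z
    using that by (auto intro!: derivative_eq_intros simp: power2_eq_square)
  \<comment> \<open>One recursion covers all quotients: q_n' = q_(n+1) - q_n q_1.\<close>
  have q: "(q n has_field_derivative (q (Suc n) z - q n z * q 1 z)) (at z)" if z: "Re z > 1" for n z
  proof -
    have nz: "zeta_reg z \<noteq> 0" by (rule zeta_reg_nonzero[OF z])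
    have d: "((deriv ^^ n) zeta_reg has_field_derivative (deriv ^^ Suc n) zeta_reg z) (at z)" for n
      by (rule higher_deriv_zeta_reg_has_derivative[OF Re_gt_1_imp_zeta_dom[OF z]])
    have "((\<lambda>z. (deriv ^^ n) zeta_reg z / (deriv ^^ 0) zeta_reg z) has_field_derivative
       ((deriv ^^ Suc n) zeta_reg z * (deriv ^^ 0) zeta_reg z - (deriv ^^ n) zeta_reg z * (deriv ^^ Suc 0) zeta_reg z) / ((deriv ^^ 0) zeta_reg z * (deriv ^^ 0) zeta_reg z)) (at z)"
      using nz by (intro DERIV_divide d) auto
    moreover have "(a * c - b * e) / (c * c) = a / c - b / c * (e / c)" if "c \<noteq> 0" for a b c e :: complex
      using that by (simp add: field_simps)
    ultimately show ?thesis unfolding q_def using nz by simp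
  qed
  have 1: "- dirichlet_series (\<lambda>n. mangoldt n * ln (real n)) z = - (?W z)\<^sup>2 - (q (Suc 1) z - q 1 z * q 1 z)"
    if z: "Re z > 1" for z
  proof (rule deriv_eq_of_eq_on_open[OF H])
    show "(mangoldt_series has_field_derivative - dirichlet_series (\<lambda>n. mangoldt n * ln (real n)) z) (at z)"
      by (rule dirichlet_series_has_derivative[OF dirichlet_abs_conv_mangoldt z])
    show "((\<lambda>s. ?W s - q 1 s) has_field_derivative - (?W z)\<^sup>2 - (q (Suc 1) z - q 1 z * q 1 z)) (at z)"
      by (intro DERIV_diff W[OF z] q[OF z])
  qed (use z mangoldt_series_eq in \<open>auto simp: q_def divide_inverse\<close>)
  have "- dirichlet_series (\<lambda>n. mangoldt n * ln (real n) * ln (real n)) s =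
      2 * ?W s * - (?W s)\<^sup>2 + (q (Suc 2) s - q 2 s * q 1 s) - 2 * q 1 s * (q (Suc 1) s - q 1 s * q 1 s)"
  proof (rule deriv_eq_of_eq_on_open[OF H])
    show "(dirichlet_series (\<lambda>n. mangoldt n * ln (real n)) has_field_derivative - dirichlet_series (\<lambda>n. mangoldt n * ln (real n) * ln (real n)) s) (at s)"
      by (rule dirichlet_series_has_derivative[OF dirichlet_abs_conv_mangoldt_ln s])
    show "dirichlet_series (\<lambda>n. mangoldt n * ln (real n)) z = (?W z)\<^sup>2 + q 2 z - (q 1 z)\<^sup>2" if "z \<in> ?H" for z
      using 1[of z] that by (simp add: power2_eq_square numeral_2_eq_2 minus_equation_iff[of _ "_ - _"] algebra_simps)
    show "((\<lambda>z. (?W z)\<^sup>2 + q 2 z - (q 1 z)\<^sup>2) has_field_derivative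
        2 * ?W s * - (?W s)\<^sup>2 + (q (Suc 2) s - q 2 s * q 1 s) - 2 * q 1 s * (q (Suc 1) s - q 1 s * q 1 s)) (at s)"
      by (rule derivative_eq_intros W[OF s] q[OF s] refl | simp)+
  qed (use s in auto)
  hence "dirichlet_series (\<lambda>n. mangoldt n * ln (real n) * ln (real n)) s = 2 * ?W s ^ 3 - (q 3 s - 3 * q 1 s * q 2 s + 2 * q 1 s ^ 3)"
    by (simp add: minus_equation_iff[of "dirichlet_series _ _"] numeral_3_eq_3 numeral_2_eq_2 algebra_simps)
  hence "dirichlet_series (\<lambda>n. mangoldt n * ln (real n) * ln (real n)) s = 2 / (s - 1) ^ 3 - (Z 3 - 3 * Z 1 * Z 2 + 2 * Z 1 ^ 3)"
    by (simp add: q_def Z_def divide_inverse power_inverse)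
  thus ?thesis by (simp add: power2_eq_square mult_ac)
qed

text \<open>With u = 1 + |Im s| each quotient is O(u^(17/16 - 3/4)) = O(u^(5/16)), so all terms are
  O(u) and division by s makes them bounded. The bound is independent of Re s, which is what lets Re
  s tend to 1 later.\<close>

lemma mangoldt_ln2_series_bound:
  "\<exists>\<delta> B. 0 < \<delta> \<and> (\<forall>s. 1 < Re s \<and> Re s \<le> 1 + \<delta> \<longrightarrow> norm ((mangoldt_ln2_series s - 2 / (s - 1) ^ 3) / s) \<le> B)"
proof -
  obtain \<delta> c where \<delta>: "0 < \<delta>" "\<delta> \<le> 1" and c: "0 < c"
    "\<And>s. 1 < Re s \<Longrightarrow> Re s \<le> 1 + \<delta> \<Longrightarrow> c * (1 + \<bar>Im s\<bar>) powr (3/4) \<le> norm (zeta_reg s)"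
    using zeta_reg_lower by blast
  have "\<exists>C. \<forall>j. C j > 0 \<and> (\<forall>s. 1 \<le> Re s \<and> Re s \<le> 2 \<longrightarrow> norm ((deriv ^^ j) zeta_reg s) \<le> C j * (1 + \<bar>Im s\<bar>) powr (17/16))"
    using zeta_reg_deriv_bound by (intro choice) blast
  then obtain C where C: "\<And>j. C j > 0" "\<And>j s. 1 \<le> Re s \<Longrightarrow> Re s \<le> 2 \<Longrightarrow> norm ((deriv ^^ j) zeta_reg s) \<le> C j * (1 + \<bar>Im s\<bar>) powr (17/16)"
    by blast
  define K where "K j = C j / c" for j :: nat
  have K: "K j > 0" for j using C(1) c(1) by (simp add: K_def)
  have main: "norm ((mangoldt_ln2_series s - 2 / (s - 1) ^ 3) / s) \<le> 2 * (K 3 + 3 * K 1 * K 2 + 2 * K 1 ^ 3)"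
    if s: "1 < Re s" "Re s \<le> 1 + \<delta>" for s
  proof -
    define u where "u = 1 + \<bar>Im s\<bar>"
    have u: "u \<ge> 1" by (simp add: u_def)
    define Z where "Z n = (deriv ^^ n) zeta_reg s / zeta_reg s" for n
    have Z: "norm (Z j) \<le> K j * u powr (5/16)" for j
    proof -
      have "norm (Z j) \<le> (C j * u powr (17/16)) / (c * u powr (3/4))"
        unfolding Z_def norm_divide using s \<delta> c C(2)[of s j] c(2)[of s] C(1)[of j] u
        by (intro frac_le) (auto simp: u_def)
      also have "\<dots> = K j * (u powr (17/16) / u powr (3/4))" by (simp add: K_def)
      also have "u powr (17/16) / u powr (3/4) = u powr (5/16)" by (simp flip: powr_diff)
      finally show ?thesis .
    qed
    have p: "u powr (5/16) \<le> u" "u powr (5/16) * u powr (5/16) \<le> u" "u powr (5/16) * u powr (5/16) * u powr (5/16) \<le> u"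
      using powr_mono[of "5/16" 1 u] powr_mono[of "10/16" 1 u] powr_mono[of "15/16" 1 u] u by (simp_all flip: powr_add)
    have "norm (Z 3 - 3 * Z 1 * Z 2 + 2 * Z 1 ^ 3) \<le> norm (Z 3) + 3 * norm (Z 1) * norm (Z 2) + 2 * norm (Z 1) ^ 3"
      using norm_triangle_ineq[of "Z 3 - 3 * Z 1 * Z 2" "2 * Z 1 ^ 3"] norm_triangle_ineq4[of "Z 3" "3 * Z 1 * Z 2"]
      by (simp add: norm_mult norm_power)
    also have "\<dots> \<le> K 3 * u powr (5/16) + 3 * (K 1 * u powr (5/16)) * (K 2 * u powr (5/16)) + 2 * (K 1 * u powr (5/16)) ^ 3"
      using Z K by (intro add_mono mult_mono mult_left_mono power_mono Z) (auto simp: less_imp_le)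
    also have "\<dots> = K 3 * u powr (5/16) + 3 * K 1 * K 2 * (u powr (5/16) * u powr (5/16)) + 2 * K 1 ^ 3 * (u powr (5/16) * u powr (5/16) * u powr (5/16))"
      by (simp add: power3_eq_cube algebra_simps)
    also have "\<dots> \<le> K 3 * u + 3 * K 1 * K 2 * u + 2 * K 1 ^ 3 * u"
      using p K by (intro add_mono mult_left_mono) (auto simp: less_imp_le)
    also have "\<dots> = (K 3 + 3 * K 1 * K 2 + 2 * K 1 ^ 3) * u" by (simp add: algebra_simps)
    also have "u \<le> 2 * norm s" using abs_Re_le_cmod[of s] abs_Im_le_cmod[of s] s by (simp add: u_def)
    hence "(K 3 + 3 * K 1 * K 2 + 2 * K 1 ^ 3) * u \<le> (K 3 + 3 * K 1 * K 2 + 2 * K 1 ^ 3) * (2 * norm s)"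
      using K by (intro mult_left_mono) (auto simp: less_imp_le intro!: add_nonneg_nonneg)
    finally have "norm (Z 3 - 3 * Z 1 * Z 2 + 2 * Z 1 ^ 3) \<le> 2 * (K 3 + 3 * K 1 * K 2 + 2 * K 1 ^ 3) * norm s"
      by (simp add: mult_ac)
    moreover have "mangoldt_ln2_series s - 2 / (s - 1) ^ 3 = - (Z 3 - 3 * Z 1 * Z 2 + 2 * Z 1 ^ 3)"
      using mangoldt_ln2_series_eq[OF s(1)] by (simp add: Z_def)
    hence "norm (mangoldt_ln2_series s - 2 / (s - 1) ^ 3) = norm (Z 3 - 3 * Z 1 * Z 2 + 2 * Z 1 ^ 3)"
      by (simp only: norm_minus_cancel)
    moreover have "s \<noteq> 0" using s by auto
    ultimately show ?thesis by (simp add: norm_divide divide_le_eq)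
  qed
  show ?thesis using \<delta>(1) main by blast
qed

section \<open>Laplace transforms and Gaussian averages\<close>

lemma integral_FTC_Ici:
  fixes F f :: "real \<Rightarrow> 'a :: euclidean_space"
  assumes F: "\<And>x. (F has_vector_derivative f x) (at x)" and cont: "continuous_on UNIV f"
    and int: "integrable lborel (\<lambda>x. indicator {a..} x *\<^sub>R f x)" and lim: "(F \<longlongrightarrow> 0) at_top"
  shows "(\<integral>x. indicator {a..} x *\<^sub>R f x \<partial>lborel) = - F a"
proof (rule tendsto_unique)
  show "((\<lambda>y. \<integral>x. indicator {..y} x *\<^sub>R (indicator {a..} x *\<^sub>R f x) \<partial>lborel) \<longlongrightarrow> (\<integral>x. indicator {a..} x *\<^sub>R f x \<partial>lborel)) at_top"
    by (rule tendsto_integral_at_top) (use int in auto)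
  have "\<forall>\<^sub>F y in at_top. F y - F a = (\<integral>x. indicator {..y} x *\<^sub>R (indicator {a..} x *\<^sub>R f x) \<partial>lborel)"
    using eventually_ge_at_top[of a]
  proof eventually_elim
    case (elim y)
    have "(\<integral>x. indicator {a..y} x *\<^sub>R f x \<partial>lborel) = F y - F a"
      using elim F by (intro integral_FTC_Icc) (auto intro: has_vector_derivative_at_within continuous_on_subset[OF cont])
    moreover have "(indicator {..y} x :: real) *\<^sub>R (indicator {a..} x *\<^sub>R f x) = indicator {a..y} x *\<^sub>R f x" for x
      by (auto simp: indicator_def)
    ultimately show ?case by (simp only:)
  qed
  moreover have "((\<lambda>y. F y - F a) \<longlongrightarrow> 0 - F a) at_top" by (intro tendsto_intros lim)
  ultimately show "((\<lambda>y. \<integral>x. indicator {..y} x *\<^sub>R (indicator {a..} x *\<^sub>R f x) \<partial>lborel) \<longlongrightarrow> - F a) at_top"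
    by (simp add: filterlim_cong)
qed auto

lemma integrable_power_exp:
  assumes "\<sigma> > 0"
  shows "integrable lborel (\<lambda>x. indicator {0..} x * (x ^ k * exp (-\<sigma> * x)) :: real)"
proof -
  have "integrable lborel (\<lambda>x. x ^ k * exp (-x) * indicator {0..} x :: real)"
    using has_bochner_integral_I0i_power_exp_m' by (rule integrable.intros)
  from lborel_integrable_real_affine[OF this, of \<sigma> 0] assms
  have "integrable lborel (\<lambda>x. (\<sigma> * x) ^ k * exp (-(\<sigma> * x)) * indicator {0..} (\<sigma> * x) :: real)" by simp
  hence "integrable lborel (\<lambda>x. (1 / \<sigma> ^ k) * ((\<sigma> * x) ^ k * exp (-(\<sigma> * x)) * indicator {0..} (\<sigma> * x)) :: real)"
    by (rule integrable_mult_right)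
  also have "(\<lambda>x. (1 / \<sigma> ^ k) * ((\<sigma> * x) ^ k * exp (-(\<sigma> * x)) * indicator {0..} (\<sigma> * x))) = (\<lambda>x. indicator {0..} x * (x ^ k * exp (-\<sigma> * x)))"
    using assms by (auto simp: fun_eq_iff indicator_def power_mult_distrib zero_le_mult_iff)
  finally show ?thesis .
qed

lemma integrable_power_cexp:
  fixes w :: complex
  assumes "Re w > 0" "a \<ge> 0"
  shows "integrable lborel (\<lambda>x. indicator {a..} x *\<^sub>R (of_real x ^ k * exp (- (w * of_real x))))"
proof (rule Bochner_Integration.integrable_bound[OF integrable_power_exp[OF assms(1), of k]])
  show "(\<lambda>x. indicator {a..} x *\<^sub>R (of_real x ^ k * exp (- (w * of_real x)))) \<in> borel_measurable lborel"
    by (intro borel_measurable_scaleR borel_measurable_indicator measurable_completion borel_measurable_continuous_onI continuous_intros) auto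
  show "AE x in lborel. norm (indicator {a..} x *\<^sub>R (of_real x ^ k * exp (- (w * of_real x)))) \<le> norm (indicator {0..} x * (x ^ k * exp (- Re w * x)))"
    using assms(2) by (intro AE_I2) (auto simp: indicator_def norm_mult norm_power abs_mult power_abs)
qed

lemma tendsto_power_cexp:
  fixes w :: complex
  assumes "Re w > 0"
  shows "((\<lambda>x. of_real x ^ k * exp (- (w * of_real x))) \<longlongrightarrow> 0) at_top"
proof (rule tendsto_norm_zero_cancel)
  define \<sigma> where "\<sigma> = Re w"
  have "((\<lambda>x::real. \<bar>x\<bar> ^ k * exp (- \<sigma> * x)) \<longlongrightarrow> 0) at_top"
    using assms unfolding \<sigma>_def[symmetric] by real_asymp
  thus "((\<lambda>x. norm (of_real x ^ k * exp (- (w * of_real x)))) \<longlongrightarrow> 0) at_top"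
    by (simp add: norm_mult norm_power \<sigma>_def)
qed

lemma integral_cexp:
  fixes w :: complex
  assumes w: "Re w > 0" and a: "a \<ge> 0"
  shows "(\<integral>x. indicator {a..} x *\<^sub>R exp (- (w * of_real x)) \<partial>lborel) = exp (- (w * of_real a)) / w"
proof -
  have w0: "w \<noteq> 0" using w by auto
  have "(\<integral>x. indicator {a..} x *\<^sub>R exp (- (w * of_real x)) \<partial>lborel) = - (- exp (- (w * of_real a)) / w)"
  proof (rule integral_FTC_Ici)
    fix x :: real
    have "((\<lambda>z. - exp (- (w * z)) / w) has_field_derivative exp (- (w * of_real x))) (at (of_real x))"
      using w0 by (auto intro!: derivative_eq_intros)
    from has_vector_derivative_real_field[OF this] show "((\<lambda>x. - exp (- (w * of_real x)) / w) has_vector_derivative exp (- (w * of_real x))) (at x)" .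
    show "((\<lambda>x. - exp (- (w * of_real x)) / w) \<longlongrightarrow> 0) at_top"
    proof -
      have "((\<lambda>x. - (of_real x ^ 0 * exp (- (w * of_real x))) / w) \<longlongrightarrow> - 0 / w) at_top"
        by (intro tendsto_intros tendsto_power_cexp w) (use w0 in auto)
      thus ?thesis by simp
    qed
  qed (use integrable_power_cexp[OF w a, of 0] in \<open>auto intro!: continuous_intros\<close>)
  thus ?thesis by simp
qed

lemma integral_id_cexp:
  fixes w :: complex
  assumes w: "Re w > 0"
  shows "(\<integral>x. indicator {0..} x *\<^sub>R (of_real x * exp (- (w * of_real x))) \<partial>lborel) = 1 / w\<^sup>2"
proof -
  have w0: "w \<noteq> 0" using w by auto
  have "(\<integral>x. indicator {0..} x *\<^sub>R (of_real x * exp (- (w * of_real x))) \<partial>lborel) = - (- (of_real 0 ^ 1 * exp (- (w * of_real 0))) / w - of_real 0 ^ 0 * exp (- (w * of_real 0)) / w\<^sup>2)"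
  proof (rule integral_FTC_Ici)
    fix x :: real
    have "((\<lambda>z. - (z ^ 1 * exp (- (w * z))) / w - z ^ 0 * exp (- (w * z)) / w\<^sup>2) has_field_derivative of_real x * exp (- (w * of_real x))) (at (of_real x))"
      using w0 by (auto intro!: derivative_eq_intros simp: field_simps power2_eq_square)
    from has_vector_derivative_real_field[OF this] 
    show "((\<lambda>x. - (of_real x ^ 1 * exp (- (w * of_real x))) / w - of_real x ^ 0 * exp (- (w * of_real x)) / w\<^sup>2) has_vector_derivative of_real x * exp (- (w * of_real x))) (at x)" .
    have "((\<lambda>x. - (of_real x ^ 1 * exp (- (w * of_real x))) / w - of_real x ^ 0 * exp (- (w * of_real x)) / w\<^sup>2) \<longlongrightarrow> - 0 / w - 0 / w\<^sup>2) at_top"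
      by (intro tendsto_intros tendsto_power_cexp w) (use w0 in auto)
    thus "((\<lambda>x. - (of_real x ^ 1 * exp (- (w * of_real x))) / w - of_real x ^ 0 * exp (- (w * of_real x)) / w\<^sup>2) \<longlongrightarrow> 0) at_top" by simp
  qed (use integrable_power_cexp[OF w, of 0 1] in \<open>auto intro!: continuous_intros\<close>)
  thus ?thesis by simp
qed

lemma integral_square_cexp:
  fixes w :: complex
  assumes w: "Re w > 0"
  shows "(\<integral>x. indicator {0..} x *\<^sub>R (of_real x ^ 2 * exp (- (w * of_real x))) \<partial>lborel) = 2 / w ^ 3"
proof -
  have w0: "w \<noteq> 0" using w by auto
  \<comment> \<open>An antiderivative from repeated integration by parts; the powers
    \<open>z ^ 1\<close> and \<open>z ^ 0\<close> are left standing so that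
    \<open>tendsto_power_cexp\<close> fits every summand.\<close>
  define F where "F z = - (z ^ 2 * exp (- (w * z))) / w - 2 * (z ^ 1 * exp (- (w * z))) / w\<^sup>2 - 2 * (z ^ 0 * exp (- (w * z))) / w ^ 3" for z
  have "(\<integral>x. indicator {0..} x *\<^sub>R (of_real x ^ 2 * exp (- (w * of_real x))) \<partial>lborel) = - F (of_real 0)"
  proof (rule integral_FTC_Ici)
    fix x :: real
    have "(F has_field_derivative of_real x ^ 2 * exp (- (w * of_real x))) (at (of_real x))"
      unfolding F_def using w0 by (auto intro!: derivative_eq_intros simp: field_simps power2_eq_square power3_eq_cube)
    from has_vector_derivative_real_field[OF this] 
    show "((\<lambda>x. F (of_real x)) has_vector_derivative of_real x ^ 2 * exp (- (w * of_real x))) (at x)" .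
    have "((\<lambda>x. F (of_real x)) \<longlongrightarrow> - 0 / w - 2 * 0 / w\<^sup>2 - 2 * 0 / w ^ 3) at_top"
      unfolding F_def by (intro tendsto_intros tendsto_power_cexp w) (use w0 in auto)
    thus "((\<lambda>x. F (of_real x)) \<longlongrightarrow> 0) at_top" by simp
  qed (use integrable_power_cexp[OF w, of 0 2] in \<open>auto intro!: continuous_intros\<close>)
  thus ?thesis by (simp add: F_def)
qed

text \<open>A normal characteristic function turns a bound for the Fourier transform of \<open>f\<close> into one for its
  Gaussian averages; the bound does not depend on the width of the Gaussian.\<close>

lemma gaussian_average_bound:
  fixes f :: "real \<Rightarrow> real"
  assumes f: "integrable lborel f"
    and B: "\<And>t. norm (\<integral>v. of_real (f v) * exp (- (\<i> * of_real t * of_real v)) \<partial>lborel) \<le> B"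
  shows "\<bar>\<integral>v. f v * exp (- (T * (x - v))\<^sup>2 / 2) \<partial>lborel\<bar> \<le> B"
proof -
  let ?N = std_normal_distribution
  interpret N: real_distribution ?N by (rule real_dist_normal_dist)
  interpret P: pair_sigma_finite lborel ?N ..
  define g :: "real \<Rightarrow> real \<Rightarrow> complex" where "g v y = of_real (f v) * iexp (T * (x - v) * y)" for v y
  have fm[measurable]: "f \<in> borel_measurable borel" using f by auto
  have gm: "case_prod g \<in> borel_measurable (lborel \<Otimes>\<^sub>M ?N)" unfolding g_def by measurable
  have ng: "norm (g v y) = \<bar>f v\<bar>" for v y by (simp add: g_def norm_mult)
  have int: "integrable (lborel \<Otimes>\<^sub>M ?N) (case_prod g)"
  proof (rule P.Fubini_integrable[OF gm])
    show "integrable lborel (\<lambda>v. \<integral>y. norm (case (v, y) of (v, y) \<Rightarrow> g v y) \<partial>?N)"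
      using f by (simp add: ng N.prob_space)
    show "AE v in lborel. integrable ?N (\<lambda>y. case (v, y) of (v, y) \<Rightarrow> g v y)"
    proof (intro AE_I2)
      fix v :: real
      show "integrable ?N (\<lambda>y. case (v, y) of (v, y) \<Rightarrow> g v y)"
        unfolding prod.case by (rule N.integrable_const_bound[of _ "\<bar>f v\<bar>"]) (simp add: ng, unfold g_def, measurable)
    qed
  qed
  have "complex_of_real (\<integral>v. f v * exp (- (T * (x - v))\<^sup>2 / 2) \<partial>lborel) = (\<integral>v. of_real (f v * exp (- (T * (x - v))\<^sup>2 / 2)) \<partial>lborel)"
    by (rule integral_complex_of_real[symmetric])
  also have "\<dots> = (\<integral>v. \<integral>y. g v y \<partial>?N \<partial>lborel)"
  proof (rule Bochner_Integration.integral_cong[OF refl])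
    fix v :: real
    \<comment> \<open>The kernel is the characteristic function of the standard normal law at T (x -
      v); Fubini then moves the normal integral outside.\<close>
    have "(\<integral>y. iexp (T * (x - v) * y) \<partial>?N) = char ?N (T * (x - v))" by (simp add: char_def)
    also have "\<dots> = of_real (exp (- (T * (x - v))\<^sup>2 / 2))" by (simp add: char_std_normal_distribution)
    finally show "of_real (f v * exp (- (T * (x - v))\<^sup>2 / 2)) = (\<integral>y. g v y \<partial>?N)"
      by (simp add: g_def)
  qed
  also have "\<dots> = (\<integral>y. \<integral>v. g v y \<partial>lborel \<partial>?N)" by (rule P.Fubini_integral[OF int, symmetric])
  finally have eq: "complex_of_real (\<integral>v. f v * exp (- (T * (x - v))\<^sup>2 / 2) \<partial>lborel) = (\<integral>y. \<integral>v. g v y \<partial>lborel \<partial>?N)" .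
  \<comment> \<open>For fixed \<open>y\<close> the inner integral is a unimodular factor times the
    transform of \<open>f\<close> at frequency \<open>T * y\<close>. So \<open>T\<close> only
    rescales the frequency, and since the normal law has mass 1, \<open>B\<close> survives the
    averaging unchanged.\<close>
  have "norm (\<integral>v. g v y \<partial>lborel) \<le> B" for y
  proof -
    have "g v y = iexp (T * x * y) * (of_real (f v) * exp (- (\<i> * of_real (T * y) * of_real v)))" for v
      by (simp add: g_def algebra_simps flip: exp_add)
    hence "(\<integral>v. g v y \<partial>lborel) = iexp (T * x * y) * (\<integral>v. of_real (f v) * exp (- (\<i> * of_real (T * y) * of_real v)) \<partial>lborel)"
      by simp
    thus ?thesis using B[of "T * y"] by (simp only: norm_mult norm_exp_i_times mult_1)
  qed
  moreover have "integrable ?N (\<lambda>y. \<integral>v. g v y \<partial>lborel)" by (rule P.integrable_snd[OF int])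
  ultimately have "norm (\<integral>y. \<integral>v. g v y \<partial>lborel \<partial>?N) \<le> (\<integral>y. B \<partial>?N)"
    by (intro Bochner_Integration.integral_norm_bound_integral) auto
  thus ?thesis unfolding eq[symmetric] using N.prob_space by simp
qed

section \<open>The weighted von Mangoldt sum\<close>

definition mangoldt_ln2_sum :: "real \<Rightarrow> real" where
  "mangoldt_ln2_sum x = (\<Sum>n | real n \<le> x. mangoldt n * (ln (real n))\<^sup>2)"

text \<open>The subtracted term is \<open>exp (- v)\<close> times the integral of \<open>ln\<^sup>2\<close> over \<open>[1, exp v]\<close>.\<close>

definition remainder :: "real \<Rightarrow> real" where
  "remainder v = exp (- v) * mangoldt_ln2_sum (exp v) - (v\<^sup>2 - 2 * v + 2 - 2 * exp (- v))"

lemma finite_real_nat_le: "finite {n. real n \<le> x}"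
  by (rule finite_subset[of _ "{..nat \<lfloor>x\<rfloor>}"]) (auto simp: le_nat_floor)

lemma mangoldt_ln2_sum_mono: "x \<le> y \<Longrightarrow> mangoldt_ln2_sum x \<le> mangoldt_ln2_sum y"
  unfolding mangoldt_ln2_sum_def
  by (intro sum_mono2 finite_real_nat_le) (auto intro: mangoldt_nonneg mult_nonneg_nonneg)

lemma mangoldt_ln2_sum_nonneg: "0 \<le> mangoldt_ln2_sum x"
  unfolding mangoldt_ln2_sum_def by (intro sum_nonneg mult_nonneg_nonneg) (auto intro: mangoldt_nonneg)

text \<open>Trivial bound: at most exp v terms, each at most v^3. It serves for integrability and
  for the Gaussian tails.\<close>

lemma mangoldt_ln2_sum_exp_le:
  assumes "v \<ge> 0"
  shows "mangoldt_ln2_sum (exp v) \<le> exp v * v ^ 3"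
proof -
  let ?A = "{n. 0 < n \<and> real n \<le> exp v}"
  have "mangoldt_ln2_sum (exp v) = (\<Sum>n\<in>?A. mangoldt n * (ln (real n))\<^sup>2)"
    unfolding mangoldt_ln2_sum_def
    by (intro sum.mono_neutral_right finite_real_nat_le) (auto intro!: Nat.gr0I)
  also have "\<dots> \<le> (\<Sum>n\<in>?A. v ^ 3)"
  proof (rule sum_mono)
    fix n assume n: "n \<in> ?A"
    hence l: "0 \<le> ln (real n)" "ln (real n) \<le> v" using ln_le_cancel_iff[of "real n" "exp v"] by auto
    have "mangoldt n * (ln (real n))\<^sup>2 \<le> v * v\<^sup>2"
      using l mangoldt_le_ln[of n] by (intro mult_mono power_mono) auto
    thus "mangoldt n * (ln (real n))\<^sup>2 \<le> v ^ 3" by (simp add: power3_eq_cube power2_eq_square)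
  qed
  also have "\<dots> = real (card ?A) * v ^ 3" by simp
  finally have le: "mangoldt_ln2_sum (exp v) \<le> real (card ?A) * v ^ 3" .
  have "card ?A \<le> card {1..nat \<lfloor>exp v\<rfloor>}" by (intro card_mono) (auto simp: le_nat_floor)
  hence "card ?A \<le> nat \<lfloor>exp v\<rfloor>" by simp
  hence "real (card ?A) \<le> real (nat \<lfloor>exp v\<rfloor>)" by (rule of_nat_mono)
  also have "\<dots> \<le> exp v" by (rule of_nat_floor) simp
  finally have "real (card ?A) \<le> exp v" .
  hence "real (card ?A) * v ^ 3 \<le> exp v * v ^ 3" using assms by (intro mult_right_mono) auto
  with le show ?thesis by linarith
qed

lemma abs_remainder_le:
  assumes "v \<ge> 0"
  shows "\<bar>remainder v\<bar> \<le> v ^ 3 + v\<^sup>2 + 2 * v + 4"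
proof -
  have "exp (- v) * mangoldt_ln2_sum (exp v) \<le> exp (- v) * (exp v * v ^ 3)"
    by (intro mult_left_mono mangoldt_ln2_sum_exp_le assms) auto
  also have "\<dots> = v ^ 3" by (simp add: exp_minus)
  finally have "exp (- v) * mangoldt_ln2_sum (exp v) \<le> v ^ 3" .
  moreover have "0 \<le> exp (- v) * mangoldt_ln2_sum (exp v)" by (simp add: mangoldt_ln2_sum_nonneg)
  moreover have "0 \<le> exp (- v)" "exp (- v) \<le> 1" using assms by auto
  moreover have "0 \<le> v ^ 3" "0 \<le> v\<^sup>2" using assms by auto
  ultimately show ?thesis using assms unfolding remainder_def abs_le_iff by (intro conjI; linarith)
qed

lemma borel_measurable_mangoldt_ln2_sum [measurable]: "mangoldt_ln2_sum \<in> borel_measurable borel"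
  by (rule borel_measurable_mono) (auto simp: mono_def mangoldt_ln2_sum_mono)

lemma borel_measurable_remainder [measurable]: "remainder \<in> borel_measurable borel"
  unfolding remainder_def by measurable

lemma integrable_remainder:
  assumes "\<delta> > 0"
  shows "integrable lborel (\<lambda>v. indicator {0..} v * (remainder v * exp (- \<delta> * v)))"
proof (rule Bochner_Integration.integrable_bound)
  let ?g = "\<lambda>k v. indicator {0..} v * (v ^ k * exp (- \<delta> * v)) :: real"
  show "integrable lborel (\<lambda>v. ?g 3 v + ?g 2 v + 2 * ?g 1 v + 4 * ?g 0 v)"
    by (intro Bochner_Integration.integrable_add integrable_mult_right integrable_power_exp assms)
  show "(\<lambda>v. indicator {0..} v * (remainder v * exp (- \<delta> * v))) \<in> borel_measurable lborel" by measurable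
  show "AE v in lborel. norm (indicator {0..} v * (remainder v * exp (- \<delta> * v))) \<le> norm (?g 3 v + ?g 2 v + 2 * ?g 1 v + 4 * ?g 0 v)"
  proof (intro AE_I2)
    fix v :: real
    show "norm (indicator {0..} v * (remainder v * exp (- \<delta> * v))) \<le> norm (?g 3 v + ?g 2 v + 2 * ?g 1 v + 4 * ?g 0 v)"
    proof (cases "v \<ge> 0")
      case True
      have "\<bar>remainder v\<bar> * exp (- \<delta> * v) \<le> (v ^ 3 + v\<^sup>2 + 2 * v + 4) * exp (- \<delta> * v)"
        by (intro mult_right_mono abs_remainder_le True) auto
      also have "\<dots> = ?g 3 v + ?g 2 v + 2 * ?g 1 v + 4 * ?g 0 v" using True by (simp add: algebra_simps)
      finally show ?thesis using True by (simp add: abs_mult)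
    qed auto
  qed
qed

text \<open>The index n enters the sum at v = log n, so it contributes its coefficient times the
  integral of e^(-sv) over [log n, \<infinity>), which is n^(-s) / s. Absolute convergence at Re s
  justifies exchanging sum and integral.\<close>

lemma laplace_mangoldt_ln2_sum:
  fixes s :: complex
  assumes s: "Re s > 1"
  shows "integrable lborel (\<lambda>v. indicator {0..} v *\<^sub>R (of_real (mangoldt_ln2_sum (exp v)) * exp (- (s * of_real v))))"
    and "(\<integral>v. indicator {0..} v *\<^sub>R (of_real (mangoldt_ln2_sum (exp v)) * exp (- (s * of_real v))) \<partial>lborel) = mangoldt_ln2_series s / s"
proof -
  define a where "a n = mangoldt n * (ln (real n))\<^sup>2" for n
  have a: "a n \<ge> 0" for n by (simp add: a_def mangoldt_nonneg)
  have a0: "a 0 = 0" by (simp add: a_def)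
  define f :: "nat \<Rightarrow> real \<Rightarrow> complex" where "f n v = of_real (a n) * (indicator {ln (real n)..} v *\<^sub>R exp (- (s * of_real v)))" for n v
  have ln0: "ln (real n) \<ge> 0" for n by (cases "n = 0") auto
  have s0: "Re s > 0" using s by simp
  have int: "integrable lborel (f n)" for n
    unfolding f_def using integrable_power_cexp[OF s0 ln0[of n], of 0] by (intro integrable_mult_right) simp
  have iff: "ln (real n) \<le> v \<longleftrightarrow> real n \<le> exp v" if "n > 0" for n v
    using that by (metis exp_le_cancel_iff exp_ln of_nat_0_less_iff)
  have fin: "f n v = 0" if "n \<notin> {n. real n \<le> exp v}" for n v
    using that iff[of n v] a0 by (cases "n = 0") (auto simp: f_def indicator_def)
  have eq: "(\<Sum>n. f n v) = indicator {0..} v *\<^sub>R (of_real (mangoldt_ln2_sum (exp v)) * exp (- (s * of_real v)))" for v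
  proof -
    have "(\<Sum>n. f n v) = (\<Sum>n | real n \<le> exp v. f n v)"
      by (rule suminf_finite[OF finite_real_nat_le fin]) auto
    also have "\<dots> = (\<Sum>n | real n \<le> exp v. of_real (a n) * (indicator {0..} v *\<^sub>R exp (- (s * of_real v))))"
    proof (rule sum.cong[OF refl])
      fix n assume n: "n \<in> {n. real n \<le> exp v}"
      show "f n v = of_real (a n) * (indicator {0..} v *\<^sub>R exp (- (s * of_real v)))"
      proof (cases "n = 0")
        case False
        thus ?thesis using iff[of n v] n order.trans[OF ln0[of n], of v] by (auto simp: f_def indicator_def)
      qed (simp add: f_def a0)
    qed
    also have "\<dots> = indicator {0..} v *\<^sub>R (of_real (mangoldt_ln2_sum (exp v)) * exp (- (s * of_real v)))"
      unfolding mangoldt_ln2_sum_def a_def[symmetric] of_real_sum by (simp add: sum_distrib_right scaleR_sum_right)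
    finally show ?thesis .
  qed
  have smb: "AE v in lborel. summable (\<lambda>n. norm (f n v))"
    by (intro AE_I2 summable_finite[OF finite_real_nat_le]) (use fin in auto)
  have nf: "(\<integral>v. norm (f n v) \<partial>lborel) = \<bar>a n\<bar> * real n powr (- Re s) / Re s" for n
  proof -
    have "complex_of_real (\<integral>v. norm (f n v) \<partial>lborel) = (\<integral>v. of_real (norm (f n v)) \<partial>lborel)"
      by (rule integral_complex_of_real[symmetric])
    also have "\<dots> = (\<integral>v. of_real \<bar>a n\<bar> * (indicator {ln (real n)..} v *\<^sub>R exp (- (of_real (Re s) * of_real v))) \<partial>lborel)"
      by (intro Bochner_Integration.integral_cong refl)
         (auto simp: f_def norm_mult indicator_def exp_of_real simp flip: of_real_mult of_real_minus)
    also have "\<dots> = of_real \<bar>a n\<bar> * (exp (- (of_real (Re s) * of_real (ln (real n)))) / of_real (Re s))"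
      by (subst integral_mult_right_zero, subst integral_cexp) (use s0 ln0 in auto)
    also have "\<dots> = of_real (\<bar>a n\<bar> * exp (- (Re s * ln (real n))) / Re s)" by (simp add: exp_of_real flip: of_real_mult of_real_minus)
    finally have "(\<integral>v. norm (f n v) \<partial>lborel) = \<bar>a n\<bar> * exp (- (Re s * ln (real n))) / Re s" by (simp only: of_real_eq_iff)
    thus ?thesis by (cases "n = 0") (auto simp: a0 powr_def)
  qed
  have "summable (\<lambda>n. \<bar>a n\<bar> * real n powr (- Re s))"
    using dirichlet_abs_conv_mangoldt_ln2 s unfolding dirichlet_abs_conv_def a_def by blast
  hence smi: "summable (\<lambda>n. \<integral>v. norm (f n v) \<partial>lborel)" unfolding nf by (rule summable_divide)
  show "integrable lborel (\<lambda>v. indicator {0..} v *\<^sub>R (of_real (mangoldt_ln2_sum (exp v)) * exp (- (s * of_real v))))"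
    using integrable_suminf[OF int smb smi] unfolding eq .
  have fi: "(\<integral>v. f n v \<partial>lborel) = of_real (a n) * of_nat n powr (-s) / s" for n
  proof -
    have "(\<integral>v. f n v \<partial>lborel) = of_real (a n) * (exp (- (s * of_real (ln (real n)))) / s)"
      unfolding f_def by (subst integral_mult_right_zero, subst integral_cexp) (use s0 ln0 in auto)
    thus ?thesis by (cases "n = 0") (auto simp: a0 powr_def Ln_of_nat)
  qed
  have "(\<lambda>n. of_real (a n) * of_nat n powr (-s) / s) sums (\<integral>v. indicator {0..} v *\<^sub>R (of_real (mangoldt_ln2_sum (exp v)) * exp (- (s * of_real v))) \<partial>lborel)"
    using sums_integral[OF int smb smi] unfolding eq fi .
  moreover have "(\<lambda>n. of_real (a n) * of_nat n powr (-s) / s) sums (mangoldt_ln2_series s / s)"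
    unfolding a_def by (intro sums_divide dirichlet_sums dirichlet_abs_conv_mangoldt_ln2 s)
  ultimately show "(\<integral>v. indicator {0..} v *\<^sub>R (of_real (mangoldt_ln2_sum (exp v)) * exp (- (s * of_real v))) \<partial>lborel) = mangoldt_ln2_series s / s"
    by (rule sums_unique2)
qed

text \<open>The factor \<open>exp (- \<delta> * v)\<close> makes the remainder integrable and places
  the transform on the line Re s = 1 + \<delta>. The term subtracted in \<open>remainder\<close> has
  exactly the polar part 2 / (s - 1)^3, divided by s, as its transform.\<close>

lemma fourier_remainder:
  fixes \<delta> t :: real
  assumes \<delta>: "\<delta> > 0"
  defines "s \<equiv> Complex (1 + \<delta>) t"
  shows "(\<integral>v. of_real (indicator {0..} v * (remainder v * exp (- \<delta> * v))) * exp (- (\<i> * of_real t * of_real v)) \<partial>lborel)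
    = (mangoldt_ln2_series s - 2 / (s - 1) ^ 3) / s"
proof -
  have s: "Re s > 1" "Re (s - 1) > 0" "Re s > 0" using \<delta> by (auto simp: s_def)
  have s0: "s \<noteq> 0" "s - 1 \<noteq> 0" using s by auto
  define E :: "nat \<Rightarrow> complex \<Rightarrow> real \<Rightarrow> complex" where "E k w v = indicator {0..} v *\<^sub>R (of_real v ^ k * exp (- (w * of_real v)))" for k w v
  define G where "G = (\<lambda>v. indicator {0..} v *\<^sub>R (of_real (mangoldt_ln2_sum (exp v)) * exp (- (s * of_real v))))"
  have iE: "integrable lborel (E k w)" if "Re w > 0" for k w
    unfolding E_def using that by (intro integrable_power_cexp) auto
  have iG: "integrable lborel G" and vG: "(\<integral>v. G v \<partial>lborel) = mangoldt_ln2_series s / s"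
    using laplace_mangoldt_ln2_sum[OF s(1)] by (auto simp: G_def)
  have E: "(\<integral>v. E 0 w v \<partial>lborel) = 1 / w" "(\<integral>v. E 1 w v \<partial>lborel) = 1 / w\<^sup>2" "(\<integral>v. E 2 w v \<partial>lborel) = 2 / w ^ 3" if "Re w > 0" for w
    using integral_cexp[OF that, of 0] integral_id_cexp[OF that] integral_square_cexp[OF that] by (simp_all add: E_def)
  have "of_real (indicator {0..} v * (remainder v * exp (- \<delta> * v))) * exp (- (\<i> * of_real t * of_real v))
    = G v - (E 2 (s - 1) v - 2 * E 1 (s - 1) v + 2 * E 0 (s - 1) v - 2 * E 0 s v)" for v
  proof (cases "v \<ge> 0")
    case True
    define c where "c = exp (- ((s - 1) * of_real v))"
    have "(s - 1) = of_real \<delta> + \<i> * of_real t" by (simp add: s_def complex_eq_iff)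
    hence c: "exp (- of_real (\<delta> * v)) * exp (- (\<i> * of_real t * of_real v)) = c"
      unfolding c_def by (simp add: algebra_simps flip: exp_add)
    have d: "exp (- (s * of_real v)) = c * exp (- of_real v)"
      unfolding c_def by (simp add: algebra_simps flip: exp_add)
    have "of_real (indicator {0..} v * (remainder v * exp (- \<delta> * v))) * exp (- (\<i> * of_real t * of_real v))
       = of_real (remainder v) * (exp (- of_real (\<delta> * v)) * exp (- (\<i> * of_real t * of_real v)))"
      using True by (simp add: exp_of_real flip: of_real_mult of_real_minus)
    also have "\<dots> = of_real (remainder v) * c" unfolding c ..
    also have "\<dots> = G v - (E 2 (s - 1) v - 2 * E 1 (s - 1) v + 2 * E 0 (s - 1) v - 2 * E 0 s v)"
      using True unfolding G_def E_def d c_def[symmetric] remainder_def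
      by (simp add: exp_of_real algebra_simps flip: of_real_minus)
    finally show ?thesis .
  qed (auto simp: G_def E_def)
  hence "(\<integral>v. of_real (indicator {0..} v * (remainder v * exp (- \<delta> * v))) * exp (- (\<i> * of_real t * of_real v)) \<partial>lborel)
    = (\<integral>v. G v - (E 2 (s - 1) v - 2 * E 1 (s - 1) v + 2 * E 0 (s - 1) v - 2 * E 0 s v) \<partial>lborel)" by simp
  also have "\<dots> = mangoldt_ln2_series s / s - (2 / (s - 1) ^ 3 - 2 * (1 / (s - 1)\<^sup>2) + 2 * (1 / (s - 1)) - 2 * (1 / s))"
    using s iG iE by (simp add: vG E E(2)[unfolded One_nat_def])
  \<comment> \<open>With w = s - 1 this amounts to (w + 1) (w^2 - w + 1) - w^3 = 1.\<close>
  also have "2 / (s - 1) ^ 3 - 2 * (1 / (s - 1)\<^sup>2) + 2 * (1 / (s - 1)) - 2 * (1 / s) = 2 / (s - 1) ^ 3 / s"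
  proof -
    define w where "w = s - 1"
    have sw: "s = w + 1" by (simp add: w_def)
    have w: "w \<noteq> 0" "w + 1 \<noteq> 0" using s0 by (auto simp: sw)
    have "2 / w ^ 3 - 2 * (1 / w\<^sup>2) + 2 * (1 / w) - 2 * (1 / (w + 1)) = 2 / w ^ 3 / (w + 1)"
      using w by (simp add: field_simps power2_eq_square power3_eq_cube)
    thus ?thesis by (simp add: sw)
  qed
  finally show ?thesis by (simp add: diff_divide_distrib)
qed

section \<open>Local averages of the remainder\<close>

text \<open>Unnormalised: the peak is 1 and the mass is of order 1/T, so a bound for the integral
  against it bounds means over a window of width 1/T only up to a factor of order T.\<close>

definition gauss :: "real \<Rightarrow> real \<Rightarrow> real" where
  "gauss T u = exp (- (T * u)\<^sup>2 / 2)"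

text \<open>The square of T (y - v) + 1/T is nonnegative. Decay like e^(-v), with a constant
  depending on \<open>T\<close> and \<open>y\<close>, is what integrability and dominated
  convergence ask for.\<close>

lemma gauss_le_exp:
  assumes "T > 0"
  shows "gauss T (y - v) \<le> exp (y + 1 / (2 * T\<^sup>2)) * exp (- v)"
proof -
  have "0 \<le> (T * (y - v) + 1 / T)\<^sup>2" by simp
  also have "\<dots> = (T * (y - v))\<^sup>2 + 2 * (y - v) + 1 / T\<^sup>2"
    using assms by (simp add: power2_eq_square field_simps)
  finally have "- (T * (y - v))\<^sup>2 / 2 \<le> (y + 1 / (2 * T\<^sup>2)) - v" by (simp add: field_simps)
  thus ?thesis unfolding gauss_def by (simp flip: exp_add)
qed

lemma borel_measurable_gauss [measurable]: "gauss T \<in> borel_measurable borel"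
  unfolding gauss_def by measurable

text \<open>\<open>e\<close> stands for the damping factor, or for 1 when there is none; the
  majorant is free of it.\<close>

lemma norm_remainder_gauss_le:
  assumes "T > 0" "0 \<le> e" "e \<le> 1"
  shows "norm (indicator {0..} v * (remainder v * e) * gauss T (y - v)) \<le>
    exp (y + 1 / (2 * T\<^sup>2)) * \<bar>indicator {0..} v * (remainder v * exp (- 1 * v))\<bar>"
proof -
  have "\<bar>remainder v\<bar> * e * gauss T (y - v) \<le> \<bar>remainder v\<bar> * 1 * (exp (y + 1 / (2 * T\<^sup>2)) * exp (- v))"
    using assms by (intro mult_mono gauss_le_exp) (auto simp: gauss_def)
  thus ?thesis using assms by (auto simp: indicator_def abs_mult gauss_def mult_ac)
qed

lemma integrable_remainder_gauss:
  assumes "T > 0"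
  shows "integrable lborel (\<lambda>v. indicator {0..} v * remainder v * gauss T (y - v))"
proof (rule Bochner_Integration.integrable_bound)
  show "integrable lborel (\<lambda>v. exp (y + 1 / (2 * T\<^sup>2)) * \<bar>indicator {0..} v * (remainder v * exp (- 1 * v))\<bar>)"
    using integrable_remainder[of 1] by (intro integrable_mult_right integrable_abs) auto
  show "AE v in lborel. norm (indicator {0..} v * remainder v * gauss T (y - v)) \<le>
     norm (exp (y + 1 / (2 * T\<^sup>2)) * \<bar>indicator {0..} v * (remainder v * exp (- 1 * v))\<bar>)"
    using norm_remainder_gauss_le[OF assms, of 1] by (intro AE_I2) (simp add: abs_mult mult_ac)
qed measurable

text \<open>The damped averages have a common bound \<open>B\<close>, and the damping exponents
  \<open>d n\<close> tend to 0, so \<open>B\<close> also bounds the limit. It depends neither on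
  \<open>T\<close> nor on \<open>y\<close>.\<close>

lemma remainder_gauss_bound:
  "\<exists>B. \<forall>T y. T > 0 \<longrightarrow> \<bar>\<integral>v. indicator {0..} v * remainder v * gauss T (y - v) \<partial>lborel\<bar> \<le> B"
proof -
  obtain \<delta> B where \<delta>: "0 < \<delta>" and B: "\<And>s. 1 < Re s \<Longrightarrow> Re s \<le> 1 + \<delta> \<Longrightarrow> norm ((mangoldt_ln2_series s - 2 / (s - 1) ^ 3) / s) \<le> B"
    using mangoldt_ln2_series_bound by blast
  show ?thesis
  proof (intro exI[of _ B] allI impI)
    fix T y :: real assume T: "T > 0"
    define d where "d n = \<delta> / real (Suc n)" for n
    have d: "0 < d n" "d n \<le> \<delta>" for n using \<delta> by (auto simp: d_def field_simps)
    have bd: "\<bar>\<integral>v. indicator {0..} v * (remainder v * exp (- d n * v)) * gauss T (y - v) \<partial>lborel\<bar> \<le> B" for n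
      unfolding gauss_def
    proof (rule gaussian_average_bound[OF integrable_remainder[OF d(1)]])
      fix t
      show "norm (\<integral>v. of_real (indicator {0..} v * (remainder v * exp (- d n * v))) * exp (- (\<i> * of_real t * of_real v)) \<partial>lborel) \<le> B"
        unfolding fourier_remainder[OF d(1)] by (rule B) (use d[of n] in auto)
    qed
    have "(\<lambda>n. \<integral>v. indicator {0..} v * (remainder v * exp (- d n * v)) * gauss T (y - v) \<partial>lborel)
       \<longlonglongrightarrow> (\<integral>v. indicator {0..} v * remainder v * gauss T (y - v) \<partial>lborel)"
    proof (rule integral_dominated_convergence)
      show "integrable lborel (\<lambda>v. exp (y + 1 / (2 * T\<^sup>2)) * \<bar>indicator {0..} v * (remainder v * exp (- 1 * v))\<bar>)"
        using integrable_remainder[of 1] by (intro integrable_mult_right integrable_abs) auto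
      show "AE v in lborel. (\<lambda>n. indicator {0..} v * (remainder v * exp (- d n * v)) * gauss T (y - v)) \<longlonglongrightarrow> indicator {0..} v * remainder v * gauss T (y - v)"
      proof (intro AE_I2)
        fix v :: real
        have "d \<longlonglongrightarrow> 0" unfolding d_def by real_asymp
        hence "(\<lambda>n. indicator {0..} v * (remainder v * exp (- d n * v)) * gauss T (y - v)) \<longlonglongrightarrow> indicator {0..} v * (remainder v * exp (- 0 * v)) * gauss T (y - v)"
          by (intro tendsto_intros)
        thus "(\<lambda>n. indicator {0..} v * (remainder v * exp (- d n * v)) * gauss T (y - v)) \<longlonglongrightarrow> indicator {0..} v * remainder v * gauss T (y - v)" by simp
      qed
      fix n
      show "AE v in lborel. norm (indicator {0..} v * (remainder v * exp (- d n * v)) * gauss T (y - v)) \<le>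
         exp (y + 1 / (2 * T\<^sup>2)) * \<bar>indicator {0..} v * (remainder v * exp (- 1 * v))\<bar>"
      proof (intro AE_I2)
        fix v :: real
        show "norm (indicator {0..} v * (remainder v * exp (- d n * v)) * gauss T (y - v)) \<le>
          exp (y + 1 / (2 * T\<^sup>2)) * \<bar>indicator {0..} v * (remainder v * exp (- 1 * v))\<bar>"
        proof (cases "v \<ge> 0")
          case True
          thus ?thesis using d[of n] by (intro norm_remainder_gauss_le T) auto
        qed auto
      qed
    qed measurable
    hence "(\<lambda>n. \<bar>\<integral>v. indicator {0..} v * (remainder v * exp (- d n * v)) * gauss T (y - v) \<partial>lborel\<bar>)
       \<longlonglongrightarrow> \<bar>\<integral>v. indicator {0..} v * remainder v * gauss T (y - v) \<partial>lborel\<bar>" by (rule tendsto_rabs)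
    thus "\<bar>\<integral>v. indicator {0..} v * remainder v * gauss T (y - v) \<partial>lborel\<bar> \<le> B"
      by (rule LIMSEQ_le_const2) (use bd in auto)
  qed
qed

lemma integrable_cubic_gauss: "integrable lborel (\<lambda>u::real. (1 + \<bar>u\<bar>) ^ 3 * exp (- u\<^sup>2 / 2))"
proof -
  have "integrable lborel (\<lambda>u. sqrt (2 * pi) * (std_normal_density u * \<bar>u\<bar> ^ 0 + 3 * (std_normal_density u * \<bar>u\<bar> ^ 1) + 3 * (std_normal_density u * \<bar>u\<bar> ^ 2) + std_normal_density u * \<bar>u\<bar> ^ 3))"
    by (intro integrable_mult_right Bochner_Integration.integrable_add integrable_std_normal_moment_abs)
  also have "(\<lambda>u. sqrt (2 * pi) * (std_normal_density u * \<bar>u\<bar> ^ 0 + 3 * (std_normal_density u * \<bar>u\<bar> ^ 1) + 3 * (std_normal_density u * \<bar>u\<bar> ^ 2) + std_normal_density u * \<bar>u\<bar> ^ 3))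
      = (\<lambda>u. (1 + \<bar>u\<bar>) ^ 3 * exp (- u\<^sup>2 / 2))"
  proof
    fix u :: real
    have "sqrt (2 * pi) * std_normal_density u = exp (- u\<^sup>2 / 2)" by (simp add: std_normal_density_def)
    moreover have "sqrt (2 * pi) * (std_normal_density u * \<bar>u\<bar> ^ 0 + 3 * (std_normal_density u * \<bar>u\<bar> ^ 1) + 3 * (std_normal_density u * \<bar>u\<bar> ^ 2) + std_normal_density u * \<bar>u\<bar> ^ 3)
      = (sqrt (2 * pi) * std_normal_density u) * (1 + \<bar>u\<bar>) ^ 3"
      unfolding power3_eq_cube power2_eq_square by (simp only: power_0 power_one_right) algebra
    ultimately show "sqrt (2 * pi) * (std_normal_density u * \<bar>u\<bar> ^ 0 + 3 * (std_normal_density u * \<bar>u\<bar> ^ 1) + 3 * (std_normal_density u * \<bar>u\<bar> ^ 2) + std_normal_density u * \<bar>u\<bar> ^ 3)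
      = (1 + \<bar>u\<bar>) ^ 3 * exp (- u\<^sup>2 / 2)" by (simp only: mult.commute)
  qed
  finally show ?thesis .
qed

text \<open>With T = x, half of the Gaussian exponent gives
  \<open>exp (- 4 * (ln x)\<^sup>2)\<close>, which beats every power of x; the other half leaves a
  Gaussian in v - y that absorbs the cubic growth. The inequality 1 + v \<le> (2 + x) (1 + |v - y|)
  separates the two kinds of growth.\<close>

lemma remainder_gauss_tail:
  assumes x: "x \<ge> 2" and \<eta>: "x * \<eta> = 4 * ln x" and y: "0 \<le> y" "y \<le> x + 1" and v: "v \<ge> 0" "\<eta> < \<bar>y - v\<bar>"
  shows "\<bar>remainder v\<bar> * gauss x (y - v) \<le> 4 * (2 + x) ^ 3 * exp (- 4 * (ln x)\<^sup>2) * ((1 + \<bar>v - y\<bar>) ^ 3 * exp (- (v - y)\<^sup>2 / 2))"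
proof -
  define u where "u = \<bar>v - y\<bar>"
  have u: "u \<ge> 0" "\<eta> < u" using v by (auto simp: u_def)
  have "\<eta> = 4 * ln x / x" using \<eta> x by (simp add: field_simps)
  hence \<eta>0: "\<eta> \<ge> 0" using x by simp
  have "\<bar>remainder v\<bar> \<le> v ^ 3 + v\<^sup>2 + 2 * v + 4" by (rule abs_remainder_le[OF v(1)])
  also have "\<dots> \<le> 4 * (1 + v) ^ 3" using v(1) by (simp add: power3_eq_cube power2_eq_square algebra_simps)
  also have "\<dots> \<le> 4 * ((2 + x) * (1 + u)) ^ 3"
  proof (intro mult_left_mono power_mono)
    have "v \<le> y + u" by (auto simp: u_def)
    also have "1 + (y + u) \<le> (1 + (x + 1)) * (1 + u)" using y x u(1) by (simp add: algebra_simps) (use mult_nonneg_nonneg[of u x] in linarith)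
    finally show "1 + v \<le> (2 + x) * (1 + u)" by simp
  qed (use v in auto)
  finally have 1: "\<bar>remainder v\<bar> \<le> 4 * (2 + x) ^ 3 * (1 + u) ^ 3" by (simp add: power_mult_distrib mult_ac)
  have "(x * \<eta>)\<^sup>2 \<le> (x * u)\<^sup>2" using x u \<eta>0 by (intro power_mono mult_left_mono) auto
  hence "16 * (ln x)\<^sup>2 \<le> x\<^sup>2 * u\<^sup>2" unfolding \<eta> by (simp add: power_mult_distrib)
  moreover have "2\<^sup>2 * u\<^sup>2 \<le> x\<^sup>2 * u\<^sup>2" using x by (intro mult_right_mono power_mono) auto
  ultimately have "- (x * u)\<^sup>2 / 2 \<le> - 4 * (ln x)\<^sup>2 + - u\<^sup>2 / 2" by (simp add: power_mult_distrib) (use zero_le_power2[of u] in linarith)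
  hence 2: "gauss x u \<le> exp (- 4 * (ln x)\<^sup>2) * exp (- u\<^sup>2 / 2)" unfolding gauss_def exp_add[symmetric] by simp
  have "\<bar>remainder v\<bar> * gauss x u \<le> (4 * (2 + x) ^ 3 * (1 + u) ^ 3) * (exp (- 4 * (ln x)\<^sup>2) * exp (- u\<^sup>2 / 2))"
    by (intro mult_mono 1 2) (use x u in \<open>auto simp: gauss_def\<close>)
  moreover have "gauss x u = gauss x (y - v)" by (simp add: u_def gauss_def power_mult_distrib power2_commute)
  moreover have "u\<^sup>2 = (v - y)\<^sup>2" by (simp add: u_def)
  ultimately show ?thesis by (simp add: u_def mult_ac)
qed

text \<open>If the remainder, up to the sign \<open>\<epsilon>\<close>, is at least L > 0 on the
  window around y, then its Gaussian average with T = x is at least L/x minus a tail smaller than 1.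
  As the average is bounded, L is O(x). The two signs serve the upper and the lower
  estimate.\<close>

lemma remainder_local_bound:
  "\<exists>B>0. \<forall>\<^sub>F x in at_top. \<forall>y \<eta> \<epsilon> L. x * \<eta> = 4 * ln x \<longrightarrow> \<bar>y - x\<bar> \<le> 1 \<longrightarrow> \<bar>\<epsilon>\<bar> = 1 \<longrightarrow>
      (\<forall>v. \<bar>y - v\<bar> \<le> \<eta> \<longrightarrow> L \<le> \<epsilon> * remainder v) \<longrightarrow> L \<le> B * x"
proof -
  obtain B where B: "\<And>T y. T > 0 \<Longrightarrow> \<bar>\<integral>v. indicator {0..} v * remainder v * gauss T (y - v) \<partial>lborel\<bar> \<le> B"
    using remainder_gauss_bound by blast
  have B0: "B \<ge> 0" using B[of 1 0] by auto
  define h where "h u = (1 + \<bar>u\<bar>) ^ 3 * exp (- u\<^sup>2 / 2)" for u :: real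
  have ih: "integrable lborel h" unfolding h_def by (rule integrable_cubic_gauss)
  define C where "C = (\<integral>u. h u \<partial>lborel)"
  have "((\<lambda>x::real. 4 * (2 + x) ^ 3 * exp (- 4 * (ln x)\<^sup>2) * C) \<longlongrightarrow> 0) at_top" by real_asymp
  hence ev1: "\<forall>\<^sub>F x in at_top. 4 * (2 + x) ^ 3 * exp (- 4 * (ln x)\<^sup>2) * C < 1" by (rule order_tendstoD) simp
  \<comment> \<open>The first condition gives \<open>\<eta>\<close> < 1, so that the window stays in
    v \<ge> 0; the second gives 1/x \<le> \<open>\<eta>\<close>, so that the core interval of radius
    1/x lies inside the window.\<close>
  have ev2: "\<forall>\<^sub>F x::real in at_top. 4 * ln x / x < 1 \<and> 1 < 4 * ln x"
    by (intro eventually_conj; real_asymp)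
  show ?thesis
  proof (rule exI[of _ "B + 1"], intro conjI)
    show "\<forall>\<^sub>F x in at_top. \<forall>y \<eta> \<epsilon> L. x * \<eta> = 4 * ln x \<longrightarrow> \<bar>y - x\<bar> \<le> 1 \<longrightarrow> \<bar>\<epsilon>\<bar> = 1 \<longrightarrow>
      (\<forall>v. \<bar>y - v\<bar> \<le> \<eta> \<longrightarrow> L \<le> \<epsilon> * remainder v) \<longrightarrow> L \<le> (B + 1) * x"
      using ev1 ev2 eventually_ge_at_top[of 3]
    proof eventually_elim
      case (elim x)
      show ?case
      proof (intro allI impI)
        fix y \<eta> \<epsilon> L :: real
        assume \<eta>: "x * \<eta> = 4 * ln x" and y: "\<bar>y - x\<bar> \<le> 1" and \<epsilon>: "\<bar>\<epsilon>\<bar> = 1" and L: "\<forall>v. \<bar>y - v\<bar> \<le> \<eta> \<longrightarrow> L \<le> \<epsilon> * remainder v"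
        have x: "x \<ge> 3" using elim by simp
        have \<eta>': "\<eta> = 4 * ln x / x" using \<eta> x by (simp add: field_simps)
        have \<eta>1: "\<eta> < 1" "1 / x \<le> \<eta>" using elim x by (auto simp: \<eta>' divide_right_mono)
        show "L \<le> (B + 1) * x"
        proof (cases "L \<le> 0")
          case True
          moreover have "0 \<le> (B + 1) * x" using B0 x by simp
          ultimately show ?thesis by linarith
        next
          case False
          define K where "K = 4 * (2 + x) ^ 3 * exp (- 4 * (ln x)\<^sup>2)"
          have K: "K \<ge> 0" using x by (simp add: K_def)
          \<comment> \<open>On the core interval the kernel is at least exp (-1/2) \<ge> 1/2, in the
            rest of the window the integrand is nonnegative, and outside the window the tail
            estimate applies. The core has length 2/x, so the first term integrates to L/x.\<close>
          have lower: "(L / 2) * indicator {y - 1/x..y + 1/x} v - K * h (v - y) \<le> \<epsilon> * (indicator {0..} v * remainder v * gauss x (y - v))" for v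
          proof (cases "\<bar>y - v\<bar> \<le> \<eta>")
            case True
            have v0: "v \<ge> 0" using True y \<eta>1 x by linarith
            have "(L / 2) * indicator {y - 1/x..y + 1/x} v \<le> L * gauss x (y - v)"
            proof (cases "v \<in> {y - 1/x..y + 1/x}")
              case True
              hence "\<bar>y - v\<bar> \<le> 1 / x" by auto
              hence "x * \<bar>y - v\<bar> \<le> 1" using x by (simp add: field_simps)
              hence "\<bar>x * (y - v)\<bar> \<le> 1" using x by (simp add: abs_mult)
              hence "(x * (y - v))\<^sup>2 \<le> 1" by (simp add: abs_square_le_1)
              hence "exp (- 1 / 2) \<le> gauss x (y - v)" by (simp add: gauss_def)
              moreover have "1 / 2 \<le> exp (- 1 / 2 :: real)" using exp_ge_add_one_self[of "- 1 / 2 :: real"] by simp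
              ultimately have "L * (1 / 2) \<le> L * gauss x (y - v)" using False by (intro mult_left_mono) auto
              with True show ?thesis by simp
            qed (use False in \<open>auto simp: gauss_def\<close>)
            also have "\<dots> \<le> (\<epsilon> * remainder v) * gauss x (y - v)"
              using L True by (intro mult_right_mono) (auto simp: gauss_def)
            finally have "(L / 2) * indicator {y - 1/x..y + 1/x} v \<le> \<epsilon> * (indicator {0..} v * remainder v * gauss x (y - v))"
              using v0 by (simp add: mult_ac)
            moreover have "0 \<le> K * h (v - y)" using K by (simp add: h_def)
            ultimately show ?thesis by linarith
          next
            case outer: False
            have i0: "indicator {y - 1/x..y + 1/x} v = (0::real)" using outer \<eta>1 by (auto simp: indicator_def)
            show ?thesis
            proof (cases "v \<ge> 0")
              case True
              have "\<bar>remainder v\<bar> * gauss x (y - v) \<le> K * h (v - y)"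
                unfolding K_def h_def by (rule remainder_gauss_tail[OF _ \<eta>]) (use x y True outer in auto)
              moreover have "\<bar>\<epsilon> * (remainder v * gauss x (y - v))\<bar> = \<bar>remainder v\<bar> * gauss x (y - v)"
                using \<epsilon> by (simp add: abs_mult gauss_def)
              ultimately have "- (K * h (v - y)) \<le> \<epsilon> * (remainder v * gauss x (y - v))" by linarith
              thus ?thesis using True i0 by simp
            next
              case False
              have "0 \<le> K * h (v - y)" using K by (simp add: h_def)
              thus ?thesis using False i0 by simp
            qed
          qed
          have ihs: "integrable lborel (\<lambda>v. h (v - y))" and vhs: "(\<integral>v. h (v - y) \<partial>lborel) = C"
            using lborel_integrable_real_affine[OF ih, of 1 "-y"] lborel_integral_real_affine[of 1 h "-y"] by (simp_all add: C_def)
          have ii: "integrable lborel (\<lambda>v. (L / 2) * indicator {y - 1/x..y + 1/x} v)" 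
            by (intro integrable_mult_right integrable_real_indicator) (simp_all add: emeasure_lborel_Icc_eq)
          have vi: "(\<integral>v. (L / 2) * indicator {y - 1/x..y + 1/x} v \<partial>lborel) = L / x"
            using x by simp
          have "L / x - K * C = (\<integral>v. (L / 2) * indicator {y - 1/x..y + 1/x} v - K * h (v - y) \<partial>lborel)"
            using vi vhs by (subst Bochner_Integration.integral_diff[OF ii integrable_mult_right[OF ihs]]) simp
          also have "\<dots> \<le> (\<integral>v. \<epsilon> * (indicator {0..} v * remainder v * gauss x (y - v)) \<partial>lborel)"
            using x by (intro integral_mono lower integrable_mult_right integrable_remainder_gauss Bochner_Integration.integrable_diff ii ihs) auto
          also have "\<dots> = \<epsilon> * (\<integral>v. indicator {0..} v * remainder v * gauss x (y - v) \<partial>lborel)" by simp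
          also have "\<dots> \<le> B" using B[of x y] x \<epsilon> by (auto simp: abs_if split: if_splits)
          finally have "L / x \<le> B + 1" using elim by (simp add: K_def)
          thus ?thesis using x by (simp add: field_simps)
        qed
      qed
    qed
  qed (use B0 in auto)
qed

section \<open>The prime number theorem with an error term\<close>

abbreviation mangoldt_ln2_mean :: "real \<Rightarrow> real" where
  "mangoldt_ln2_mean v \<equiv> exp (- v) * mangoldt_ln2_sum (exp v)"

text \<open>Monotonicity of the sum in disguise: the mean may fall as its argument grows, but not
  faster than exp (-v).\<close>

lemma mangoldt_ln2_mean_shift:
  assumes "u \<le> v"
  shows "mangoldt_ln2_mean u \<le> exp (v - u) * mangoldt_ln2_mean v"
proof -
  have "mangoldt_ln2_mean u \<le> exp (- u) * mangoldt_ln2_sum (exp v)"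
    using assms by (intro mult_left_mono mangoldt_ln2_sum_mono) auto
  also have "\<dots> = exp (v - u) * mangoldt_ln2_mean v" by (simp add: exp_diff exp_minus field_simps)
  finally show ?thesis .
qed

text \<open>A mean at x that deviates from x^2 by much more than x ln x makes the remainder large
  with one sign on a whole window of length 2\<eta>, to the right of x if it is too big and to the
  left if it is too small. \<open>remainder_local_bound\<close> excludes both. The cost of moving
  within the window is of order \<eta> x^2 = 4 x ln x.\<close>

lemma mangoldt_ln2_mean_asymp:
  "\<exists>C>0. \<forall>\<^sub>F x in at_top. \<bar>mangoldt_ln2_mean x - x\<^sup>2\<bar> \<le> C * (x * ln x)"
proof -
  obtain B where B: "B > 0" and evB: "\<forall>\<^sub>F x in at_top. \<forall>y \<eta> \<epsilon> L. x * \<eta> = 4 * ln x \<longrightarrow> \<bar>y - x\<bar> \<le> 1 \<longrightarrow> \<bar>\<epsilon>\<bar> = 1 \<longrightarrow>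
      (\<forall>v. \<bar>y - v\<bar> \<le> \<eta> \<longrightarrow> L \<le> \<epsilon> * remainder v) \<longrightarrow> L \<le> B * x"
    using remainder_local_bound by blast
  \<comment> \<open>Collects the terms (B + 19) x, 16 x ln x and 16 (B + 19) ln x of the upper
    bound.\<close>
  define C where "C = 17 * (B + 19) + 16"
  have C: "C > 0" using B by (simp add: C_def)
  have ev: "\<forall>\<^sub>F x::real in at_top. 4 * ln x / x \<le> 1 / 4 \<and> 1 \<le> ln x \<and> ln x \<le> x"
    by (intro eventually_conj; real_asymp)
  show ?thesis
  proof (rule exI[of _ "16 * C + B + 34 + C"], intro conjI)
    show "\<forall>\<^sub>F x in at_top. \<bar>mangoldt_ln2_mean x - x\<^sup>2\<bar> \<le> (16 * C + B + 34 + C) * (x * ln x)"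
      using evB ev eventually_ge_at_top[of 3]
    proof eventually_elim
      case (elim x)
      define \<eta> where "\<eta> = 4 * ln x / x"
      have x: "x \<ge> 3" and lnx: "1 \<le> ln x" "ln x \<le> x" and \<eta>: "\<eta> \<le> 1 / 4" "0 \<le> \<eta>" "x * \<eta> = 4 * ln x"
        using elim by (auto simp: \<eta>_def)
      have loc: "L \<le> B * x" if "\<bar>y - x\<bar> \<le> 1" "\<bar>\<epsilon>\<bar> = 1" "\<And>v. \<bar>y - v\<bar> \<le> \<eta> \<Longrightarrow> L \<le> \<epsilon> * remainder v" for y \<epsilon> L
        using elim(1) \<eta>(3) that by blast
      define P where "P = mangoldt_ln2_mean x"
      have P: "P \<ge> 0" by (simp add: P_def mangoldt_ln2_sum_nonneg)
      have xx: "x \<le> x * ln x" "0 \<le> x * ln x" using x lnx by auto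
      \<comment> \<open>On [x, x + 2\<eta>] the mean is at least exp (-2\<eta>) P \<ge> (1 -
        2\<eta>) P.\<close>
      have "(1 - 2 * \<eta>) * P - (x + 2 * \<eta>)\<^sup>2 - 2 \<le> B * x"
      proof (rule loc[of "x + \<eta>" 1])
        fix v assume "\<bar>x + \<eta> - v\<bar> \<le> \<eta>"
        hence v: "x \<le> v" "v \<le> x + 2 * \<eta>" by auto
        have "1 - 2 * \<eta> \<le> exp (- (v - x))"
          using exp_ge_add_one_self[of "- (v - x)"] v by linarith
        hence "(1 - 2 * \<eta>) * P \<le> exp (- (v - x)) * P" using P by (rule mult_right_mono)
        also have "\<dots> \<le> exp (- (v - x)) * (exp (v - x) * mangoldt_ln2_mean v)"
          unfolding P_def by (intro mult_left_mono mangoldt_ln2_mean_shift v) auto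
        also have "\<dots> = mangoldt_ln2_mean v" by (simp only: mult.assoc[symmetric] exp_add[symmetric]) simp
        finally have "(1 - 2 * \<eta>) * P \<le> mangoldt_ln2_mean v" .
        moreover have "v\<^sup>2 \<le> (x + 2 * \<eta>)\<^sup>2" using v x by (intro power_mono) auto
        moreover have "0 \<le> exp (- v)" by simp
        moreover have "q - r - 2 \<le> 1 * (w - (s - 2 * v + 2 - 2 * e))" if "q \<le> w" "s \<le> r" "0 \<le> e" for q r s w e :: real
          using that v x by simp
        ultimately show "(1 - 2 * \<eta>) * P - (x + 2 * \<eta>)\<^sup>2 - 2 \<le> 1 * remainder v"
          unfolding remainder_def by blast
      qed (use \<eta> in auto)
      moreover have "(x + 2 * \<eta>)\<^sup>2 = x\<^sup>2 + 16 * ln x + 4 * \<eta>\<^sup>2" using \<eta>(3) by (simp add: power2_eq_square algebra_simps)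
      moreover have "\<eta>\<^sup>2 \<le> (1/4)\<^sup>2" using \<eta> by (intro power_mono) auto
      ultimately have "(1 - 2 * \<eta>) * P \<le> x\<^sup>2 + B * x + 16 * ln x + 3" by (simp add: power2_eq_square)
      also have "\<dots> \<le> x\<^sup>2 + (B + 19) * x" using x lnx by (simp add: algebra_simps)
      finally have "(1 + 4 * \<eta>) * ((1 - 2 * \<eta>) * P) \<le> (1 + 4 * \<eta>) * (x\<^sup>2 + (B + 19) * x)"
        using \<eta> by (intro mult_left_mono) auto
      \<comment> \<open>In place of a division by 1 - 2\<eta>: the product (1 + 4\<eta>) (1 -
        2\<eta>) is at least 1 for 0 \<le> \<eta> \<le> 1/4.\<close>
      moreover have "P \<le> (1 + 4 * \<eta>) * ((1 - 2 * \<eta>) * P)"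
      proof -
        have "\<eta> * \<eta> \<le> (1 / 4) * \<eta>" using \<eta> by (intro mult_right_mono) auto
        hence "1 \<le> (1 + 4 * \<eta>) * (1 - 2 * \<eta>)" by (simp add: algebra_simps)
        from mult_right_mono[OF this P] show ?thesis by (simp add: mult_ac)
      qed
      moreover have "(1 + 4 * \<eta>) * (x\<^sup>2 + (B + 19) * x) = x\<^sup>2 + (B + 19) * x + 4 * (x * \<eta>) * x + 4 * (B + 19) * (x * \<eta>)"
        by (simp add: power2_eq_square algebra_simps)
      ultimately have "P \<le> x\<^sup>2 + (B + 19) * x + 16 * (x * ln x) + 16 * (B + 19) * ln x"
        unfolding \<eta>(3) by (simp add: algebra_simps)
      moreover have "(B + 19) * x \<le> (B + 19) * (x * ln x)" "(B + 19) * ln x \<le> (B + 19) * (x * ln x)"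
        using B xx lnx x by (intro mult_left_mono; simp)+
      ultimately have upper: "P \<le> x\<^sup>2 + C * (x * ln x)" by (simp add: C_def algebra_simps)
      \<comment> \<open>The mirror image: on [x - 2\<eta>, x] the mean is at most exp (2\<eta>) P
        \<le> (1 + 4\<eta>) P.\<close>
      have "x\<^sup>2 - 16 * ln x - 2 * x - (1 + 4 * \<eta>) * P \<le> B * x"
      proof (rule loc[of "x - \<eta>" "-1"])
        fix v assume "\<bar>x - \<eta> - v\<bar> \<le> \<eta>"
        hence v: "v \<le> x" "x - 2 * \<eta> \<le> v" by auto
        have v0: "v \<ge> 0" using v \<eta> x by linarith
        have "mangoldt_ln2_mean v \<le> exp (x - v) * P" unfolding P_def by (intro mangoldt_ln2_mean_shift v)
        also have "exp (x - v) \<le> 1 + 2 * \<bar>x - v\<bar>" using exp_bound_lemma[of "x - v"] v \<eta> by simp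
        hence "exp (x - v) * P \<le> (1 + 4 * \<eta>) * P" using v P by (intro mult_right_mono) auto
        finally have "mangoldt_ln2_mean v \<le> (1 + 4 * \<eta>) * P" .
        moreover have "(x - 2 * \<eta>)\<^sup>2 \<le> v\<^sup>2" using v x \<eta> by (intro power_mono) auto
        moreover have "(x - 2 * \<eta>)\<^sup>2 = x\<^sup>2 - 16 * ln x + 4 * \<eta>\<^sup>2" using \<eta>(3) by (simp add: power2_eq_square algebra_simps)
        moreover have "exp (- v) \<le> 1" "0 \<le> \<eta>\<^sup>2" using v0 by auto
        moreover have "X - 2 * x - q \<le> - 1 * (w - (s - 2 * v + 2 - 2 * e))" if "w \<le> q" "r \<le> s" "r = X + 4 * h" "e \<le> 1" "0 \<le> h" for q r s w e h X :: real
          using that v by simp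
        ultimately show "x\<^sup>2 - 16 * ln x - 2 * x - (1 + 4 * \<eta>) * P \<le> - 1 * remainder v"
          unfolding remainder_def by blast
      qed (use \<eta> in auto)
      \<comment> \<open>The upper bound just proved is needed to see that 4\<eta> P is itself an
        error term.\<close>
      moreover have "\<eta> * P \<le> 4 * (x * ln x) + 4 * C * (ln x * ln x)"
      proof -
        have "\<eta> * P \<le> \<eta> * (x\<^sup>2 + C * (x * ln x))" using upper \<eta> by (intro mult_left_mono) auto
        also have "\<dots> = (x * \<eta>) * x + C * ((x * \<eta>) * ln x)" by (simp add: power2_eq_square algebra_simps)
        finally show ?thesis unfolding \<eta>(3) by (simp add: mult_ac)
      qed
      moreover have "C * (ln x * ln x) \<le> C * (x * ln x)" using C lnx by (intro mult_left_mono mult_right_mono) auto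
      moreover have "B * x \<le> B * (x * ln x)" using B xx by (intro mult_left_mono) auto
      moreover have "ln x \<le> x * ln x" using x lnx by simp
      ultimately have lower: "x\<^sup>2 - (16 * C + B + 34) * (x * ln x) \<le> P" using xx by (simp add: algebra_simps)
      have "0 \<le> C * (x * ln x)" "0 \<le> (16 * C + B + 34) * (x * ln x)" using C B xx by auto
      with upper lower show ?case unfolding P_def[symmetric] abs_le_iff by (simp add: algebra_simps)
    qed
  qed (use B C in auto)
qed

lemma mangoldt_ln2_sum_asymp:
  "\<exists>C>0. \<forall>\<^sub>F x in at_top. \<bar>mangoldt_ln2_sum x - x * (ln x)\<^sup>2\<bar> \<le> C * (x * ln x * ln (ln x))"
proof -
  obtain C where C: "C > 0" "\<forall>\<^sub>F x in at_top. \<bar>mangoldt_ln2_mean x - x\<^sup>2\<bar> \<le> C * (x * ln x)"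
    using mangoldt_ln2_mean_asymp by blast
  have "\<forall>\<^sub>F x in at_top. \<bar>mangoldt_ln2_mean (ln x) - (ln x)\<^sup>2\<bar> \<le> C * (ln x * ln (ln x))"
    using filterlim_iff[THEN iffD1, OF ln_at_top] C(2) by blast
  hence "\<forall>\<^sub>F x in at_top. \<bar>mangoldt_ln2_sum x - x * (ln x)\<^sup>2\<bar> \<le> C * (x * ln x * ln (ln x))"
    using eventually_gt_at_top[of 0]
  proof eventually_elim
    case (elim x)
    have "mangoldt_ln2_sum x - x * (ln x)\<^sup>2 = x * (mangoldt_ln2_mean (ln x) - (ln x)\<^sup>2)"
      using elim by (simp add: exp_minus field_simps)
    hence "\<bar>mangoldt_ln2_sum x - x * (ln x)\<^sup>2\<bar> = x * \<bar>mangoldt_ln2_mean (ln x) - (ln x)\<^sup>2\<bar>"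
      using elim by (simp add: abs_mult)
    also have "\<dots> \<le> x * (C * (ln x * ln (ln x)))" using elim by (intro mult_left_mono) auto
    finally show ?case by (simp add: mult_ac)
  qed
  with C(1) show ?thesis by blast
qed

section \<open>From the weighted von Mangoldt sum to the number of odd primes\<close>

definition odd_prime_count :: "nat \<Rightarrow> nat" where
  "odd_prime_count n = card {p \<in> odd_primes. p \<le> n}"

lemma real_nat_le_eq: "{k. real k \<le> real n} = {..n}"
  by auto

lemma mangoldt_odd_prime: "p \<in> odd_primes \<Longrightarrow> mangoldt p = ln (real p)"
  by (auto simp: odd_primes_def)

text \<open>Every term is at most ln^3 n, and the nonzero terms come from odd primes or from a small
  exceptional set of prime powers, so a large weighted sum forces many odd primes.\<close>

lemma odd_prime_count_lower:
  assumes n: "n \<ge> 4"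
  shows "mangoldt_ln2_sum (real n) \<le> (real (odd_prime_count n) + (sqrt (real n) + 1) * (log 2 (real n) + 1)) * ln (real n) ^ 3"
proof -
  define a :: "nat \<Rightarrow> real" where "a k = mangoldt k * (ln (real k))\<^sup>2" for k
  define A where "A = {p \<in> odd_primes. p \<le> n}"
  \<comment> \<open>Powers of 2, including 2 itself, and higher powers of odd primes. Each is p^j
    with p \<le> sqrt n and j \<le> log 2 n, so their number is at most the size of the rectangle
    \<open>?I\<close>.\<close>
  define Q where "Q = {k. k \<le> n \<and> a k \<noteq> 0 \<and> k \<notin> odd_primes}"
  let ?I = "{..nat \<lfloor>sqrt (real n)\<rfloor>} \<times> {..nat \<lfloor>log 2 (real n)\<rfloor>}"
  have fin: "finite A" "finite Q" by (auto simp: A_def Q_def)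
  have ale: "a k \<le> ln (real n) ^ 3" if "k \<le> n" for k
  proof (cases "k = 0")
    case True thus ?thesis using n by (simp add: a_def)
  next
    case False
    hence l: "0 \<le> ln (real k)" "ln (real k) \<le> ln (real n)" using that by auto
    hence "mangoldt k * (ln (real k))\<^sup>2 \<le> ln (real n) * (ln (real n))\<^sup>2"
      using mangoldt_le_ln[of k] by (intro mult_mono power_mono) auto
    thus ?thesis by (simp add: a_def power3_eq_cube power2_eq_square)
  qed
  have "Q \<subseteq> (\<lambda>(p, j). p ^ j) ` ?I"
  proof
    fix k assume k: "k \<in> Q"
    hence "primepow k" by (auto simp: Q_def a_def mangoldt_def split: if_splits)
    then obtain p j where pj: "prime p" "j > 0" "k = p ^ j" by (auto simp: primepow_def)
    have p2: "p \<ge> 2" using pj(1) by (rule prime_ge_2_nat)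
    have kn: "p ^ j \<le> n" using k pj by (auto simp: Q_def)
    \<comment> \<open>For j = 1 only p = 2 is possible, and then the claim is the hypothesis 4 \<le>
      n.\<close>
    have "p\<^sup>2 \<le> n"
    proof (cases "j = 1")
      case True
      hence "even p" using k pj by (auto simp: Q_def odd_primes_def)
      hence "p = 2" using prime_odd_nat[OF pj(1)] p2 by fastforce
      thus ?thesis using n by simp
    next
      case False
      hence "p ^ 2 \<le> p ^ j" using pj p2 by (intro power_increasing) auto
      thus ?thesis using kn by simp
    qed
    hence "real p ^ 2 \<le> real n" by (metis of_nat_mono of_nat_power)
    hence "real p \<le> sqrt (real n)" by (simp add: real_le_rsqrt)
    hence 1: "p \<le> nat \<lfloor>sqrt (real n)\<rfloor>" by (rule le_nat_floor)
    have "2 ^ j \<le> p ^ j" using p2 by (rule power_mono) auto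
    hence "2 ^ j \<le> real n" using kn by (metis le_trans of_nat_le_iff of_nat_numeral of_nat_power)
    hence "log 2 (2 ^ j) \<le> log 2 (real n)" using n by (subst log_le_cancel_iff) auto
    hence "real j \<le> log 2 (real n)" by (simp add: log_nat_power)
    hence 2: "j \<le> nat \<lfloor>log 2 (real n)\<rfloor>" by (rule le_nat_floor)
    show "k \<in> (\<lambda>(p, j). p ^ j) ` ?I" using 1 2 pj(3) by (intro image_eqI[of _ _ "(p, j)"]) auto
  qed
  hence "card Q \<le> card ?I" by (rule surj_card_le[rotated]) auto
  also have "\<dots> = Suc (nat \<lfloor>sqrt (real n)\<rfloor>) * Suc (nat \<lfloor>log 2 (real n)\<rfloor>)" by simp
  finally have "real (card Q) \<le> real (Suc (nat \<lfloor>sqrt (real n)\<rfloor>) * Suc (nat \<lfloor>log 2 (real n)\<rfloor>))" by (rule of_nat_mono)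
  also have "\<dots> = (real (nat \<lfloor>sqrt (real n)\<rfloor>) + 1) * (real (nat \<lfloor>log 2 (real n)\<rfloor>) + 1)" by (simp add: algebra_simps)
  also have "\<dots> \<le> (sqrt (real n) + 1) * (log 2 (real n) + 1)"
    using n by (intro mult_mono add_right_mono of_nat_floor) auto
  finally have cardQ: "real (card Q) \<le> (sqrt (real n) + 1) * (log 2 (real n) + 1)" .
  have "mangoldt_ln2_sum (real n) = (\<Sum>k\<le>n. a k)" unfolding mangoldt_ln2_sum_def a_def real_nat_le_eq ..
  also have "\<dots> = (\<Sum>k\<in>A \<union> Q. a k)"
    by (intro sum.mono_neutral_right) (auto simp: A_def Q_def)
  also have "\<dots> = sum a A + sum a Q" using fin by (intro sum.union_disjoint) (auto simp: A_def Q_def)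
  also have "\<dots> \<le> (\<Sum>k\<in>A. ln (real n) ^ 3) + (\<Sum>k\<in>Q. ln (real n) ^ 3)"
    by (intro add_mono sum_mono ale) (auto simp: A_def Q_def)
  also have "\<dots> = (real (odd_prime_count n) + real (card Q)) * ln (real n) ^ 3"
    by (simp add: A_def odd_prime_count_def algebra_simps)
  also have "\<dots> \<le> (real (odd_prime_count n) + (sqrt (real n) + 1) * (log 2 (real n) + 1)) * ln (real n) ^ 3"
    using cardQ n by (intro mult_right_mono) auto
  finally show ?thesis .
qed

text \<open>Primes up to the cut \<open>y\<close> are counted trivially, and each one above it
  weighs at least ln^3 y. Later y = n / ln^2 n, which is small enough to be an error term while ln y
  = ln n - 2 ln ln n.\<close>

lemma odd_prime_count_upper:
  assumes y: "1 < y" "y \<le> real n"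
  shows "real (odd_prime_count n) \<le> y + mangoldt_ln2_sum (real n) / ln y ^ 3"
proof -
  define A where "A = {p \<in> odd_primes. p \<le> n}"
  define A1 where "A1 = {p \<in> A. real p \<le> y}"
  define A2 where "A2 = {p \<in> A. y < real p}"
  have "A = A1 \<union> A2" "A1 \<inter> A2 = {}" by (auto simp: A1_def A2_def)
  moreover have fin: "finite A1" "finite A2" by (auto simp: A1_def A2_def A_def)
  ultimately have cardA: "card A = card A1 + card A2" by (simp add: card_Un_disjoint)
  have "A1 \<subseteq> {1..nat \<lfloor>y\<rfloor>}"
    by (auto simp: A1_def A_def odd_primes_def le_nat_floor prime_gt_0_nat Suc_le_eq)
  hence "card A1 \<le> card {1..nat \<lfloor>y\<rfloor>}" by (intro card_mono) auto
  hence "card A1 \<le> nat \<lfloor>y\<rfloor>" by simp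
  hence "real (card A1) \<le> real (nat \<lfloor>y\<rfloor>)" by (rule of_nat_mono)
  also have "\<dots> \<le> y" using y by (intro of_nat_floor) auto
  finally have c1: "real (card A1) \<le> y" .
  have ly: "ln y > 0" using y by simp
  have "real (card A2) * ln y ^ 3 = (\<Sum>p\<in>A2. ln y ^ 3)" by simp
  also have "\<dots> \<le> (\<Sum>p\<in>A2. mangoldt p * (ln (real p))\<^sup>2)"
  proof (rule sum_mono)
    fix p assume p: "p \<in> A2"
    hence "ln y ^ 3 \<le> ln (real p) ^ 3" using y ly by (intro power_mono) (auto simp: A2_def)
    also have "ln (real p) ^ 3 = mangoldt p * (ln (real p))\<^sup>2"
      using p by (simp add: A2_def A_def mangoldt_odd_prime power3_eq_cube power2_eq_square)
    finally show "ln y ^ 3 \<le> mangoldt p * (ln (real p))\<^sup>2" .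
  qed
  also have "\<dots> \<le> mangoldt_ln2_sum (real n)" unfolding mangoldt_ln2_sum_def
    by (intro sum_mono2 finite_real_nat_le) (auto simp: A2_def A_def intro: mult_nonneg_nonneg mangoldt_nonneg)
  finally have "real (card A2) \<le> mangoldt_ln2_sum (real n) / ln y ^ 3" using ly by (simp add: field_simps)
  with c1 show ?thesis by (simp add: odd_prime_count_def A_def[symmetric] cardA)
qed

theorem odd_prime_count_asymp:
  "\<exists>C>0. \<forall>\<^sub>F n in at_top. \<bar>real (odd_prime_count n) - real n / ln (real n)\<bar> \<le> C * (real n * ln (ln (real n)) / (ln (real n))\<^sup>2)"
proof -
  obtain C where C: "C > 0" and ev: "\<forall>\<^sub>F x in at_top. \<bar>mangoldt_ln2_sum x - x * (ln x)\<^sup>2\<bar> \<le> C * (x * ln x * ln (ln x))"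
    using mangoldt_ln2_sum_asymp by blast
  \<comment> \<open>\<open>U\<close> is the upper bound minus x / ln x and \<open>V\<close> is x /
    ln x minus the lower bound, as functions of a real variable; both are
    O(\<open>E\<close>).\<close>
  define U where "U x = x / (ln x)\<^sup>2 + (x * (ln x)\<^sup>2 + C * (x * ln x * ln (ln x))) / ln (x / (ln x)\<^sup>2) ^ 3 - x / ln x" for x
  define V where "V x = x / ln x - ((x * (ln x)\<^sup>2 - C * (x * ln x * ln (ln x))) / ln x ^ 3 - (sqrt x + 1) * (log 2 x + 1))" for x
  define E where "E x = x * ln (ln x) / (ln x)\<^sup>2" for x :: real
  have "U \<in> O(E)" unfolding U_def E_def using C by real_asymp
  then obtain c1 where c1: "c1 > 0" "\<forall>\<^sub>F x in at_top. norm (U x) \<le> c1 * norm (E x)" by (elim landau_o.bigE)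
  have "V \<in> O(E)" unfolding V_def E_def log_def using C by real_asymp
  then obtain c2 where c2: "c2 > 0" "\<forall>\<^sub>F x in at_top. norm (V x) \<le> c2 * norm (E x)" by (elim landau_o.bigE)
  have ev2: "\<forall>\<^sub>F x::real in at_top. 1 < x / (ln x)\<^sup>2 \<and> x / (ln x)\<^sup>2 \<le> x \<and> 0 < ln x \<and> 0 < ln (ln x)"
    by (intro eventually_conj; real_asymp)
  have "\<forall>\<^sub>F n in sequentially. \<bar>mangoldt_ln2_sum (real n) - real n * (ln (real n))\<^sup>2\<bar> \<le> C * (real n * ln (real n) * ln (ln (real n)))
     \<and> norm (U (real n)) \<le> c1 * norm (E (real n)) \<and> norm (V (real n)) \<le> c2 * norm (E (real n)) \<and>
     (1 < real n / (ln (real n))\<^sup>2 \<and> real n / (ln (real n))\<^sup>2 \<le> real n \<and> 0 < ln (real n) \<and> 0 < ln (ln (real n)))"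
    by (intro eventually_conj; rule eventually_compose_filterlim[OF _ filterlim_real_sequentially]) 
       (use ev c1 c2 ev2 in \<open>auto simp: eventually_conj_iff\<close>)
  hence "\<forall>\<^sub>F n in sequentially. \<bar>real (odd_prime_count n) - real n / ln (real n)\<bar> \<le> (c1 + c2) * (real n * ln (ln (real n)) / (ln (real n))\<^sup>2)"
    using eventually_ge_at_top[of 4]
  proof eventually_elim
    case (elim n)
    define y where "y = real n / (ln (real n))\<^sup>2"
    have ly: "ln y > 0" using elim by (simp add: y_def)
    have E0: "E (real n) \<ge> 0" using elim by (simp add: E_def)
    have "real (odd_prime_count n) \<le> y + mangoldt_ln2_sum (real n) / ln y ^ 3"
      using elim by (intro odd_prime_count_upper) (auto simp: y_def)
    also have "\<dots> \<le> y + (real n * (ln (real n))\<^sup>2 + C * (real n * ln (real n) * ln (ln (real n)))) / ln y ^ 3"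
      using elim ly by (intro add_left_mono divide_right_mono) auto
    also have "\<dots> = U (real n) + real n / ln (real n)" by (simp add: U_def y_def)
    finally have 1: "real (odd_prime_count n) - real n / ln (real n) \<le> c1 * E (real n)"
      using elim E0 by auto
    have "real n * (ln (real n))\<^sup>2 - C * (real n * ln (real n) * ln (ln (real n))) \<le>
        (real (odd_prime_count n) + (sqrt (real n) + 1) * (log 2 (real n) + 1)) * ln (real n) ^ 3"
      using elim odd_prime_count_lower[of n] by linarith
    hence "(real n * (ln (real n))\<^sup>2 - C * (real n * ln (real n) * ln (ln (real n)))) / ln (real n) ^ 3 \<le>
        real (odd_prime_count n) + (sqrt (real n) + 1) * (log 2 (real n) + 1)"
      using elim by (subst pos_divide_le_eq) auto
    hence "real n / ln (real n) - real (odd_prime_count n) \<le> V (real n)" by (simp add: V_def)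
    hence 2: "real n / ln (real n) - real (odd_prime_count n) \<le> c2 * E (real n)" using elim E0 by auto
    have "c1 * E (real n) \<ge> 0" "c2 * E (real n) \<ge> 0" using c1 c2 E0 by auto
    with 1 2 show ?case unfolding E_def[symmetric] by (simp add: abs_le_iff algebra_simps)
  qed
  thus ?thesis using c1(1) c2(1) by (intro exI[of _ "c1 + c2"]) auto
qed

section \<open>Counting Goldbach representations\<close>

definition goldbach_S :: "nat \<Rightarrow> nat" where
  "goldbach_S n = (\<Sum>d=1..n. goldbach_R d)"

lemma goldbach_A_eq: "goldbach_A M = (\<Sum>k=1..2 * M. goldbach_S (2 * M div k))"
proof -
  let ?N = "2 * M"
  have "goldbach_A M = (\<Sum>(m, d)\<in>(SIGMA m:{1..?N}. {d. d dvd m}). goldbach_R d)"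
    unfolding goldbach_A_def goldbach_a_def by (rule sum.Sigma) auto
  also have "\<dots> = (\<Sum>(k, d)\<in>(SIGMA k:{1..?N}. {1..?N div k}). goldbach_R d)"
  \<comment> \<open>The new index k is the complementary divisor m div d, and m \<le> N becomes d
    \<le> N div k.\<close>
  proof (rule sum.reindex_bij_witness[where i = "\<lambda>(k, d). (k * d, d)" and j = "\<lambda>(m, d). (m div d, d)"], goal_cases)
    case (2 z)
    then obtain m d where z: "z = (m, d)" "1 \<le> m" "m \<le> ?N" "d dvd m" by auto
    then obtain k where k: "m = d * k" by auto
    hence "d > 0" "k > 0" using z by auto
    moreover have "k \<le> ?N" using z k \<open>d > 0\<close> by (metis dvd_imp_le dvd_triv_right le_trans less_le_trans less_numeral_extra(1))
    moreover have "d \<le> ?N div k" using z k \<open>k > 0\<close> by (simp add: less_eq_div_iff_mult_less_eq)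
    ultimately show ?case using z k by simp
  next
    case (4 z)
    then obtain k d where z: "z = (k, d)" "1 \<le> k" "1 \<le> d" "d \<le> ?N div k" by auto
    hence "k * d \<le> ?N" by (simp add: less_eq_div_iff_mult_less_eq mult.commute)
    thus ?case using z by simp
  qed auto
  also have "\<dots> = (\<Sum>k=1..?N. goldbach_S (?N div k))"
    unfolding goldbach_S_def by (rule sum.Sigma[symmetric]) auto
  finally show ?thesis .
qed

lemma odd_prime_count_eq: "odd_prime_count n = (\<Sum>q=1..n. indicator odd_primes q)"
proof -
  have "{p \<in> odd_primes. p \<le> n} = {1..n} \<inter> odd_primes"
    by (auto simp: odd_primes_def dest: prime_gt_0_nat)
  thus ?thesis by (simp add: odd_prime_count_def sum_indicator_eq_card)
qed

text \<open>With q = d - k the sum d of a pair disappears: what remains is a sum over primes k of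
  values of the prime count, where its asymptotics can be inserted.\<close>

lemma goldbach_S_eq: "goldbach_S n = (\<Sum>k=1..n. indicator odd_primes k * odd_prime_count (n - k))"
proof -
  have "goldbach_S n = (\<Sum>(d, k)\<in>(SIGMA d:{1..n}. {1..<d}). indicator odd_primes k * indicator odd_primes (d - k))"
    unfolding goldbach_S_def goldbach_R_def by (rule sum.Sigma) auto
  also have "\<dots> = (\<Sum>(k, q)\<in>(SIGMA k:{1..n}. {1..n - k}). indicator odd_primes k * indicator odd_primes q)"
    by (rule sum.reindex_bij_witness[where i = "\<lambda>(k, q). (k + q, k)" and j = "\<lambda>(d, k). (k, d - k)"]) auto
  also have "\<dots> = (\<Sum>k=1..n. \<Sum>q=1..n-k. indicator odd_primes k * indicator odd_primes q)"
    by (rule sum.Sigma[symmetric]) auto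
  finally show ?thesis by (simp add: odd_prime_count_eq sum_distrib_left)
qed

lemma odd_prime_count_le: "odd_prime_count n \<le> n"
proof -
  have "odd_prime_count n \<le> (\<Sum>q=1..n. 1)"
    unfolding odd_prime_count_eq by (intro sum_mono) (auto simp: indicator_def)
  thus ?thesis by simp
qed

text \<open>Partial summation: n - k counts the w with k \<le> w < n. A sum over primes with linear
  weight becomes a sum of prime counts, to which the asymptotics apply again.\<close>

lemma sum_odd_prime_count: "(\<Sum>k=1..n. indicator odd_primes k * (n - k)) = (\<Sum>w<n. odd_prime_count w)"
proof -
  have "(\<Sum>k=1..n. indicator odd_primes k * (n - k)) = (\<Sum>k=1..n. \<Sum>w\<in>{k..<n}. indicator odd_primes k)"
    by (simp add: mult.commute)
  also have "\<dots> = (\<Sum>(k, w)\<in>(SIGMA k:{1..n}. {k..<n}). indicator odd_primes k)" by (rule sum.Sigma) auto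
  also have "\<dots> = (\<Sum>(w, k)\<in>(SIGMA w:{..<n}. {1..w}). indicator odd_primes k)"
    by (rule sum.reindex_bij_witness[where i = "\<lambda>(a, b). (b, a)" and j = "\<lambda>(a, b). (b, a)"]) auto
  also have "\<dots> = (\<Sum>w<n. odd_prime_count w)"
    unfolding odd_prime_count_eq by (rule sum.Sigma[symmetric]) auto
  finally show ?thesis .
qed

text \<open>Trivial bound, for the quotients N div k with large k.\<close>

lemma goldbach_S_le: "goldbach_S n \<le> n\<^sup>2"
proof -
  have "goldbach_S n \<le> (\<Sum>k=1..n. n)" unfolding goldbach_S_eq
  proof (rule sum_mono)
    fix k show "indicator odd_primes k * odd_prime_count (n - k) \<le> n"
      using odd_prime_count_le[of "n - k"] by (auto simp: indicator_def)
  qed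
  thus ?thesis by (simp add: power2_eq_square)
qed

text \<open>The logarithm of w is replaced by that of n, with an error measured against n. For w < n
  / ln^2 n both terms are trivially small; for the other w the logarithms differ by at most 2 ln ln
  n.\<close>

lemma odd_prime_count_uniform:
  "\<exists>C>0. \<forall>\<^sub>F n in at_top. \<forall>w\<le>n. \<bar>real (odd_prime_count w) * ln (real n) - real w\<bar> \<le> C * (real n * ln (ln (real n)) / ln (real n))"
proof -
  obtain C n0 where C: "C > 0" and n0: "\<And>n. n \<ge> n0 \<Longrightarrow> \<bar>real (odd_prime_count n) - real n / ln (real n)\<bar> \<le> C * (real n * ln (ln (real n)) / (ln (real n))\<^sup>2)"
    using odd_prime_count_asymp unfolding eventually_at_top_linorder by metis
  have "\<forall>\<^sub>F x::real in at_top. real n0 \<le> x / (ln x)\<^sup>2 \<and> 3 \<le> x / (ln x)\<^sup>2 \<and> 1 \<le> ln (ln x) \<and> 4 * ln (ln x) \<le> ln x \<and> 1 < ln x \<and> 3 < x"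
    by (intro eventually_conj; real_asymp)
  hence "\<forall>\<^sub>F n in sequentially. real n0 \<le> real n / (ln (real n))\<^sup>2 \<and> 3 \<le> real n / (ln (real n))\<^sup>2 \<and> 1 \<le> ln (ln (real n)) \<and> 4 * ln (ln (real n)) \<le> ln (real n) \<and> 1 < ln (real n) \<and> 3 < real n"
    by (rule eventually_compose_filterlim[OF _ filterlim_real_sequentially])
  hence "\<forall>\<^sub>F n in sequentially. \<forall>w\<le>n. \<bar>real (odd_prime_count w) * ln (real n) - real w\<bar> \<le> (4 * C + 4) * (real n * ln (ln (real n)) / ln (real n))"
  proof eventually_elim
    case (elim n)
    define l where "l = ln (real n)"
    have l: "1 \<le> ln l" "4 * ln l \<le> l" "1 < l" "real n0 \<le> real n / l\<^sup>2" "3 \<le> real n / l\<^sup>2" "3 < real n"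
      using elim by (auto simp: l_def)
    define e where "e = real n * ln l / l"
    have e0: "e \<ge> 0" using l by (simp add: e_def)
    show ?case
    proof (intro allI impI)
      fix w assume w: "w \<le> n"
      have "\<bar>real (odd_prime_count w) * l - real w\<bar> \<le> (4 * C + 4) * e"
      proof (cases "real w < real n / l\<^sup>2")
        case True
        have "real w * l \<le> real n / l\<^sup>2 * l" using True l by (intro mult_right_mono) auto
        also have "\<dots> = real n * 1 / l" using l by (simp add: power2_eq_square)
        also have "\<dots> \<le> e" unfolding e_def using l by (intro divide_right_mono mult_left_mono) auto
        finally have wl: "real w * l \<le> e" .
        have "real (odd_prime_count w) * l \<le> real w * l" using odd_prime_count_le[of w] l by (intro mult_right_mono) auto
        moreover have "real w * 1 \<le> real w * l" using l by (intro mult_left_mono) auto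
        moreover have "0 \<le> real (odd_prime_count w) * l" using l by simp
        ultimately have "\<bar>real (odd_prime_count w) * l - real w\<bar> \<le> 1 * e" using wl by (simp only: abs_le_iff) linarith
        also have "\<dots> \<le> (4 * C + 4) * e" using e0 C by (intro mult_right_mono) auto
        finally show ?thesis .
      next
        case False
        hence wl: "real n / l\<^sup>2 \<le> real w" by simp
        have w3: "real w \<ge> 3" "w \<ge> n0" using wl l by auto
        define m where "m = ln (real w)"
        have "ln (real n / l\<^sup>2) \<le> m" unfolding m_def using wl l w3 by (subst ln_le_cancel_iff) auto
        also have "ln (real n / l\<^sup>2) = l - 2 * ln l" using l by (simp add: ln_div ln_realpow l_def)
        finally have m1: "l - 2 * ln l \<le> m" .
        have m2: "m \<le> l" unfolding m_def l_def using w w3 by simp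
        have m3: "l / 2 \<le> m" using m1 l by linarith
        have m0: "m > 1" using m1 l by linarith
        have lnm: "0 \<le> ln m" "ln m \<le> ln l" using m0 m2 by auto
        have "\<bar>real (odd_prime_count w) * l - real w\<bar> \<le> \<bar>(real (odd_prime_count w) - real w / m) * l\<bar> + \<bar>real w * ((l - m) / m)\<bar>"
        proof -
          have "real (odd_prime_count w) * l - real w = (real (odd_prime_count w) - real w / m) * l + real w * ((l - m) / m)"
            using m0 by (simp add: field_simps)
          thus ?thesis by (simp only: abs_triangle_ineq)
        qed
        also have "\<bar>(real (odd_prime_count w) - real w / m) * l\<bar> \<le> (C * (real w * ln m / m\<^sup>2)) * l"
          using n0[OF w3(2)] l unfolding m_def[symmetric] abs_mult by (intro mult_mono) auto
        also have "\<dots> \<le> (C * (real n * ln l / (l / 2)\<^sup>2)) * l"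
          using C w lnm m3 l m0 by (intro mult_right_mono mult_left_mono frac_le mult_mono power_mono) auto
        also have "\<dots> = 4 * C * e" using l by (simp add: e_def power2_eq_square field_simps)
        also have "\<bar>real w * ((l - m) / m)\<bar> = real w * ((l - m) / m)" using m2 m0 by simp
        also have "\<dots> \<le> real n * ((2 * ln l) / (l / 2))"
          using w m1 m2 m3 l by (intro mult_mono frac_le) auto
        also have "\<dots> = 4 * e" using l by (simp add: e_def)
        finally show ?thesis by (simp add: algebra_simps)
      qed
      thus "\<bar>real (odd_prime_count w) * ln (real n) - real w\<bar> \<le> (4 * C + 4) * (real n * ln (ln (real n)) / ln (real n))"
        by (simp add: l_def e_def)
    qed
  qed
  thus ?thesis using C by (intro exI[of _ "4 * C + 4"]) auto
qed

text \<open>The approximation w / ln n of the prime count is inserted twice: in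
  \<open>goldbach_S_eq\<close>, leaving \<open>T\<close>, and after partial summation in
  \<open>T\<close> itself, leaving the sum of all w < n, which is n^2/2 - n/2.\<close>

lemma goldbach_S_asymp:
  "\<exists>C>0. \<forall>\<^sub>F n in at_top. \<bar>real (goldbach_S n) * (ln (real n))\<^sup>2 - (real n)\<^sup>2 / 2\<bar> \<le> C * ((real n)\<^sup>2 * ln (ln (real n)) / ln (real n))"
proof -
  obtain C where C: "C > 0" and ev: "\<forall>\<^sub>F n in at_top. \<forall>w\<le>n. \<bar>real (odd_prime_count w) * ln (real n) - real w\<bar> \<le> C * (real n * ln (ln (real n)) / ln (real n))"
    using odd_prime_count_uniform by blast
  have "\<forall>\<^sub>F x::real in at_top. 1 \<le> x * ln (ln x) / ln x \<and> ln (ln x) \<le> ln x \<and> 1 < ln x"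
    by (intro eventually_conj; real_asymp)
  hence ev2: "\<forall>\<^sub>F n in sequentially. 1 \<le> real n * ln (ln (real n)) / ln (real n) \<and> ln (ln (real n)) \<le> ln (real n) \<and> 1 < ln (real n)"
    by (rule eventually_compose_filterlim[OF _ filterlim_real_sequentially])
  have "\<forall>\<^sub>F n in sequentially. \<bar>real (goldbach_S n) * (ln (real n))\<^sup>2 - (real n)\<^sup>2 / 2\<bar> \<le> (1 + C + C * (1 + C)) * ((real n)\<^sup>2 * ln (ln (real n)) / ln (real n))"
    using ev ev2
  proof eventually_elim
    case (elim n)
    define l where "l = ln (real n)"
    define e where "e = real n * ln l / l"
    have l: "l > 1" "ln l \<le> l" and e1: "1 \<le> e" using elim by (auto simp: l_def e_def)
    have en: "e \<le> real n" using l by (simp add: e_def divide_le_eq mult_left_mono)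
    have U: "\<bar>real (odd_prime_count w) * l - real w\<bar> \<le> C * e" if "w \<le> n" for w
      using elim(1) that unfolding l_def e_def by blast
    let ?i = "\<lambda>k. indicator odd_primes k :: real"
    define T where "T = (\<Sum>k=1..n. ?i k * real (n - k))"
    have "real (\<Sum>k=1..n. indicator odd_primes k * (n - k)) = T"
      unfolding T_def of_nat_sum by (intro sum.cong refl) (auto simp: indicator_def)
    hence T: "T = (\<Sum>w<n. real (odd_prime_count w))" unfolding sum_odd_prime_count by simp
    have S: "real (goldbach_S n) = (\<Sum>k=1..n. ?i k * real (odd_prime_count (n - k)))"
      unfolding goldbach_S_eq of_nat_sum by (intro sum.cong refl) (auto simp: indicator_def)
    have i: "(\<Sum>k=1..n. ?i k) = real (odd_prime_count n)"
      unfolding odd_prime_count_eq of_nat_sum by (intro sum.cong refl) (auto simp: indicator_def)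
    have "\<bar>real (goldbach_S n) * l - T\<bar> = \<bar>\<Sum>k=1..n. ?i k * (real (odd_prime_count (n - k)) * l - real (n - k))\<bar>"
      unfolding S T_def sum_distrib_right sum_subtractf[symmetric]
      by (intro arg_cong[where f = abs] sum.cong refl) (simp only: right_diff_distrib mult.assoc)
    also have "\<dots> \<le> (\<Sum>k=1..n. \<bar>?i k * (real (odd_prime_count (n - k)) * l - real (n - k))\<bar>)" by (rule sum_abs)
    also have "\<dots> \<le> (\<Sum>k=1..n. ?i k * (C * e))"
      unfolding abs_mult by (intro sum_mono mult_mono U) auto
    also have "\<dots> = real (odd_prime_count n) * (C * e)" unfolding i[symmetric] by (simp add: sum_distrib_right)
    finally have 1: "\<bar>real (goldbach_S n) * l - T\<bar> \<le> real (odd_prime_count n) * (C * e)" .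
    have "\<bar>T * l - (\<Sum>w<n. real w)\<bar> = \<bar>\<Sum>w<n. real (odd_prime_count w) * l - real w\<bar>"
      unfolding T by (simp add: sum_distrib_right sum_subtractf)
    also have "\<dots> \<le> (\<Sum>w<n. \<bar>real (odd_prime_count w) * l - real w\<bar>)" by (rule sum_abs)
    also have "\<dots> \<le> (\<Sum>w<n. C * e)" by (intro sum_mono U) auto
    finally have 2: "\<bar>T * l - (\<Sum>w<n. real w)\<bar> \<le> real n * (C * e)" by simp
    have 3: "(\<Sum>w<n. real w) = (real n)\<^sup>2 / 2 - real n / 2"
      by (induction n) (auto simp: power2_eq_square field_simps)
    \<comment> \<open>The first error is summed over primes only, and their sparsity offsets the
      extra factor \<open>l\<close>.\<close>
    have "real (odd_prime_count n) * l \<le> real n + C * e" using U[of n] by (simp add: abs_le_iff)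
    also have "\<dots> \<le> (1 + C) * real n" using en C by (simp add: algebra_simps)
    finally have "(real (odd_prime_count n) * l) * (C * e) \<le> ((1 + C) * real n) * (C * e)"
      using C e1 by (intro mult_right_mono) auto
    moreover have "\<bar>(real (goldbach_S n) * l - T) * l\<bar> \<le> real (odd_prime_count n) * (C * e) * l"
      unfolding abs_mult using mult_right_mono[OF 1, of l] l by simp
    ultimately have "\<bar>(real (goldbach_S n) * l - T) * l\<bar> \<le> (1 + C) * C * (real n * e)"
      by (simp only: mult_ac)
    moreover have "real n * 1 \<le> real n * e" using e1 by (intro mult_left_mono) auto
    moreover have "real (goldbach_S n) * l\<^sup>2 - (real n)\<^sup>2 / 2 = (real (goldbach_S n) * l - T) * l + (T * l - (\<Sum>w<n. real w)) - real n / 2"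
      unfolding 3 by (simp add: power2_eq_square algebra_simps)
    ultimately have "\<bar>real (goldbach_S n) * l\<^sup>2 - (real n)\<^sup>2 / 2\<bar> \<le> (1 + C + C * (1 + C)) * (real n * e)"
      using 2 by (simp add: algebra_simps)
    thus ?case by (simp add: l_def e_def power2_eq_square mult_ac)
  qed
  thus ?thesis using C by (intro exI[of _ "1 + C + C * (1 + C)"]) (auto intro!: add_pos_pos)
qed

text \<open>For k up to ln^3 N the logarithm of N div k is within 4 ln ln N of ln N. The 4 in place
  of 3 absorbs the rounding, by N / ln^4 N \<le> N / ln^3 N - 1.\<close>

lemma goldbach_S_div_asymp:
  "\<exists>C>0. \<forall>\<^sub>F N in at_top. \<forall>k. 1 \<le> k \<and> real k \<le> ln (real N) ^ 3 \<longrightarrow>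
     \<bar>real (goldbach_S (N div k)) * (ln (real N))\<^sup>2 - (real N / real k)\<^sup>2 / 2\<bar> \<le> C * ((real N / real k)\<^sup>2 * (ln (ln (real N)) / ln (real N)))"
proof -
  obtain C n0 where C: "C > 0" and n0: "\<And>n. n \<ge> n0 \<Longrightarrow> \<bar>real (goldbach_S n) * (ln (real n))\<^sup>2 - (real n)\<^sup>2 / 2\<bar> \<le> C * ((real n)\<^sup>2 * ln (ln (real n)) / ln (real n))"
    using goldbach_S_asymp unfolding eventually_at_top_linorder by metis
  have "\<forall>\<^sub>F x::real in at_top. real n0 \<le> x / ln x ^ 3 - 1 \<and> 3 \<le> x / ln x ^ 3 - 1 \<and> x / ln x ^ 4 \<le> x / ln x ^ 3 - 1 \<and> 
     1 \<le> ln (ln x) \<and> 8 * ln (ln x) \<le> ln x \<and> 1 < ln x \<and> 3 < x \<and> 2 * ln x ^ 3 / x \<le> ln (ln x) / ln x"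
    by (intro eventually_conj; real_asymp)
  hence "\<forall>\<^sub>F N in sequentially. real n0 \<le> real N / ln (real N) ^ 3 - 1 \<and> 3 \<le> real N / ln (real N) ^ 3 - 1 \<and> real N / ln (real N) ^ 4 \<le> real N / ln (real N) ^ 3 - 1 \<and> 
     1 \<le> ln (ln (real N)) \<and> 8 * ln (ln (real N)) \<le> ln (real N) \<and> 1 < ln (real N) \<and> 3 < real N \<and> 2 * ln (real N) ^ 3 / real N \<le> ln (ln (real N)) / ln (real N)"
    by (rule eventually_compose_filterlim[OF _ filterlim_real_sequentially])
  hence "\<forall>\<^sub>F N in sequentially. \<forall>k. 1 \<le> k \<and> real k \<le> ln (real N) ^ 3 \<longrightarrow>
     \<bar>real (goldbach_S (N div k)) * (ln (real N))\<^sup>2 - (real N / real k)\<^sup>2 / 2\<bar> \<le> (66 * C + 17) * ((real N / real k)\<^sup>2 * (ln (ln (real N)) / ln (real N)))"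
  proof eventually_elim
    case (elim N)
    define L where "L = ln (real N)"
    define \<epsilon> where "\<epsilon> = ln L / L"
    have L: "real n0 \<le> real N / L ^ 3 - 1" "3 \<le> real N / L ^ 3 - 1" "real N / L ^ 4 \<le> real N / L ^ 3 - 1"
      "1 \<le> ln L" "8 * ln L \<le> L" "1 < L" "3 < real N" "2 * L ^ 3 / real N \<le> \<epsilon>"
      using elim by (auto simp: L_def \<epsilon>_def)
    have \<epsilon>: "0 \<le> \<epsilon>" "\<epsilon> \<le> 1" using L by (auto simp: \<epsilon>_def)
    show ?case
    proof (intro allI impI)
      fix k assume "1 \<le> k \<and> real k \<le> ln (real N) ^ 3"
      hence k: "1 \<le> k" "real k \<le> L ^ 3" by (auto simp: L_def)
      define m where "m = N div k"
      define x where "x = real N / real k"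
      have x: "x > 0" using k L by (simp add: x_def)
      have m_le: "real m \<le> x" unfolding m_def x_def by (rule of_nat_div_le_of_nat)
      have "\<lfloor>x\<rfloor> = int m" unfolding x_def m_def by (rule floor_divide_of_nat_eq)
      hence m_ge: "x - 1 \<le> real m" by linarith
      have "real N / L ^ 3 \<le> x" unfolding x_def using k L by (intro divide_left_mono) auto
      hence m1: "real N / L ^ 3 - 1 \<le> real m" using m_ge by linarith
      have m3: "real m \<ge> 3" "m \<ge> n0" using m1 L by auto
      define l where "l = ln (real m)"
      have "ln (real N / L ^ 4) \<le> l" unfolding l_def using m1 L m3 by (subst ln_le_cancel_iff) auto
      also have "ln (real N / L ^ 4) = L - 4 * ln L" using L by (simp add: ln_div ln_realpow L_def)
      finally have l1: "L - 4 * ln L \<le> l" .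
      have "m \<le> N" unfolding m_def by simp
      hence l2: "l \<le> L" unfolding l_def L_def using m3 by simp
      have l3: "L / 2 \<le> l" using l1 L by linarith
      have l0: "l > 1" using l1 L by linarith
      have lnl: "0 \<le> ln l" "ln l \<le> ln L" using l0 l2 by auto
      have "\<bar>real (goldbach_S m) * l\<^sup>2 - (real m)\<^sup>2 / 2\<bar> \<le> C * ((real m)\<^sup>2 * ln l / l)"
        using n0[OF m3(2)] by (simp add: l_def)
      also have "\<dots> \<le> C * (x\<^sup>2 * ln L / (L / 2))"
        using C m_le lnl l3 L by (intro mult_left_mono frac_le mult_mono power_mono) auto
      also have "\<dots> = 2 * C * (x\<^sup>2 * \<epsilon>)" by (simp add: \<epsilon>_def)
      finally have 1: "\<bar>real (goldbach_S m) * l\<^sup>2 - (real m)\<^sup>2 / 2\<bar> \<le> 2 * C * (x\<^sup>2 * \<epsilon>)" .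
      have mx: "(real m)\<^sup>2 \<le> x\<^sup>2" using m_le by (intro power_mono) auto
      have xe: "x\<^sup>2 * \<epsilon> \<le> x\<^sup>2 * 1" using \<epsilon> by (intro mult_left_mono) auto
      hence "2 * C * (x\<^sup>2 * \<epsilon>) \<le> 2 * C * x\<^sup>2" using C by (simp add: mult_left_mono)
      hence Sl: "real (goldbach_S m) * l\<^sup>2 \<le> (1 / 2 + 2 * C) * x\<^sup>2" using 1 mx by (simp add: algebra_simps abs_le_iff)
      \<comment> \<open>Relative cost of replacing \<open>l\<^sup>2\<close> by
        \<open>L\<^sup>2\<close>, from L - l \<le> 4 ln L and L/2 \<le> l \<le> L.\<close>
      have "(L\<^sup>2 - l\<^sup>2) / l\<^sup>2 \<le> (8 * ln L * L) / (L / 2)\<^sup>2"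
      proof (intro frac_le)
        have "L\<^sup>2 - l\<^sup>2 = (L - l) * (L + l)" by (simp add: power2_eq_square algebra_simps)
        also have "\<dots> \<le> (4 * ln L) * (2 * L)" using l1 l2 l0 L by (intro mult_mono) auto
        finally show "L\<^sup>2 - l\<^sup>2 \<le> 8 * ln L * L" by simp
      qed (use L l3 in \<open>auto intro!: power_mono\<close>)
      also have "\<dots> = 32 * \<epsilon>" using L by (simp add: \<epsilon>_def power2_eq_square)
      finally have r: "(L\<^sup>2 - l\<^sup>2) / l\<^sup>2 \<le> 32 * \<epsilon>" .
      have "real (goldbach_S m) * L\<^sup>2 - real (goldbach_S m) * l\<^sup>2 = (real (goldbach_S m) * l\<^sup>2) * ((L\<^sup>2 - l\<^sup>2) / l\<^sup>2)"
        using l0 by (simp add: field_simps)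
      also have "\<dots> \<le> ((1 / 2 + 2 * C) * x\<^sup>2) * (32 * \<epsilon>)"
        by (rule mult_mono[OF Sl r]) (use C l2 l0 in \<open>auto intro!: divide_nonneg_nonneg power_mono\<close>)
      finally have 2: "real (goldbach_S m) * L\<^sup>2 - real (goldbach_S m) * l\<^sup>2 \<le> (16 + 64 * C) * (x\<^sup>2 * \<epsilon>)" by (simp add: algebra_simps)
      have 3: "real (goldbach_S m) * l\<^sup>2 \<le> real (goldbach_S m) * L\<^sup>2" using l2 l0 by (intro mult_left_mono power_mono) auto
      \<comment> \<open>Rounding N / k down changes the square by at most 2x, a relative change of
        2k/N, negligible for k \<le> L^3.\<close>
      have "x\<^sup>2 - (real m)\<^sup>2 = (x - real m) * (x + real m)" by (simp add: power2_eq_square algebra_simps)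
      also have "\<dots> \<le> 1 * (2 * x)" using m_ge m_le by (intro mult_mono) auto
      also have "\<dots> = x\<^sup>2 * (2 * real k / real N)" using k L by (simp add: x_def power2_eq_square field_simps)
      also have "\<dots> \<le> x\<^sup>2 * (2 * L ^ 3 / real N)" using k L by (intro mult_left_mono divide_right_mono) auto
      also have "\<dots> \<le> x\<^sup>2 * \<epsilon>" using L by (intro mult_left_mono) auto
      finally have 4: "x\<^sup>2 - (real m)\<^sup>2 \<le> x\<^sup>2 * \<epsilon>" .
      have "\<bar>real (goldbach_S m) * L\<^sup>2 - x\<^sup>2 / 2\<bar> \<le> (66 * C + 17) * (x\<^sup>2 * \<epsilon>)"
        using 1 2 3 4 mx unfolding abs_le_iff by (simp add: algebra_simps)
      thus "\<bar>real (goldbach_S (N div k)) * (ln (real N))\<^sup>2 - (real N / real k)\<^sup>2 / 2\<bar> \<le> (66 * C + 17) * ((real N / real k)\<^sup>2 * (ln (ln (real N)) / ln (real N)))"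
        by (simp add: m_def x_def L_def \<epsilon>_def)
    qed
  qed
  thus ?thesis using C by (intro exI[of _ "66 * C + 17"]) auto
qed

text \<open>The inequality 1 / (n + 1)^2 \<le> 1/n - 1/(n + 1) telescopes; keeping the term - 1/N in
  the claim makes the induction close.\<close>

lemma sum_inverse_squares_tail:
  assumes "1 \<le> K" "K \<le> N"
  shows "(\<Sum>k\<in>{K<..N}. 1 / (real k)\<^sup>2) \<le> 1 / real K - 1 / real N"
  using assms(2)
proof (induction N rule: dec_induct)
  case (step n)
  have n: "n \<ge> 1" using step assms by simp
  have "{K<..Suc n} = insert (Suc n) {K<..n}" using step by auto
  hence "(\<Sum>k\<in>{K<..Suc n}. 1 / (real k)\<^sup>2) = 1 / (real (Suc n))\<^sup>2 + (\<Sum>k\<in>{K<..n}. 1 / (real k)\<^sup>2)" by simp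
  also have "\<dots> \<le> 1 / (real n * real (Suc n)) + (1 / real K - 1 / real n)"
    using step n unfolding power2_eq_square by (intro add_mono divide_left_mono mult_right_mono) auto
  also have "1 / (real n * real (Suc n)) = 1 / real n - 1 / real (Suc n)" using n by (subst diff_frac_eq) auto
  also have "1 / real n - 1 / real (Suc n) + (1 / real K - 1 / real n) = 1 / real K - 1 / real (Suc n)" by simp
  finally show ?case .
qed auto

lemma sum_inverse_squares_bounds:
  assumes K: "1 \<le> K"
  shows "(\<Sum>k=1..K. 1 / (real k)\<^sup>2) \<le> pi\<^sup>2 / 6" "pi\<^sup>2 / 6 \<le> (\<Sum>k=1..K. 1 / (real k)\<^sup>2) + 1 / real K"
proof -
  have "(\<lambda>n. \<Sum>k<n. 1 / (real k + 1)\<^sup>2) \<longlonglongrightarrow> pi\<^sup>2 / 6" using inverse_squares_sums by (simp add: sums_def add.commute)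
  moreover have "(\<Sum>k<n. 1 / (real k + 1)\<^sup>2) = (\<Sum>k=1..n. 1 / (real k)\<^sup>2)" for n
    by (induction n) (auto simp: add.commute)
  ultimately have lim: "(\<lambda>n. \<Sum>k=1..n. 1 / (real k)\<^sup>2) \<longlonglongrightarrow> pi\<^sup>2 / 6" by simp
  have split: "(\<Sum>k=1..n. 1 / (real k)\<^sup>2) = (\<Sum>k=1..K. 1 / (real k)\<^sup>2) + (\<Sum>k\<in>{K<..n}. 1 / (real k)\<^sup>2)" if "n \<ge> K" for n
  proof -
    have "{1..n} = {1..K} \<union> {K<..n}" using that K by auto
    show ?thesis unfolding \<open>{1..n} = _\<close> by (rule sum.union_disjoint) auto
  qed
  show "(\<Sum>k=1..K. 1 / (real k)\<^sup>2) \<le> pi\<^sup>2 / 6"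
  proof (rule LIMSEQ_le_const[OF lim], rule exI[of _ K], intro allI impI)
    fix n assume n: "n \<ge> K"
    have "0 \<le> (\<Sum>k\<in>{K<..n}. 1 / (real k)\<^sup>2)" by (intro sum_nonneg) auto
    thus "(\<Sum>k=1..K. 1 / (real k)\<^sup>2) \<le> (\<Sum>k=1..n. 1 / (real k)\<^sup>2)"
      unfolding split[OF n] by linarith
  qed
  show "pi\<^sup>2 / 6 \<le> (\<Sum>k=1..K. 1 / (real k)\<^sup>2) + 1 / real K"
  proof (rule LIMSEQ_le_const2[OF lim], rule exI[of _ K], intro allI impI)
    fix n assume n: "n \<ge> K"
    have "0 \<le> 1 / real n" by simp
    thus "(\<Sum>k=1..n. 1 / (real k)\<^sup>2) \<le> (\<Sum>k=1..K. 1 / (real k)\<^sup>2) + 1 / real K"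
      using split[OF n] sum_inverse_squares_tail[OF K n] by linarith
  qed
qed

text \<open>The cutoff K near ln^3 N is dictated by the tail: with S(n) \<le> n^2 the k beyond K
  contribute at most N^2 / K, which then fits the error. The main term is N^2 / (2 ln^2 N) times
  pi^2 / 6.\<close>

lemma goldbach_hyperbola_asymp:
  "\<exists>C>0. \<forall>\<^sub>F N in at_top. \<bar>real (\<Sum>k=1..N. goldbach_S (N div k)) - pi\<^sup>2 * (real N)\<^sup>2 / (12 * (ln (real N))\<^sup>2)\<bar>
     \<le> C * ((real N)\<^sup>2 * ln (ln (real N)) / ln (real N) ^ 3)"
proof -
  obtain C where C: "C > 0" and ev: "\<forall>\<^sub>F N in at_top. \<forall>k. 1 \<le> k \<and> real k \<le> ln (real N) ^ 3 \<longrightarrow>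
     \<bar>real (goldbach_S (N div k)) * (ln (real N))\<^sup>2 - (real N / real k)\<^sup>2 / 2\<bar> \<le> C * ((real N / real k)\<^sup>2 * (ln (ln (real N)) / ln (real N)))"
    using goldbach_S_div_asymp by blast
  have "\<forall>\<^sub>F x::real in at_top. ln x ^ 3 \<le> x \<and> 2 \<le> ln x \<and> 1 \<le> ln (ln x)"
    by (intro eventually_conj; real_asymp)
  hence ev2: "\<forall>\<^sub>F N in sequentially. ln (real N) ^ 3 \<le> real N \<and> 2 \<le> ln (real N) \<and> 1 \<le> ln (ln (real N))"
    by (rule eventually_compose_filterlim[OF _ filterlim_real_sequentially])
  \<comment> \<open>\<open>C * (pi\<^sup>2 / 6)\<close> comes from the asymptotics for k \<le> K, 2
    from the tail, and 1 from completing the sum of inverse squares.\<close>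
  define D where "D = C * (pi\<^sup>2 / 6) + 3"
  have D: "D > 0" unfolding D_def using C by (intro add_nonneg_pos) auto
  have "\<forall>\<^sub>F N in sequentially. \<bar>real (\<Sum>k=1..N. goldbach_S (N div k)) - pi\<^sup>2 * (real N)\<^sup>2 / (12 * (ln (real N))\<^sup>2)\<bar>
     \<le> D * ((real N)\<^sup>2 * ln (ln (real N)) / ln (real N) ^ 3)"
    using ev ev2
  proof eventually_elim
    case (elim N)
    define L where "L = ln (real N)"
    define \<epsilon> where "\<epsilon> = ln L / L"
    have L: "L ^ 3 \<le> real N" "2 \<le> L" "1 \<le> ln L" using elim by (auto simp: L_def)
    have \<epsilon>: "0 \<le> \<epsilon>" "1 / L \<le> \<epsilon>" using L by (auto simp: \<epsilon>_def divide_right_mono)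
    have ap: "\<bar>real (goldbach_S (N div k)) * L\<^sup>2 - (real N / real k)\<^sup>2 / 2\<bar> \<le> C * ((real N / real k)\<^sup>2 * \<epsilon>)" if "1 \<le> k" "real k \<le> L ^ 3" for k
      using elim(1) that unfolding L_def \<epsilon>_def by blast
    define K where "K = nat \<lfloor>L ^ 3\<rfloor>"
    have L3: "1 \<le> L ^ 3" "2 \<le> L ^ 3" using L power_mono[of 2 L 3] by auto
    have KL: "real K \<le> L ^ 3" unfolding K_def by (rule of_nat_floor) (use L3 in linarith)
    have "L ^ 3 < real K + 1" unfolding K_def using L3 by linarith
    hence LK: "L ^ 3 / 2 \<le> real K" using L3 by linarith
    have K1: "1 \<le> K" using LK L3 by linarith
    have KN: "K \<le> N" using KL L by linarith
    have "1 / real K \<le> 1 / (L ^ 3 / 2)" by (rule frac_le) (use LK L3 in linarith)+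
    hence iK: "1 / real K \<le> 2 / L ^ 3" by simp
    define H where "H = (\<Sum>k=1..K. 1 / (real k)\<^sup>2)"
    have H: "0 \<le> H" "H \<le> pi\<^sup>2 / 6" "pi\<^sup>2 / 6 \<le> H + 1 / real K"
      using sum_inverse_squares_bounds[OF K1] by (auto simp: H_def intro: sum_nonneg)
    define a where "a k = real (goldbach_S (N div k))" for k
    have "\<bar>(\<Sum>k=1..K. a k) * L\<^sup>2 - (real N)\<^sup>2 / 2 * H\<bar> = \<bar>\<Sum>k=1..K. a k * L\<^sup>2 - (real N / real k)\<^sup>2 / 2\<bar>"
      unfolding H_def sum_distrib_left sum_distrib_right sum_subtractf[symmetric]
      by (intro arg_cong[where f = abs] sum.cong refl) (simp add: power_divide)
    also have "\<dots> \<le> (\<Sum>k=1..K. \<bar>a k * L\<^sup>2 - (real N / real k)\<^sup>2 / 2\<bar>)" by (rule sum_abs)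
    also have "\<dots> \<le> (\<Sum>k=1..K. C * ((real N / real k)\<^sup>2 * \<epsilon>))"
      unfolding a_def
    proof (intro sum_mono ap)
      fix k assume k: "k \<in> {1..K}"
      thus "1 \<le> k" by simp
      have "real k \<le> real K" using k by simp
      thus "real k \<le> L ^ 3" using KL by linarith
    qed
    also have "\<dots> = C * ((real N)\<^sup>2 * \<epsilon>) * H" unfolding H_def by (simp add: sum_distrib_left power_divide mult_ac)
    also have "\<dots> \<le> C * ((real N)\<^sup>2 * \<epsilon>) * (pi\<^sup>2 / 6)" using C \<epsilon> H by (intro mult_left_mono) auto
    finally have 1: "\<bar>(\<Sum>k=1..K. a k) * L\<^sup>2 - (real N)\<^sup>2 / 2 * H\<bar> \<le> C * (pi\<^sup>2 / 6) * ((real N)\<^sup>2 * \<epsilon>)" by (simp add: mult_ac)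
    have "(\<Sum>k\<in>{K<..N}. a k) \<le> (\<Sum>k\<in>{K<..N}. (real N)\<^sup>2 * (1 / (real k)\<^sup>2))"
    proof (rule sum_mono)
      fix k assume "k \<in> {K<..N}"
      have "a k \<le> (real (N div k))\<^sup>2" unfolding a_def using goldbach_S_le[of "N div k"] by (metis of_nat_mono of_nat_power)
      also have "\<dots> \<le> (real N / real k)\<^sup>2" by (intro power_mono of_nat_div_le_of_nat) auto
      finally show "a k \<le> (real N)\<^sup>2 * (1 / (real k)\<^sup>2)" by (simp add: power_divide)
    qed
    also have "\<dots> = (real N)\<^sup>2 * (\<Sum>k\<in>{K<..N}. 1 / (real k)\<^sup>2)" by (simp add: sum_distrib_left)
    also have "\<dots> \<le> (real N)\<^sup>2 * (2 / L ^ 3)"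
    proof (intro mult_left_mono)
      have "0 \<le> 1 / real N" by simp
      thus "(\<Sum>k\<in>{K<..N}. 1 / (real k)\<^sup>2) \<le> 2 / L ^ 3" using sum_inverse_squares_tail[OF K1 KN] iK by linarith
    qed auto
    finally have "(\<Sum>k\<in>{K<..N}. a k) * L\<^sup>2 \<le> (real N)\<^sup>2 * (2 / L ^ 3) * L\<^sup>2" by (intro mult_right_mono) auto
    also have "\<dots> = 2 * ((real N)\<^sup>2 * (1 / L))" using L by (simp add: power2_eq_square power3_eq_cube)
    also have "\<dots> \<le> 2 * ((real N)\<^sup>2 * \<epsilon>)" using \<epsilon> by (intro mult_left_mono) auto
    finally have 2: "(\<Sum>k\<in>{K<..N}. a k) * L\<^sup>2 \<le> 2 * ((real N)\<^sup>2 * \<epsilon>)" .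
    have 3: "0 \<le> (\<Sum>k\<in>{K<..N}. a k) * L\<^sup>2" by (intro mult_nonneg_nonneg sum_nonneg) (auto simp: a_def)
    have "1 / real K \<le> 2 * (1 / L)"
    proof -
      have "L * 1 \<le> L * (L * L)" using L by (intro mult_left_mono) (auto intro: order_trans[OF _ mult_mono[of 1 L 1 L]])
      hence "2 / L ^ 3 \<le> 2 / L" using L by (intro divide_left_mono) (auto simp: power3_eq_cube)
      thus ?thesis using iK by simp
    qed
    also have "\<dots> \<le> 2 * \<epsilon>" using \<epsilon> by simp
    finally have "\<bar>H - pi\<^sup>2 / 6\<bar> \<le> 2 * \<epsilon>" using H by linarith
    hence "(real N)\<^sup>2 / 2 * \<bar>H - pi\<^sup>2 / 6\<bar> \<le> (real N)\<^sup>2 / 2 * (2 * \<epsilon>)" by (intro mult_left_mono) auto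
    hence "\<bar>(real N)\<^sup>2 / 2 * (H - pi\<^sup>2 / 6)\<bar> \<le> (real N)\<^sup>2 * \<epsilon>" by (simp add: abs_mult)
    hence 4: "\<bar>(real N)\<^sup>2 / 2 * H - pi\<^sup>2 * (real N)\<^sup>2 / 12\<bar> \<le> (real N)\<^sup>2 * \<epsilon>" by (simp add: algebra_simps)
    have "{1..N} = {1..K} \<union> {K<..N}" using KN by auto
    hence split: "(\<Sum>k=1..N. a k) = (\<Sum>k=1..K. a k) + (\<Sum>k\<in>{K<..N}. a k)"
      by (simp only:) (rule sum.union_disjoint; auto)
    have "\<bar>(\<Sum>k=1..N. a k) * L\<^sup>2 - pi\<^sup>2 * (real N)\<^sup>2 / 12\<bar> \<le> D * ((real N)\<^sup>2 * \<epsilon>)"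
      using 1 2 3 4 unfolding split D_def distrib_right abs_le_iff by linarith
    hence "\<bar>(\<Sum>k=1..N. a k) * L\<^sup>2 - pi\<^sup>2 * (real N)\<^sup>2 / 12\<bar> / L\<^sup>2 \<le> D * ((real N)\<^sup>2 * \<epsilon>) / L\<^sup>2" by (intro divide_right_mono) auto
    also have "\<bar>(\<Sum>k=1..N. a k) * L\<^sup>2 - pi\<^sup>2 * (real N)\<^sup>2 / 12\<bar> / L\<^sup>2 = \<bar>((\<Sum>k=1..N. a k) * L\<^sup>2 - pi\<^sup>2 * (real N)\<^sup>2 / 12) / L\<^sup>2\<bar>"
      by simp
    also have "((\<Sum>k=1..N. a k) * L\<^sup>2 - pi\<^sup>2 * (real N)\<^sup>2 / 12) / L\<^sup>2 = (\<Sum>k=1..N. a k) - pi\<^sup>2 * (real N)\<^sup>2 / (12 * L\<^sup>2)"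
      using L by (simp add: diff_divide_distrib)
    also have "D * ((real N)\<^sup>2 * \<epsilon>) / L\<^sup>2 = D * ((real N)\<^sup>2 * ln L / L ^ 3)"
      by (simp add: \<epsilon>_def power2_eq_square power3_eq_cube)
    finally show ?case by (simp add: a_def L_def)
  qed
  thus ?thesis using D by blast
qed

theorem theorem3p5:
  shows "(\<lambda>M::nat. real (goldbach_A M) - pi\<^sup>2 * (real M)\<^sup>2 / (3 * (ln (real M))\<^sup>2))
           \<in> O[at_top](\<lambda>M::nat. (real M)\<^sup>2 * ln (ln (real M)) / (ln (real M)) ^ 3)"
proof -
  obtain C where C: "C > 0" and ev: "\<forall>\<^sub>F N in at_top. \<bar>real (\<Sum>k=1..N. goldbach_S (N div k)) - pi\<^sup>2 * (real N)\<^sup>2 / (12 * (ln (real N))\<^sup>2)\<bar>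
     \<le> C * ((real N)\<^sup>2 * ln (ln (real N)) / ln (real N) ^ 3)"
    using goldbach_hyperbola_asymp by blast
  have "filterlim (\<lambda>M::nat. 2 * M) at_top at_top" by (rule mult_nat_left_at_top) simp
  from eventually_compose_filterlim[OF ev this]
  have "\<forall>\<^sub>F M in at_top. \<bar>real (goldbach_A M) - pi\<^sup>2 * (real (2 * M))\<^sup>2 / (12 * (ln (real (2 * M)))\<^sup>2)\<bar>
     \<le> C * ((real (2 * M))\<^sup>2 * ln (ln (real (2 * M))) / ln (real (2 * M)) ^ 3)"
    unfolding goldbach_A_eq .
  hence "\<forall>\<^sub>F M in at_top. norm (real (goldbach_A M) - pi\<^sup>2 * (real (2 * M))\<^sup>2 / (12 * (ln (real (2 * M)))\<^sup>2))
     \<le> C * norm ((real (2 * M))\<^sup>2 * ln (ln (real (2 * M))) / ln (real (2 * M)) ^ 3)"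
  proof eventually_elim
    case (elim M)
    moreover have "C * X \<le> C * norm X" for X :: real using C by (intro mult_left_mono) auto
    ultimately show ?case unfolding real_norm_def by (meson order_trans)
  qed
  hence "(\<lambda>M. real (goldbach_A M) - pi\<^sup>2 * (real (2 * M))\<^sup>2 / (12 * (ln (real (2 * M)))\<^sup>2))
      \<in> O(\<lambda>M. (real (2 * M))\<^sup>2 * ln (ln (real (2 * M))) / ln (real (2 * M)) ^ 3)" by (rule landau_o.bigI[OF C])
  also have "(\<lambda>M::nat. (real (2 * M))\<^sup>2 * ln (ln (real (2 * M))) / ln (real (2 * M)) ^ 3) \<in> O(\<lambda>M. (real M)\<^sup>2 * ln (ln (real M)) / (ln (real M)) ^ 3)"
    unfolding of_nat_mult of_nat_numeral by real_asymp
  finally have 1: "(\<lambda>M. real (goldbach_A M) - pi\<^sup>2 * (real (2 * M))\<^sup>2 / (12 * (ln (real (2 * M)))\<^sup>2))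
      \<in> O(\<lambda>M. (real M)\<^sup>2 * ln (ln (real M)) / (ln (real M)) ^ 3)" .
  \<comment> \<open>Here (2M)^2 / 12 = M^2 / 3, and ln (2M) = ln M + ln 2 changes the main term by
    O(M^2 / ln^3 M) only.\<close>
  have 2: "(\<lambda>M::nat. pi\<^sup>2 * (real (2 * M))\<^sup>2 / (12 * (ln (real (2 * M)))\<^sup>2) - pi\<^sup>2 * (real M)\<^sup>2 / (3 * (ln (real M))\<^sup>2))
      \<in> O(\<lambda>M. (real M)\<^sup>2 * ln (ln (real M)) / (ln (real M)) ^ 3)"
    unfolding of_nat_mult of_nat_numeral by real_asymp
  from sum_in_bigo(1)[OF 1 2] show ?thesis by simp
qed

end
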